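(* Let $-A$ be the generator of a bounded $C_0$-group on a Banach space $X$. Then $A$ admits the $\mathcal B$-calculus if and only if $A$ admits the $C_0(i\mathbb R)$-calculus.
   Context: $\mathbb C_+=\{z:\Re z>0\}$. $\mathcal B$ is the Banach algebra of holomorphic $f$ on $\mathbb C_+$ with $\|f\|_{\mathcal B_0}:=\int_0^\infty\sup_{\beta\in\mathbb R}|f'(\alpha+i\beta)|\,d\alpha<\infty$, with norm $\|f\|_{\mathcal B}=\sup_{\mathbb C_+}|f|+\|f\|_{\mathcal B_0}$. $r_z(\lambda)=(z+\lambda)^{-1}$. An operator $A$ on $X$ admits the $\mathcal B$-calculus if $A$ is densely defined, $\sigma(A)\subset\overline{\mathbb C}_+$, and there is a bounded algebra homomorphism $\Phi:\mathcal B\to L(X)$ with $\Phi(r_z)=(z+A)^{-1}$ for all $z\in\mathbb C_+$. A closed densely defined operator $A$ admits the $C_0(i\mathbb R)$-calculus if $\sigma(A)\subset i\mathbb R$ and there is a bounded algebra homomorphism $H:C_0(i\mathbb R)\to L(X)$ with $H(r_z)=(z+A)^{-1}$ for all $z\in\mathbb C\setminus i\mathbb R$ (here $r_z$ is restricted to $i\mathbb R$, and $C_0(i\mathbb R)$ is the algebra of continuous functions on $i\mathbb R$ vanishing at infinity with the sup norm). *)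

theory Defs
  imports "HOL-Analysis.Analysis" "HOL-Complex_Analysis.Complex_Analysis"
begin

class complex_banach = banach +
  fixes cscale :: "complex \<Rightarrow> 'a \<Rightarrow> 'a"
  assumes cscale_of_real: "cscale (complex_of_real r) x = r *\<^sub>R x"
    and cscale_add_right: "cscale a (x + y) = cscale a x + cscale a y"
    and cscale_add_left: "cscale (a + b) x = cscale a x + cscale b x"
    and cscale_assoc: "cscale a (cscale b x) = cscale (a * b) x"
    and norm_cscale: "norm (cscale a x) = norm a * norm x"

definition bounded_op :: "('a::complex_banach \<Rightarrow> 'a) \<Rightarrow> bool" where
  "bounded_op T \<longleftrightarrow> bounded_linear T \<and> (\<forall>c x. T (cscale c x) = cscale c (T x))"

text \<open>An (unbounded) operator is a pair of a domain D and a map A (only its values on D matter).\<close>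
definition densely_defined :: "'a::complex_banach set \<Rightarrow> bool" where
  "densely_defined D \<longleftrightarrow> closure D = UNIV"

definition lin_op :: "'a::complex_banach set \<Rightarrow> ('a \<Rightarrow> 'a) \<Rightarrow> bool" where
  "lin_op D A \<longleftrightarrow> 0 \<in> D \<and> (\<forall>x\<in>D. \<forall>y\<in>D. x + y \<in> D \<and> A (x + y) = A x + A y)
     \<and> (\<forall>c. \<forall>x\<in>D. cscale c x \<in> D \<and> A (cscale c x) = cscale c (A x))"

definition closed_op :: "'a::complex_banach set \<Rightarrow> ('a \<Rightarrow> 'a) \<Rightarrow> bool" where
  "closed_op D A \<longleftrightarrow> lin_op D A \<and> closed {(x, A x) | x. x \<in> D}"

definition is_inverse_shift :: "'a::complex_banach set \<Rightarrow> ('a \<Rightarrow> 'a) \<Rightarrow> complex \<Rightarrow> ('a \<Rightarrow> 'a) \<Rightarrow> bool" where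
  "is_inverse_shift D A z R \<longleftrightarrow>
     (\<forall>x\<in>D. R (cscale z x + A x) = x) \<and>
     (\<forall>y. R y \<in> D \<and> cscale z (R y) + A (R y) = y)"

definition resolvent_set :: "'a::complex_banach set \<Rightarrow> ('a \<Rightarrow> 'a) \<Rightarrow> complex set" where
  "resolvent_set D A = {w. \<exists>R. bounded_op R \<and>
     (\<forall>x\<in>D. R (cscale w x - A x) = x) \<and> (\<forall>y. R y \<in> D \<and> cscale w (R y) - A (R y) = y)}"

definition spectrum_op :: "'a::complex_banach set \<Rightarrow> ('a \<Rightarrow> 'a) \<Rightarrow> complex set" where
  "spectrum_op D A = - resolvent_set D A"

definition bounded_C0_group :: "(real \<Rightarrow> 'a::complex_banach \<Rightarrow> 'a) \<Rightarrow> bool" where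
  "bounded_C0_group T \<longleftrightarrow>
     (\<forall>t. bounded_op (T t)) \<and> T 0 = id \<and> (\<forall>s t. T (s + t) = T s \<circ> T t) \<and>
     (\<forall>x. continuous_on UNIV (\<lambda>t. T t x)) \<and> (\<exists>M. \<forall>t. onorm (T t) \<le> M)"

definition is_generator :: "(real \<Rightarrow> 'a::complex_banach \<Rightarrow> 'a) \<Rightarrow> 'a set \<Rightarrow> ('a \<Rightarrow> 'a) \<Rightarrow> bool" where
  "is_generator T D B \<longleftrightarrow>
     D = {x. \<exists>y. ((\<lambda>t. (1 / t) *\<^sub>R (T t x - x)) \<longlongrightarrow> y) (at 0)} \<and>
     (\<forall>x\<in>D. ((\<lambda>t. (1 / t) *\<^sub>R (T t x - x)) \<longlongrightarrow> B x) (at 0))"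

definition rhp :: "complex set" where
  "rhp = {z. Re z > 0}"

definition B0_integral :: "(complex \<Rightarrow> complex) \<Rightarrow> ennreal" where
  "B0_integral f = (\<integral>\<^sup>+ \<alpha>. indicator {0<..} \<alpha> *
      (SUP \<beta>::real. ennreal (norm (deriv f (Complex \<alpha> \<beta>)))) \<partial>lborel)"

definition B_alg :: "(complex \<Rightarrow> complex) set" where
  "B_alg = {f. f holomorphic_on rhp \<and> bounded (f ` rhp) \<and> B0_integral f < \<infinity>}"

definition B_norm :: "(complex \<Rightarrow> complex) \<Rightarrow> real" where
  "B_norm f = (SUP z\<in>rhp. norm (f z)) + enn2real (B0_integral f)"

definition rz :: "complex \<Rightarrow> complex \<Rightarrow> complex" where
  "rz z = (\<lambda>w. 1 / (z + w))"

definition iR :: "complex set" where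
  "iR = {z. Re z = 0}"

definition C0_iR :: "(complex \<Rightarrow> complex) set" where
  "C0_iR = {f. continuous_on iR f \<and>
     (\<forall>e>0. \<exists>R. \<forall>z\<in>iR. norm z \<ge> R \<longrightarrow> norm (f z) < e)}"

definition sup_norm_iR :: "(complex \<Rightarrow> complex) \<Rightarrow> real" where
  "sup_norm_iR f = (SUP z\<in>iR. norm (f z))"

definition bounded_alg_hom ::
  "(complex \<Rightarrow> complex) set \<Rightarrow> ((complex \<Rightarrow> complex) \<Rightarrow> real) \<Rightarrow>
   ((complex \<Rightarrow> complex) \<Rightarrow> 'a::complex_banach \<Rightarrow> 'a) \<Rightarrow> bool" where
  "bounded_alg_hom S nrm \<Phi> \<longleftrightarrow>
     (\<forall>f\<in>S. bounded_op (\<Phi> f)) \<and>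
     (\<forall>f\<in>S. \<forall>g\<in>S. \<Phi> (\<lambda>z. f z + g z) = (\<lambda>x. \<Phi> f x + \<Phi> g x)) \<and>
     (\<forall>c. \<forall>f\<in>S. \<Phi> (\<lambda>z. c * f z) = (\<lambda>x. cscale c (\<Phi> f x))) \<and>
     (\<forall>f\<in>S. \<forall>g\<in>S. \<Phi> (\<lambda>z. f z * g z) = \<Phi> f \<circ> \<Phi> g) \<and>
     (\<exists>C. \<forall>f\<in>S. onorm (\<Phi> f) \<le> C * nrm f)"

definition admits_B_calculus :: "'a::complex_banach set \<Rightarrow> ('a \<Rightarrow> 'a) \<Rightarrow> bool" where
  "admits_B_calculus D A \<longleftrightarrow>
     densely_defined D \<and> spectrum_op D A \<subseteq> closure rhp \<and>
     (\<exists>\<Phi>. bounded_alg_hom B_alg B_norm \<Phi> \<and>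
        (\<forall>z\<in>rhp. is_inverse_shift D A z (\<Phi> (rz z))))"

definition admits_C0_calculus :: "'a::complex_banach set \<Rightarrow> ('a \<Rightarrow> 'a) \<Rightarrow> bool" where
  "admits_C0_calculus D A \<longleftrightarrow>
     closed_op D A \<and> densely_defined D \<and> spectrum_op D A \<subseteq> iR \<and>
     (\<exists>H. bounded_alg_hom C0_iR sup_norm_iR H \<and>
        (\<forall>z. z \<notin> iR \<longrightarrow> is_inverse_shift D A z (H (rz z))))"

end

theory Submission
  imports Defs
begin

text \<open>
  Suppose first that \<open>A\<close> has a \<open>\<B>\<close>-calculus \<open>\<Phi>\<close>. Then \<open>\<Phi> (exp (- t z)) = T t\<close> for \<open>t \<ge> 0\<close>. Let \<open>h\<close> be
  entire with \<open>|h z| \<le> K exp (a |Re z|)\<close> and \<open>|h| \<le> m\<close> on \<open>i\<real>\<close>. By Phragmen-Lindelof \<open>K\<close> may be replaced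
  by \<open>m\<close>, and Cauchy's estimate on discs of radius \<open>1 / a\<close> shows that \<open>exp (- 2 a z) h z\<close> has \<open>\<B>\<close>-norm at most
  \<open>6 m\<close>, whatever \<open>a\<close> is. Since the group is bounded, \<open>h \<mapsto> T (- 2 a) \<circ> \<Phi> (exp (- 2 a z) h)\<close> is an algebra
  homomorphism bounded for the sup norm on \<open>i\<real>\<close>. The uniform closure of these \<open>h\<close> contains all resolvent
  functions, hence by Stone-Weierstrass all of \<open>C\<^sub>0(i\<real>)\<close>.

  Conversely, functions in \<open>\<B>\<close> have uniform boundary values on \<open>i\<real>\<close>, which are bounded and continuous, and
  a \<open>C\<^sub>0(i\<real>)\<close>-calculus extends to bounded continuous functions.
\<close>

section \<open>Complex Banach spaces and algebra homomorphisms\<close>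

text \<open>The homomorphism \<open>\<Phi>\<close> is prescribed on resolvents only, and
  \<open>exp_fn t\<close> does not tend to 1 in \<open>B_norm\<close> as \<open>t\<close> tends to
  0: its derivative contributes 1 for every positive \<open>t\<close>. So \<open>T t\<close> cannot
  be reached by norm limits at small times. Multiplication by the third power of a resolvent repairs
  this: the second order Taylor remainder of the exponential then has norm of order \<open>t\<close>
  squared, the group has the same expansion on the range of that power, and this range is dense. No
  vector-valued integral is involved. Resolvents are handled in the same spirit, through explicit
  truncated Laplace integrals whose product with \<open>w + z\<close> is elementary; for negative
  real part of \<open>w\<close> the truncation runs over negative times, which is where a bounded
  group is used instead of a semigroup.

  A second theme is bookkeeping. Elements of either algebra are total functions on the complex plane
  of which only the values on \<open>rhp\<close> or \<open>iR\<close> matter, so the homomorphisms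
  must be shown to respect equality there. They are not assumed unital either; identities and
  approximate identities come from the density of the domain.\<close>

lemma cscale_one [simp]: "cscale 1 (x::'a::complex_banach) = x"
  using cscale_of_real[of 1 x] by simp

lemma cscale_zero_left [simp]: "cscale 0 (x::'a::complex_banach) = 0"
  using cscale_of_real[of 0 x] by simp

lemma cscale_minus_left: "cscale (- c) (x::'a::complex_banach) = - cscale c x"
  using cscale_add_left[of c "- c" x] by (simp add: eq_neg_iff_add_eq_0 add.commute)

lemma bounded_linear_cscale: "bounded_linear (cscale c :: 'a::complex_banach \<Rightarrow> 'a)"
proof (rule bounded_linear_intro)
  fix x y :: 'a and r :: real
  show "cscale c (x + y) = cscale c x + cscale c y" by (rule cscale_add_right)
  show "cscale c (r *\<^sub>R x) = r *\<^sub>R cscale c x"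
    by (simp add: cscale_of_real[symmetric] cscale_assoc mult.commute)
  show "norm (cscale c x) \<le> norm x * norm c" by (simp add: norm_cscale)
qed

lemma cscale_minus_right: "cscale c (- x::'a::complex_banach) = - cscale c x"
  by (rule linear_neg[OF bounded_linear.linear[OF bounded_linear_cscale]])

lemma cscale_diff_right: "cscale c (x - y::'a::complex_banach) = cscale c x - cscale c y"
  by (rule linear_diff[OF bounded_linear.linear[OF bounded_linear_cscale]])

lemma cscale_diff_left: "cscale (a - b) (x::'a::complex_banach) = cscale a x - cscale b x"
  using cscale_add_left[of a "- b" x] by (simp add: cscale_minus_left)

lemma bounded_op_add: "bounded_op U \<Longrightarrow> U (x + y) = U x + U y"
  and bounded_op_diff: "bounded_op U \<Longrightarrow> U (x - y) = U x - U y"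
  and bounded_op_minus: "bounded_op U \<Longrightarrow> U (- x) = - U x"
  and bounded_op_zero: "bounded_op U \<Longrightarrow> U 0 = 0"
  and bounded_op_scaleR: "bounded_op U \<Longrightarrow> U (r *\<^sub>R x) = r *\<^sub>R U x"
  and bounded_op_cscale: "bounded_op U \<Longrightarrow> U (cscale c x) = cscale c (U x)"
  and bounded_op_bounded_linear: "bounded_op U \<Longrightarrow> bounded_linear U"
  by (simp_all add: bounded_op_def bounded_linear.linear linear_add linear_diff linear_neg
      linear_0 linear_scale)

lemma bounded_opI:
  fixes U :: "'a::complex_banach \<Rightarrow> 'a"
  assumes "\<And>x y. U (x + y) = U x + U y" "\<And>c x. U (cscale c x) = cscale c (U x)"
    "\<And>x. norm (U x) \<le> K * norm x"
  shows "bounded_op U"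
proof -
  have "bounded_linear U"
  proof (rule bounded_linear_intro)
    show "U (r *\<^sub>R x) = r *\<^sub>R U x" for r x
      using assms(2)[of "complex_of_real r" x] by (simp add: cscale_of_real)
    show "norm (U x) \<le> norm x * K" for x
      using assms(3)[of x] by (simp add: mult.commute)
  qed (rule assms(1))
  with assms(2) show ?thesis by (simp add: bounded_op_def)
qed

lemma bounded_op_comp: "bounded_op U \<Longrightarrow> bounded_op V \<Longrightarrow> bounded_op (U \<circ> V)"
  by (simp add: bounded_op_def comp_def bounded_linear_compose)

lemma bounded_op_eq_on_dense:
  assumes U: "bounded_op U" and V: "bounded_op V" and S: "closure S = UNIV"
    and eq: "\<And>x. x \<in> S \<Longrightarrow> U x = V x"
  shows "U = V"
proof
  fix x
  have "closed {x. U x = V x}"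
    by (intro closed_Collect_eq linear_continuous_on bounded_op_bounded_linear U V)
  moreover have "S \<subseteq> {x. U x = V x}" using eq by auto
  ultimately have "closure S \<subseteq> {x. U x = V x}" by (rule closure_minimal[rotated])
  thus "U x = V x" using S by auto
qed

text \<open>Applied repeatedly with \<open>U\<close> a resolvent, this makes the ranges of its
  powers dense, so that bounded operators need only be compared after two or three
  regularisations.\<close>

lemma dense_image:
  assumes U: "bounded_op U" and S: "closure S = UNIV" and r: "closure (range U) = UNIV"
  shows "closure (U ` S) = UNIV"
proof -
  have "U ` closure S \<subseteq> closure (U ` S)"
    by (intro continuous_image_closure_subset[OF linear_continuous_on[OF bounded_op_bounded_linear[OF U]]]) auto
  hence "range U \<subseteq> closure (U ` S)" using S by simp
  hence "closure (range U) \<subseteq> closure (U ` S)" by (intro closure_minimal) auto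
  thus ?thesis using r by auto
qed

lemma bounded_alg_homD:
  assumes "bounded_alg_hom S nrm \<Phi>"
  shows bounded_alg_hom_op: "f \<in> S \<Longrightarrow> bounded_op (\<Phi> f)"
    and bounded_alg_hom_add: "f \<in> S \<Longrightarrow> g \<in> S \<Longrightarrow> \<Phi> (\<lambda>z. f z + g z) x = \<Phi> f x + \<Phi> g x"
    and bounded_alg_hom_scale: "f \<in> S \<Longrightarrow> \<Phi> (\<lambda>z. c * f z) x = cscale c (\<Phi> f x)"
    and bounded_alg_hom_mult: "f \<in> S \<Longrightarrow> g \<in> S \<Longrightarrow> \<Phi> (\<lambda>z. f z * g z) x = \<Phi> f (\<Phi> g x)"
  using assms by (simp_all add: bounded_alg_hom_def)

lemma bounded_alg_hom_bound:
  assumes hom: "bounded_alg_hom S nrm \<Phi>" and nn: "\<And>f. f \<in> S \<Longrightarrow> 0 \<le> nrm f"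
  obtains C where "C \<ge> 0" "\<And>f x. f \<in> S \<Longrightarrow> norm (\<Phi> f x) \<le> C * nrm f * norm x"
proof -
  from hom obtain C where C: "\<forall>f\<in>S. onorm (\<Phi> f) \<le> C * nrm f"
    by (auto simp: bounded_alg_hom_def)
  show ?thesis
  proof
    \<comment> \<open>The definition leaves the sign of \<open>C\<close> open; nonnegativity of
      \<open>nrm\<close> lets the absolute value take its place.\<close>
    show "\<bar>C\<bar> \<ge> 0" by simp
    fix f x assume f: "f \<in> S"
    have "norm (\<Phi> f x) \<le> onorm (\<Phi> f) * norm x"
      by (intro onorm bounded_op_bounded_linear bounded_alg_hom_op[OF hom f])
    also have "\<dots> \<le> (\<bar>C\<bar> * nrm f) * norm x"
    proof (rule mult_right_mono)
      have "onorm (\<Phi> f) \<le> C * nrm f" using C f by blast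
      also have "\<dots> \<le> \<bar>C\<bar> * nrm f" by (intro mult_right_mono nn f) auto
      finally show "onorm (\<Phi> f) \<le> \<bar>C\<bar> * nrm f" .
    qed simp
    finally show "norm (\<Phi> f x) \<le> \<bar>C\<bar> * nrm f * norm x" .
  qed
qed

text \<open>A difference of norm zero is annihilated by the bound. This is what identifies the
  images of functions that agree on the relevant set but differ elsewhere. The difference is written
  with \<open>-1 *\<close> because a homomorphism is only given to respect sums and scalar
  multiples.\<close>

lemma bounded_alg_hom_cong:
  assumes hom: "bounded_alg_hom S nrm \<Phi>" and nn: "\<And>f. f \<in> S \<Longrightarrow> 0 \<le> nrm f"
    and f: "f \<in> S" and g: "g \<in> S" and m: "(\<lambda>z. -1 * g z) \<in> S"
    and d: "(\<lambda>z. f z + -1 * g z) \<in> S" "nrm (\<lambda>z. f z + -1 * g z) \<le> 0"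
  shows "\<Phi> f = \<Phi> g"
proof
  fix x
  obtain C where C: "C \<ge> 0" "\<And>f x. f \<in> S \<Longrightarrow> norm (\<Phi> f x) \<le> C * nrm f * norm x"
    using bounded_alg_hom_bound[OF hom nn] by metis
  have "nrm (\<lambda>z. f z + -1 * g z) = 0" using nn[OF d(1)] d(2) by simp
  hence "\<Phi> (\<lambda>z. f z + -1 * g z) x = 0" using C(2)[OF d(1), of x] by simp
  moreover have "\<Phi> (\<lambda>z. f z + -1 * g z) x = \<Phi> f x + cscale (-1) (\<Phi> g x)"
    using bounded_alg_hom_add[OF hom f m] bounded_alg_hom_scale[OF hom g] by metis
  ultimately show "\<Phi> f x = \<Phi> g x" by (simp add: cscale_minus_left)
qed

section \<open>The algebra of holomorphic functions on the half-plane\<close>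

lemma open_rhp: "open rhp" and rhp_ne: "rhp \<noteq> {}"
proof -
  show "open rhp" by (simp add: rhp_def open_halfspace_Re_gt)
  have "1 \<in> rhp" by (simp add: rhp_def)
  thus "rhp \<noteq> {}" by blast
qed

text \<open>Separated from the integral because its measurability needs an argument and because the
  seminorm is estimated through pointwise majorants of this function.\<close>

definition B0_sup :: "(complex \<Rightarrow> complex) \<Rightarrow> real \<Rightarrow> ennreal" where
  "B0_sup f \<alpha> = indicator {0<..} \<alpha> * (SUP \<beta>::real. ennreal (norm (deriv f (Complex \<alpha> \<beta>))))"

lemma B0_integral_eq: "B0_integral f = (\<integral>\<^sup>+ \<alpha>. B0_sup f \<alpha> \<partial>lborel)"
  by (simp add: B0_integral_def B0_sup_def)

lemma B0_sup_ge: "0 < Re z \<Longrightarrow> ennreal (norm (deriv f z)) \<le> B0_sup f (Re z)"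
  using SUP_upper[of "Im z" UNIV "\<lambda>\<beta>. ennreal (norm (deriv f (Complex (Re z) \<beta>)))"]
  by (simp add: B0_sup_def complex.collapse)

lemma B0_sup_le:
  assumes "\<And>\<beta>. 0 < \<alpha> \<Longrightarrow> ennreal (norm (deriv f (Complex \<alpha> \<beta>))) \<le> c"
  shows "B0_sup f \<alpha> \<le> c"
proof (cases "\<alpha> > 0")
  case True
  have "(SUP \<beta>::real. ennreal (norm (deriv f (Complex \<alpha> \<beta>)))) \<le> c"
    using assms[OF True] by (intro SUP_least)
  with True show ?thesis by (simp add: B0_sup_def)
qed (simp add: B0_sup_def)

text \<open>The supremum over the uncountable index \<open>\<beta>\<close> is lower semicontinuous in \<open>\<alpha>\<close>.\<close>

lemma borel_measurable_B0_sup [measurable]: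
  assumes f: "f holomorphic_on rhp"
  shows "B0_sup f \<in> borel_measurable borel"
proof (rule borel_measurableI_greater)
  fix y :: ennreal
  have cont: "continuous_on {0<..} (\<lambda>\<alpha>. ennreal (norm (deriv f (Complex \<alpha> \<beta>))))" for \<beta> :: real
  proof -
    have 1: "continuous_on rhp (deriv f)"
      by (intro holomorphic_on_imp_continuous_on holomorphic_deriv f open_rhp)
    have "continuous_on {0<..} (\<lambda>\<alpha>. deriv f (Complex \<alpha> \<beta>))"
      by (rule continuous_on_compose2[OF 1])
        (auto simp: rhp_def Complex_eq intro!: continuous_intros)
    thus ?thesis by (intro continuous_on_ennreal continuous_on_norm)
  qed
  have "{x \<in> space borel. y < B0_sup f x}
      = (\<Union>\<beta>. {0<..} \<inter> (\<lambda>\<alpha>. ennreal (norm (deriv f (Complex \<alpha> \<beta>)))) -` {y<..})"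
    by (auto simp: B0_sup_def less_SUP_iff indicator_def split: if_splits)
  also have "open \<dots>"
    by (intro open_UN ballI continuous_open_preimage cont) auto
  finally show "{x \<in> space borel. y < B0_sup f x} \<in> sets borel" by simp
qed

lemma B_algD:
  assumes "f \<in> B_alg"
  shows B_alg_holomorphic: "f holomorphic_on rhp"
    and B_alg_bdd: "bdd_above ((\<lambda>z. norm (f z)) ` rhp)"
    and B_alg_B0: "B0_integral f < \<infinity>"
  using assms by (auto simp: B_alg_def bounded_iff bdd_above_def)

lemma B_alg_norm_le: "f \<in> B_alg \<Longrightarrow> z \<in> rhp \<Longrightarrow> norm (f z) \<le> (SUP z\<in>rhp. norm (f z))"
  by (intro cSUP_upper B_alg_bdd)

lemma B_alg_sup_nonneg: "f \<in> B_alg \<Longrightarrow> 0 \<le> (SUP z\<in>rhp. norm (f z))"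
  by (rule order_trans[OF norm_ge_zero B_alg_norm_le[of f 1]]) (auto simp: rhp_def)

lemma B_norm_nonneg: "f \<in> B_alg \<Longrightarrow> 0 \<le> B_norm f"
  using B_alg_sup_nonneg[of f] by (simp add: B_norm_def)

lemma B_sup_le_B_norm: "(SUP z\<in>rhp. norm (f z)) \<le> B_norm f"
  by (simp add: B_norm_def)

text \<open>A majorant of the derivative that depends on the real part alone bounds the inner
  supremum; with a primitive \<open>G\<close> that tends to \<open>L\<close>, its integral over the
  half-line is \<open>L - G 0\<close>.\<close>

lemma B_algI:
  assumes f: "f holomorphic_on rhp" and m: "\<And>z. z \<in> rhp \<Longrightarrow> norm (f z) \<le> m"
    and d: "\<And>z. z \<in> rhp \<Longrightarrow> norm (deriv f z) \<le> g (Re z)"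
    and g: "g \<in> borel_measurable borel" "\<And>x. 0 \<le> x \<Longrightarrow> 0 \<le> g x"
    and G: "\<And>x. 0 \<le> x \<Longrightarrow> (G has_real_derivative g x) (at x)" "(G \<longlongrightarrow> L) at_top"
  shows "f \<in> B_alg" and "B_norm f \<le> m + (L - G 0)"
proof -
  have "G 0 \<le> L"
  proof (rule tendsto_lowerbound[OF G(2)])
    show "eventually (\<lambda>x. G 0 \<le> G x) at_top"
      using eventually_ge_at_top[of "0::real"]
    proof eventually_elim
      case (elim x)
      show ?case
        by (rule DERIV_nonneg_imp_nondecreasing[OF elim]) (use G(1) g(2) in blast)
    qed
  qed simp
  have "B0_integral f \<le> (\<integral>\<^sup>+ x. ennreal (g x) * indicator {0..} x \<partial>lborel)"
    unfolding B0_integral_eq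
  proof (rule nn_integral_mono)
    fix x :: real
    show "B0_sup f x \<le> ennreal (g x) * indicator {0..} x"
      by (intro B0_sup_le) (use d[of "Complex x _"] in \<open>auto simp: rhp_def intro!: ennreal_leI\<close>)
  qed
  also have "\<dots> = ennreal (L - G 0)"
    by (rule nn_integral_FTC_atLeast) (use g G in auto)
  finally have B0: "B0_integral f \<le> ennreal (L - G 0)" .
  show "f \<in> B_alg"
    using f m B0 by (auto simp: B_alg_def bounded_iff intro: order.strict_trans1)
  have "(SUP z\<in>rhp. norm (f z)) \<le> m" by (intro cSUP_least rhp_ne m)
  moreover have "enn2real (B0_integral f) \<le> L - G 0"
    using B0 \<open>G 0 \<le> L\<close> by (simp add: enn2real_leI)
  ultimately show "B_norm f \<le> m + (L - G 0)" by (simp add: B_norm_def)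
qed

text \<open>The rate cancels: \<open>a * K * exp (- a * x)\<close> has integral \<open>K\<close>
  over the half-line. This cancellation is why the norms obtained below depend neither on the time
  \<open>t\<close> nor on the exponential type.\<close>

lemma B_algI_exp:
  assumes "f holomorphic_on rhp" "\<And>z. z \<in> rhp \<Longrightarrow> norm (f z) \<le> m" "a > 0" "K \<ge> 0"
    and "\<And>z. z \<in> rhp \<Longrightarrow> norm (deriv f z) \<le> a * K * exp (- a * Re z)"
  shows "f \<in> B_alg" "B_norm f \<le> m + K"
proof -
  note * = B_algI[of f m "\<lambda>x. a * K * exp (- a * x)" "\<lambda>x. - K * exp (- a * x)" 0]
  have d: "((\<lambda>x. - K * exp (- a * x)) has_real_derivative a * K * exp (- a * x)) (at x)" for x
    by (auto intro!: derivative_eq_intros)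
  have "((\<lambda>x. exp (- a * x)) \<longlongrightarrow> 0) at_top"
    using \<open>a > 0\<close> 
    by (intro filterlim_compose[OF exp_at_bot] filterlim_tendsto_neg_mult_at_bot[OF tendsto_const _ filterlim_ident]) auto
  from tendsto_mult_left[OF this, of "- K"] have l: "((\<lambda>x. - K * exp (- a * x)) \<longlongrightarrow> 0) at_top" by simp
  have "f \<in> B_alg \<and> B_norm f \<le> m + (0 - - K * exp (- a * 0))"
    using * assms d l by (simp add: borel_measurable_times)
  thus "f \<in> B_alg" "B_norm f \<le> m + K" by simp_all
qed

text \<open>The majorant has total mass \<open>K / a\<close>. Inverse squares arise from
  differentiating resolvents, where no exponential decay is available.\<close>

lemma B_algI_inverse_square:
  assumes "f holomorphic_on rhp" "\<And>z. z \<in> rhp \<Longrightarrow> norm (f z) \<le> m" "a > 0" "K \<ge> 0"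
    and "\<And>z. z \<in> rhp \<Longrightarrow> norm (deriv f z) \<le> K / (a + Re z)\<^sup>2"
  shows "f \<in> B_alg" "B_norm f \<le> m + K / a"
proof -
  note * = B_algI[of f m "\<lambda>x. K / (a + x)\<^sup>2" "\<lambda>x. - K / (a + x)" 0]
  have d: "((\<lambda>x. - K / (a + x)) has_real_derivative K / (a + x)\<^sup>2) (at x)" if "x \<ge> 0" for x
    using that \<open>a > 0\<close> by (auto intro!: derivative_eq_intros simp: power2_eq_square)
  have l: "((\<lambda>x. - K / (a + x)) \<longlongrightarrow> 0) at_top"
    by (intro tendsto_divide_0[OF tendsto_const] filterlim_at_top_imp_at_infinity
        filterlim_tendsto_add_at_top[OF tendsto_const filterlim_ident])
  have "f \<in> B_alg \<and> B_norm f \<le> m + (0 - - K / (a + 0))"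
    using * assms d l by simp
  thus "f \<in> B_alg" "B_norm f \<le> m + K / a" by simp_all
qed

text \<open>Gives closure under sums and products in one stroke. For products the Leibniz rule
  supplies the weights: \<open>a\<close> and \<open>b\<close> are the sup norms of the opposite
  factors.\<close>

lemma B_alg_dominated:
  assumes f: "f \<in> B_alg" and g: "g \<in> B_alg" and h: "h holomorphic_on rhp"
    and m: "\<And>z. z \<in> rhp \<Longrightarrow> norm (h z) \<le> m" and ab: "0 \<le> a" "0 \<le> b"
    and d: "\<And>z. z \<in> rhp \<Longrightarrow> norm (deriv h z) \<le> a * norm (deriv f z) + b * norm (deriv g z)"
  shows "h \<in> B_alg"
proof -
  note [measurable] = borel_measurable_B0_sup[OF B_alg_holomorphic[OF f]]
    borel_measurable_B0_sup[OF B_alg_holomorphic[OF g]]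
  have "B0_integral h \<le> (\<integral>\<^sup>+ x. ennreal a * B0_sup f x + ennreal b * B0_sup g x \<partial>lborel)"
    unfolding B0_integral_eq
  proof (intro nn_integral_mono B0_sup_le)
    fix \<alpha> \<beta> :: real assume "0 < \<alpha>"
    let ?z = "Complex \<alpha> \<beta>"
    have z: "?z \<in> rhp" using \<open>0 < \<alpha>\<close> by (simp add: rhp_def)
    have "ennreal (norm (deriv h ?z)) \<le> ennreal (a * norm (deriv f ?z) + b * norm (deriv g ?z))"
      by (intro ennreal_leI d z)
    also have "\<dots> = ennreal a * ennreal (norm (deriv f ?z)) + ennreal b * ennreal (norm (deriv g ?z))"
      using ab by (simp add: ennreal_mult)
    also have "\<dots> \<le> ennreal a * B0_sup f \<alpha> + ennreal b * B0_sup g \<alpha>"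
      using B0_sup_ge[of ?z f] B0_sup_ge[of ?z g] \<open>0 < \<alpha>\<close>
      by (intro add_mono mult_left_mono) auto
    finally show "ennreal (norm (deriv h ?z)) \<le> ennreal a * B0_sup f \<alpha> + ennreal b * B0_sup g \<alpha>" .
  qed
  also have "\<dots> = ennreal a * B0_integral f + ennreal b * B0_integral g"
    by (simp add: nn_integral_add nn_integral_cmult B0_integral_eq)
  also have "\<dots> < \<infinity>" using B_alg_B0[OF f] B_alg_B0[OF g] by (simp add: ennreal_mult_less_top)
  finally show ?thesis using h m by (auto simp: B_alg_def bounded_iff)
qed

lemma B_alg_differentiable: "f \<in> B_alg \<Longrightarrow> z \<in> rhp \<Longrightarrow> f field_differentiable at z"
  using B_alg_holomorphic open_rhp holomorphic_on_imp_differentiable_at by blast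

lemma B_alg_const: "(\<lambda>z. c) \<in> B_alg"
  using B_algI_exp[of "\<lambda>z. c" "norm c" 1 0] by simp

lemma B_alg_mult:
  assumes f: "f \<in> B_alg" and g: "g \<in> B_alg"
  shows "(\<lambda>z. f z * g z) \<in> B_alg"
proof (rule B_alg_dominated[OF f g])
  let ?F = "SUP z\<in>rhp. norm (f z)" and ?G = "SUP z\<in>rhp. norm (g z)"
  show "(\<lambda>z. f z * g z) holomorphic_on rhp"
    by (intro holomorphic_intros B_alg_holomorphic f g)
  show "0 \<le> ?G" "0 \<le> ?F" using f g by (auto intro: B_alg_sup_nonneg)
  fix z assume z: "z \<in> rhp"
  note le = B_alg_norm_le[OF f z] B_alg_norm_le[OF g z]
  show "norm (f z * g z) \<le> ?F * ?G"
    unfolding norm_mult using le by (intro mult_mono B_alg_sup_nonneg f) auto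
  have "deriv (\<lambda>z. f z * g z) z = f z * deriv g z + deriv f z * g z"
    by (intro deriv_mult B_alg_differentiable f g z)
  hence "norm (deriv (\<lambda>z. f z * g z) z) \<le> norm (f z) * norm (deriv g z) + norm (deriv f z) * norm (g z)"
    by (metis norm_triangle_ineq norm_mult)
  also have "\<dots> \<le> ?F * norm (deriv g z) + norm (deriv f z) * ?G"
    by (intro add_mono mult_right_mono mult_left_mono le) auto
  finally show "norm (deriv (\<lambda>z. f z * g z) z) \<le> ?G * norm (deriv f z) + ?F * norm (deriv g z)"
    by (simp add: algebra_simps)
qed

lemma B_alg_scale: "f \<in> B_alg \<Longrightarrow> (\<lambda>z. c * f z) \<in> B_alg"
  by (rule B_alg_mult[OF B_alg_const])

lemma B_alg_add:
  assumes f: "f \<in> B_alg" and g: "g \<in> B_alg"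
  shows "(\<lambda>z. f z + g z) \<in> B_alg"
proof (rule B_alg_dominated[OF f g])
  let ?F = "SUP z\<in>rhp. norm (f z)" and ?G = "SUP z\<in>rhp. norm (g z)"
  show "(\<lambda>z. f z + g z) holomorphic_on rhp"
    by (intro holomorphic_intros B_alg_holomorphic f g)
  fix z assume z: "z \<in> rhp"
  show "norm (f z + g z) \<le> ?F + ?G"
    by (rule norm_triangle_mono[OF B_alg_norm_le[OF f z] B_alg_norm_le[OF g z]])
  have "deriv (\<lambda>z. f z + g z) z = deriv f z + deriv g z"
    by (intro deriv_add B_alg_differentiable f g z)
  thus "norm (deriv (\<lambda>z. f z + g z) z) \<le> 1 * norm (deriv f z) + 1 * norm (deriv g z)"
    by (simp add: norm_triangle_ineq)
qed auto

text \<open>Nothing is known about \<open>f\<close> outside \<open>rhp\<close>, but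
  \<open>rhp\<close> is open, so each of its points has a neighbourhood on which \<open>f\<close>
  vanishes and the derivative is zero as well.\<close>

lemma B_norm_zero_on:
  assumes "\<And>z. z \<in> rhp \<Longrightarrow> f z = 0"
  shows "B_norm f \<le> 0"
proof -
  have h: "f holomorphic_on rhp" using holomorphic_cong[of rhp rhp f "\<lambda>_. 0"] assms by simp
  have "deriv f z = 0" if "z \<in> rhp" for z
  proof -
    have "deriv f z = deriv (\<lambda>_. 0) z"
      using eventually_nhds_in_open[OF open_rhp that]
      by (intro deriv_cong_ev) (auto elim!: eventually_mono simp: assms)
    thus ?thesis by simp
  qed
  thus ?thesis using B_algI_exp(2)[of f 0 1 0] h assms by simp
qed

lemma bounded_alg_hom_B_cong:
  assumes hom: "bounded_alg_hom B_alg B_norm \<Phi>" and f: "f \<in> B_alg" and g: "g \<in> B_alg"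
    and eq: "\<And>z. z \<in> rhp \<Longrightarrow> f z = g z"
  shows "\<Phi> f = \<Phi> g"
  by (rule bounded_alg_hom_cong[OF hom B_norm_nonneg f g B_alg_scale[OF g]
        B_alg_add[OF f B_alg_scale[OF g]] B_norm_zero_on]) (auto simp: eq)

section \<open>Resolvent functions and exponentials as elements of the algebra\<close>

lemma rz_in_B_alg:
  assumes "w \<in> rhp"
  shows "rz w \<in> B_alg"
proof (rule B_algI_inverse_square(1))
  have nz: "w + z \<noteq> 0" if "z \<in> rhp" for z
    using that assms by (auto simp: rhp_def complex_eq_iff)
  have ge: "Re w + Re z \<le> norm (w + z)" for z
    using complex_Re_le_cmod[of "w + z"] by simp
  show "rz w holomorphic_on rhp" unfolding rz_def using nz by (intro holomorphic_intros) auto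
  show "Re w > 0" using assms by (simp add: rhp_def)
  show "(0::real) \<le> 1" by simp
  fix z assume z: "z \<in> rhp"
  show "norm (rz w z) \<le> 1 / Re w"
    using ge[of z] z assms unfolding rz_def norm_divide rhp_def by (simp add: frac_le)
  have "(rz w has_field_derivative - (1 / (w + z)\<^sup>2)) (at z)"
    unfolding rz_def using nz[OF z] by (auto intro!: derivative_eq_intros simp: power2_eq_square)
  hence "deriv (rz w) z = - (1 / (w + z)\<^sup>2)" by (rule DERIV_imp_deriv)
  thus "norm (deriv (rz w) z) \<le> 1 / (Re w + Re z)\<^sup>2"
    using ge[of z] z assms nz[OF z]
    by (simp add: norm_divide norm_power rhp_def) (intro divide_left_mono power_mono, auto)
qed

definition exp_fn :: "real \<Rightarrow> complex \<Rightarrow> complex" where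
  "exp_fn t z = exp (- of_real t * z)"

lemma exp_fn_0 [simp]: "exp_fn 0 = (\<lambda>z. 1)"
  by (simp add: exp_fn_def fun_eq_iff)

lemma exp_fn_add: "exp_fn (s + t) z = exp_fn s z * exp_fn t z"
  by (simp add: exp_fn_def exp_add[symmetric] algebra_simps)

lemma norm_exp_fn: "norm (exp_fn t z) = exp (- t * Re z)"
  by (simp add: exp_fn_def)

lemma exp_fn_holomorphic [holomorphic_intros]: "exp_fn t holomorphic_on S"
  unfolding exp_fn_def[abs_def] by (intro holomorphic_intros)

lemma exp_fn_deriv: "(exp_fn t has_field_derivative (- of_real t * exp_fn t z)) (at z within S)"
  unfolding exp_fn_def[abs_def] by (auto intro!: derivative_eq_intros)

lemma exp_fn_in_B_alg:
  assumes "t \<ge> 0"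
  shows "exp_fn t \<in> B_alg" and "B_norm (exp_fn t) \<le> 2"
proof -
  have "exp_fn t \<in> B_alg \<and> B_norm (exp_fn t) \<le> 2"
  proof (cases "t = 0")
    case True
    thus ?thesis using B_algI_exp[of "\<lambda>z. 1" 1 1 0] by simp
  next
    case False
    have "norm (deriv (exp_fn t) z) = t * exp (- t * Re z)" for z
      using DERIV_imp_deriv[OF exp_fn_deriv[of t z UNIV]] assms
      by (simp add: norm_mult norm_exp_fn)
    thus ?thesis using B_algI_exp[of "exp_fn t" 1 t 1] False assms
      by (simp add: exp_fn_holomorphic norm_exp_fn rhp_def)
  qed
  thus "exp_fn t \<in> B_alg" "B_norm (exp_fn t) \<le> 2" by auto
qed

section \<open>Estimates for exponentials and functions of exponential type\<close>

text \<open>Mean value estimate along the segment from 0 to \<open>z\<close>, on which the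
  exponential has modulus at most \<open>exp |Re z|\<close>. It later controls the growth of
  truncated resolvents.\<close>

lemma norm_one_minus_exp_le:
  "norm (1 - exp z) \<le> norm z * exp \<bar>Re z\<bar>" for z :: complex
proof -
  have "norm (exp 0 - exp z) \<le> exp \<bar>Re z\<bar> * norm (0 - z)"
  proof (rule field_differentiable_bound[where S = "closed_segment 0 z" and f' = exp])
    fix u assume "u \<in> closed_segment 0 z"
    then obtain r where r: "0 \<le> r" "r \<le> 1" "u = of_real r * z"
      by (auto simp: in_segment scaleR_conv_of_real)
    have "r * Re z \<le> r * \<bar>Re z\<bar>" using r by (intro mult_left_mono) auto
    also have "\<dots> \<le> 1 * \<bar>Re z\<bar>" using r by (intro mult_right_mono) auto
    finally have "r * Re z \<le> \<bar>Re z\<bar>" by simp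
    thus "norm (exp u) \<le> exp \<bar>Re z\<bar>" using r by simp
  qed (auto intro!: derivative_eq_intros)
  thus ?thesis by (simp add: mult.commute)
qed

text \<open>The closed right half-plane is convex, and there the derivative of
  \<open>exp (- z)\<close> has modulus at most 1.\<close>

lemma norm_exp_minus_one_le:
  assumes "Re w \<ge> 0" shows "norm (1 - exp (- w)) \<le> norm (w::complex)"
proof -
  have "norm (exp (- w) - exp (- 0)) \<le> 1 * norm (w - 0)"
    by (rule field_differentiable_bound[where S = "{z. Re z \<ge> 0}" and f' = "\<lambda>z. - exp (- z)"])
      (auto intro!: derivative_eq_intros convex_halfspace_Re_ge simp: assms)
  thus ?thesis by (simp add: norm_minus_commute)
qed

text \<open>One more mean value estimate, on the half disc of radius \<open>norm w\<close>, where
  the first order bound controls the derivative \<open>1 - exp (- z)\<close>. The lost factor 1/2 is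
  harmless.\<close>

lemma norm_exp_taylor2_le:
  assumes "Re w \<ge> 0" shows "norm (exp (- w) - 1 + w) \<le> (norm (w::complex))\<^sup>2"
proof -
  have "norm ((exp (- w) - 1 + w) - (exp (- 0) - 1 + 0)) \<le> norm w * norm (w - 0)"
  proof (rule field_differentiable_bound[where S = "{z. Re z \<ge> 0} \<inter> cball 0 (norm w)" 
        and f' = "\<lambda>z. 1 - exp (- z)"])
    fix z assume "z \<in> {z. Re z \<ge> 0} \<inter> cball 0 (norm w)"
    thus "norm (1 - exp (- z)) \<le> norm w"
      using norm_exp_minus_one_le[of z] by auto
  qed (auto intro!: derivative_eq_intros convex_Int convex_halfspace_Re_ge simp: assms)
  thus ?thesis by (simp add: power2_eq_square)
qed

text \<open>The third power of the resolvent makes the derivative integrable in the real part.\<close>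

lemma B_norm_exp_taylor2:
  assumes t: "t \<ge> 0"
  defines "f \<equiv> \<lambda>z. (exp_fn t z - 1 + of_real t * z) * rz 1 z ^ 3"
  shows "f \<in> B_alg" and "B_norm f \<le> 5 * t\<^sup>2"
proof -
  have one: "Re z + 1 \<le> norm (1 + z)" for z
    using complex_Re_le_cmod[of "1 + z"] by simp
  have nz: "1 + z \<noteq> 0" if "z \<in> rhp" for z :: complex
    using that by (auto simp: rhp_def complex_eq_iff)
  have zle: "norm z \<le> norm (1 + z)" if "z \<in> rhp" for z :: complex
    unfolding cmod_def using that by (intro real_sqrt_le_mono) (auto simp: rhp_def intro!: power_mono)
  have e1: "norm (1 - exp_fn t z) \<le> t * norm z" if "z \<in> rhp" for z
    using norm_exp_minus_one_le[of "of_real t * z"] that t by (simp add: rhp_def exp_fn_def norm_mult)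
  have e2: "norm (exp_fn t z - 1 + of_real t * z) \<le> t\<^sup>2 * (norm z)\<^sup>2" if "z \<in> rhp" for z
    using norm_exp_taylor2_le[of "of_real t * z"] that t
    by (simp add: rhp_def exp_fn_def norm_mult power_mult_distrib)
  have hol: "f holomorphic_on rhp"
    unfolding f_def rz_def using nz by (intro holomorphic_intros) auto
  have bd: "norm (f z) \<le> t\<^sup>2" if z: "z \<in> rhp" for z
  proof -
    have "norm (f z) \<le> (t\<^sup>2 * (norm z)\<^sup>2) / norm (1 + z) ^ 3"
      using e2[OF z]
      by (simp add: f_def rz_def norm_mult norm_divide norm_power power_one_over divide_simps mult_right_mono)
    also have "\<dots> \<le> (t\<^sup>2 * (norm (1 + z))\<^sup>2) / norm (1 + z) ^ 3"
      using zle[OF z] by (intro divide_right_mono mult_left_mono power_mono) auto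
    also have "\<dots> = t\<^sup>2 / norm (1 + z)" using nz[OF z] by (simp add: power3_eq_cube power2_eq_square)
    also have "\<dots> \<le> t\<^sup>2 / 1"
      using one[of z] z nz[OF z] by (intro divide_left_mono) (auto simp: rhp_def)
    finally show ?thesis by simp
  qed
  have dv: "norm (deriv f z) \<le> 4 * t\<^sup>2 / (1 + Re z)\<^sup>2" if z: "z \<in> rhp" for z
  proof -
    let ?n = "norm (1 + z)"
    have n0: "?n > 0" using nz[OF z] by simp
    have "(f has_field_derivative (of_real t * (1 - exp_fn t z)) * (1 / (1 + z)) ^ 3
        - 3 * (exp_fn t z - 1 + of_real t * z) * (1 / (1 + z)) ^ 4) (at z)"
    proof -
      have r: "(rz 1 has_field_derivative - (rz 1 z)\<^sup>2) (at z)"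
        unfolding rz_def using nz[OF z] by (auto intro!: derivative_eq_intros simp: power2_eq_square)
      have g: "((\<lambda>z. exp_fn t z - 1 + of_real t * z) has_field_derivative
          (- of_real t * exp_fn t z - 0 + of_real t * 1)) (at z)"
        by (intro DERIV_add DERIV_diff exp_fn_deriv DERIV_const DERIV_cmult DERIV_ident)
      have "(f has_field_derivative (- of_real t * exp_fn t z - 0 + of_real t * 1) * rz 1 z ^ 3
          + (of_nat 3 * (- (rz 1 z)\<^sup>2 * rz 1 z ^ (3 - Suc 0))) * (exp_fn t z - 1 + of_real t * z)) (at z)"
        unfolding f_def by (rule DERIV_mult[OF g DERIV_power[OF r]])
      moreover have "1 / (1 + z) = rz 1 z" by (simp add: rz_def)
      ultimately show ?thesis
        by (elim DERIV_cong) (simp add: algebra_simps eval_nat_numeral)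
    qed
    hence "deriv f z = (of_real t * (1 - exp_fn t z)) * (1 / (1 + z)) ^ 3
        - 3 * (exp_fn t z - 1 + of_real t * z) * (1 / (1 + z)) ^ 4"
      by (rule DERIV_imp_deriv)
    also have "norm \<dots> \<le> norm ((of_real t * (1 - exp_fn t z)) * (1 / (1 + z)) ^ 3)
        + norm (3 * (exp_fn t z - 1 + of_real t * z) * (1 / (1 + z)) ^ 4)"
      by (rule norm_triangle_ineq4)
    also have "\<dots> \<le> (t * (t * ?n)) * (1 / ?n) ^ 3 + (3 * (t\<^sup>2 * ?n\<^sup>2)) * (1 / ?n) ^ 4"
    proof (rule add_mono)
      have "norm (1 - exp_fn t z) \<le> t * ?n"
        using e1[OF z] zle[OF z] t by (meson mult_left_mono order_trans)
      thus "norm ((of_real t * (1 - exp_fn t z)) * (1 / (1 + z)) ^ 3) \<le> (t * (t * ?n)) * (1 / ?n) ^ 3"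
        unfolding norm_mult norm_power norm_divide using t
        by (intro mult_mono) (auto simp: norm_divide)
      have "norm (exp_fn t z - 1 + of_real t * z) \<le> t\<^sup>2 * ?n\<^sup>2"
        using e2[OF z] zle[OF z] by (meson mult_left_mono order_trans power_mono norm_ge_zero zero_le_power2)
      thus "norm (3 * (exp_fn t z - 1 + of_real t * z) * (1 / (1 + z)) ^ 4)
          \<le> (3 * (t\<^sup>2 * ?n\<^sup>2)) * (1 / ?n) ^ 4"
        unfolding norm_mult norm_power norm_divide
        by (intro mult_mono) auto
    qed
    \<comment> \<open>The 4 is 1 from differentiating the numerator plus 3 from the third power; the
      sup bound supplies the remaining 1 of the constant 5.\<close>
    also have "\<dots> = 4 * t\<^sup>2 / ?n\<^sup>2"
      using n0 by (simp add: field_simps power2_eq_square power3_eq_cube power4_eq_xxxx)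
    also have "\<dots> \<le> 4 * t\<^sup>2 / (1 + Re z)\<^sup>2"
      using one[of z] n0 z by (intro divide_left_mono power_mono mult_pos_pos) (auto simp: rhp_def)
    finally show ?thesis .
  qed
  show "f \<in> B_alg" "B_norm f \<le> 5 * t\<^sup>2"
    using B_algI_inverse_square[of f "t\<^sup>2" 1 "4 * t\<^sup>2"] hol bd dv by auto
qed

text \<open>Bounded Phragmen-Lindelof: divide by \<open>1 + \<epsilon>z\<close>, apply the maximum principle on large half discs
  and let \<open>\<epsilon>\<close> tend to zero.\<close>

lemma phragmen_lindelof_halfplane:
  assumes k: "k holomorphic_on UNIV"
    and K: "\<And>z. Re z \<ge> 0 \<Longrightarrow> norm (k z) \<le> K"
    and m: "\<And>z. Re z = 0 \<Longrightarrow> norm (k z) \<le> m" and z0: "Re z0 \<ge> 0"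
  shows "norm (k z0) \<le> m"
proof (rule field_le_epsilon)
  fix d :: real assume "d > 0"
  have m0: "m \<ge> 0" by (rule order_trans[OF norm_ge_zero m[of 0]]) simp
  \<comment> \<open>Strictly positive even if \<open>m = 0\<close>, so that it may stand in the
    denominator that fixes \<open>R\<close>.\<close>
  define b where "b = m + d"
  have b: "b > 0" using m0 \<open>d > 0\<close> by (simp add: b_def)
  have eps: "norm (k z0) \<le> b * norm (1 + of_real \<epsilon> * z0)" if e: "\<epsilon> > 0" for \<epsilon> :: real
  proof -
    \<comment> \<open>Large enough for the disc to contain \<open>z0\<close> and for
      \<open>K / (\<epsilon> * R)\<close> to be at most \<open>b\<close> on the arc; adding 1 keeps
      it positive.\<close>
    define R where "R = max (norm z0) (K / (\<epsilon> * b)) + 1"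
    define S where "S = {z. Re z \<ge> 0} \<inter> cball (0::complex) R"
    have "0 \<le> max (norm z0) (K / (\<epsilon> * b))" by (simp add: le_max_iff_disj)
    hence R0: "R > 0" and Rz: "norm z0 \<le> R" and RK: "K / (\<epsilon> * b) \<le> R"
      by (auto simp: R_def)
    have n1: "1 \<le> norm (1 + of_real \<epsilon> * z)" if "Re z \<ge> 0" for z
      using complex_Re_le_cmod[of "1 + of_real \<epsilon> * z"] that e by simp (smt (verit) mult_nonneg_nonneg)
    have n2: "\<epsilon> * norm z \<le> norm (1 + of_real \<epsilon> * z)" if "Re z \<ge> 0" for z
    proof -
      have "norm (of_real \<epsilon> * z) \<le> norm (1 + of_real \<epsilon> * z)"
        unfolding cmod_def using that e by (intro real_sqrt_le_mono) (auto intro!: power_mono)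
      thus ?thesis using e by (simp add: norm_mult)
    qed
    have nz: "1 + of_real \<epsilon> * z \<noteq> 0" if "Re z \<ge> 0" for z
      using n1[OF that] by auto
    have cl: "closed S" unfolding S_def by (intro closed_Int closed_halfspace_Re_ge closed_cball)
    \<comment> \<open>Consequently a frontier point of \<open>S\<close> off the axis lies on the arc
      \<open>norm z = R\<close>.\<close>
    have sub: "{z. Re z > 0} \<inter> ball 0 R \<subseteq> interior S"
      by (rule interior_maximal) (auto simp: S_def intro!: open_Int open_halfspace_Re_gt)
    have "norm (k z0 / (1 + of_real \<epsilon> * z0)) \<le> b"
    proof (rule maximum_modulus_frontier[where S = S and f = "\<lambda>z. k z / (1 + of_real \<epsilon> * z)"])
      show "(\<lambda>z. k z / (1 + of_real \<epsilon> * z)) holomorphic_on interior S"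
        using interior_subset[of S] nz
        by (intro holomorphic_intros holomorphic_on_subset[OF k]) (auto simp: S_def)
      show "continuous_on (closure S) (\<lambda>z. k z / (1 + of_real \<epsilon> * z))"
        using cl nz by (intro continuous_intros
            continuous_on_subset[OF holomorphic_on_imp_continuous_on[OF k]]) (auto simp: S_def)
      show "bounded S" unfolding S_def by (intro bounded_Int) auto
      show "z0 \<in> S" using z0 Rz by (auto simp: S_def)
      fix z assume "z \<in> frontier S"
      hence zS: "z \<in> S" and zi: "z \<notin> interior S" using cl by (auto simp: frontier_def)
      have re: "Re z \<ge> 0" using zS by (simp add: S_def)
      show "norm (k z / (1 + of_real \<epsilon> * z)) \<le> b"
      proof (cases "Re z = 0")
        case True
        have "norm (k z / (1 + of_real \<epsilon> * z)) \<le> m / 1"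
          unfolding norm_divide using n1[OF re] m[OF True] m0 by (intro frac_le) auto
        thus ?thesis using \<open>d > 0\<close> by (simp add: b_def)
      next
        case False
        hence "Re z > 0" using re by simp
        hence "z \<notin> ball 0 R" using zi sub by blast
        hence "norm z = R" using zS by (auto simp: S_def)
        hence "\<epsilon> * R \<le> norm (1 + of_real \<epsilon> * z)" using n2[OF re] by simp
        hence "norm (k z / (1 + of_real \<epsilon> * z)) \<le> K / (\<epsilon> * R)"
          unfolding norm_divide using K[OF re] e R0 order_trans[OF norm_ge_zero K[OF re]]
          by (intro frac_le) auto
        also have "\<dots> \<le> b" using RK e R0 b by (simp add: field_simps)
        finally show ?thesis .
      qed
    qed
    thus ?thesis using nz[OF z0] by (simp add: norm_divide divide_simps)
  qed
  have "((\<lambda>\<epsilon>::real. b * norm (1 + of_real \<epsilon> * z0)) \<longlongrightarrow> b * norm (1 + of_real 0 * z0)) (at_right 0)"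
    by (intro tendsto_intros)
  hence "norm (k z0) \<le> b * norm (1 + of_real 0 * z0)"
    by (rule tendsto_lowerbound) (auto intro!: eventually_at_rightI[of 0 1] eps)
  thus "norm (k z0) \<le> m + d" by (simp add: b_def)
qed

text \<open>Growth is measured by \<open>Re z\<close> instead of \<open>norm z\<close>, which builds
  boundedness on the imaginary axis into the definition. These are the entire functions of
  exponential type bounded on that axis; all exponentials, for times of either sign, are among
  them.\<close>

definition exp_type :: "(complex \<Rightarrow> complex) set" where
  "exp_type = {h. h holomorphic_on UNIV \<and> (\<exists>a>0. \<exists>K. \<forall>z. norm (h z) \<le> K * exp (a * \<bar>Re z\<bar>))}"

text \<open>\<open>h z * exp (- a * z)\<close> is bounded on the closed right half-plane and has the
  modulus of \<open>h\<close> on the axis, so the axis bound spreads to the half-plane. Passing to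
  \<open>h (- z)\<close> covers the other half.\<close>

lemma exp_type_bound:
  assumes h: "h holomorphic_on UNIV" and K: "\<And>z. norm (h z) \<le> K * exp (a * \<bar>Re z\<bar>)"
    and m: "\<And>z. z \<in> iR \<Longrightarrow> norm (h z) \<le> m"
  shows "norm (h z) \<le> m * exp (a * \<bar>Re z\<bar>)"
proof -
  have right: "norm (g z) \<le> m * exp (a * Re z)"
    if g: "g holomorphic_on UNIV" "\<And>z. norm (g z) \<le> K * exp (a * \<bar>Re z\<bar>)"
      "\<And>z. z \<in> iR \<Longrightarrow> norm (g z) \<le> m" and z: "Re z \<ge> 0" for g z
  proof -
    have "norm (g z * exp_fn a z) \<le> m"
    proof (rule phragmen_lindelof_halfplane[where K = K and k = "\<lambda>z. g z * exp_fn a z"])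
      show "(\<lambda>z. g z * exp_fn a z) holomorphic_on UNIV" by (intro holomorphic_intros g(1))
      show "norm (g z * exp_fn a z) \<le> K" if "Re z \<ge> 0" for z
        using g(2)[of z] that by (simp add: norm_mult norm_exp_fn exp_minus field_simps)
      show "norm (g z * exp_fn a z) \<le> m" if "Re z = 0" for z
        using g(3)[of z] that by (simp add: norm_mult norm_exp_fn iR_def)
    qed (rule z)
    thus ?thesis by (simp add: norm_mult norm_exp_fn exp_minus field_simps)
  qed
  show ?thesis
  proof (cases "Re z \<ge> 0")
    case True
    thus ?thesis using right[of h z] h K m by simp
  next
    case False
    have "(\<lambda>z. h (- z)) holomorphic_on UNIV"
      using holomorphic_on_compose_gen[OF holomorphic_on_minus[OF holomorphic_on_ident] h] by (simp add: o_def)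
    moreover have "norm (h (- z)) \<le> K * exp (a * \<bar>Re z\<bar>)" for z using K[of "- z"] by simp
    moreover have "norm (h (- z)) \<le> m" if "z \<in> iR" for z using m[of "- z"] that by (simp add: iR_def)
    ultimately show ?thesis using right[of "\<lambda>z. h (- z)" "- z"] False by simp
  qed
qed

text \<open>By Cauchy's estimate on discs of radius \<open>1/a\<close>, differentiation costs a factor \<open>a e\<close>, while the
  shift by \<open>2a\<close> gains \<open>1/a\<close> upon integration: the bound is independent of the type \<open>a\<close>.\<close>

lemma exp_type_shift_in_B_alg:
  assumes h: "h holomorphic_on UNIV" and a: "a > 0" and K: "\<And>z. norm (h z) \<le> K * exp (a * \<bar>Re z\<bar>)"
    and m: "\<And>z. z \<in> iR \<Longrightarrow> norm (h z) \<le> m"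
  shows "(\<lambda>z. exp_fn (2 * a) z * h z) \<in> B_alg" and "B_norm (\<lambda>z. exp_fn (2 * a) z * h z) \<le> 6 * m"
proof -
  define g where "g = (\<lambda>z. exp_fn (2 * a) z * h z)"
  have m0: "m \<ge> 0" by (rule order_trans[OF norm_ge_zero m[of 0]]) (simp add: iR_def)
  note hb = exp_type_bound[OF h K m]
  \<comment> \<open>One half of the shift by \<open>2 * a\<close> pays for the growth of
    \<open>h\<close>; the other half remains as decay and makes the derivative integrable.\<close>
  have cancel: "exp (- (2 * a) * x) * exp (a * x) = exp (- a * x)" for x :: real
    by (simp add: exp_add[symmetric] algebra_simps)
  have hol: "g holomorphic_on rhp"
    unfolding g_def by (intro holomorphic_intros holomorphic_on_subset[OF h]) auto
  have bd: "norm (g z) \<le> m * exp (- a * Re z)" if z: "z \<in> rhp" for z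
  proof -
    have "norm (g z) \<le> exp (- (2 * a) * Re z) * (m * exp (a * Re z))"
      unfolding g_def norm_mult norm_exp_fn using hb[of z] z by (intro mult_left_mono) (auto simp: rhp_def)
    thus ?thesis using cancel[of "Re z"] by (simp add: mult_ac)
  qed
  have bd': "norm (g z) \<le> m" if z: "z \<in> rhp" for z
  proof -
    have "m * exp (- a * Re z) \<le> m * 1" using m0 a z by (intro mult_left_mono) (auto simp: rhp_def)
    thus ?thesis using bd[OF z] by simp
  qed
  have dv: "norm (deriv g z) \<le> a * (5 * m) * exp (- a * Re z)" if z: "z \<in> rhp" for z
  proof -
    have "norm ((deriv ^^ 1) h z) \<le> fact 1 * (m * exp (a * (Re z + 1 / a))) / (1 / a) ^ 1"
    proof (rule Cauchy_inequality)
      fix x assume x: "norm (z - x) = 1 / a"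
      have "Re x - Re z \<le> norm (z - x)" "Re z - Re x \<le> norm (z - x)"
        using abs_Re_le_cmod[of "z - x"] by auto
      hence "\<bar>Re x\<bar> \<le> Re z + 1 / a" using x z by (auto simp: rhp_def)
      hence "m * exp (a * \<bar>Re x\<bar>) \<le> m * exp (a * (Re z + 1 / a))"
        using a m0 by (intro mult_left_mono) auto
      thus "norm (h x) \<le> m * exp (a * (Re z + 1 / a))" using hb[of x] by simp
    qed (use a h in \<open>auto intro: holomorphic_on_subset holomorphic_on_imp_continuous_on\<close>)
    hence "norm (deriv h z) \<le> a * (m * exp (a * Re z) * exp 1)"
      using a by (simp add: algebra_simps exp_add)
    \<comment> \<open>Bounding \<open>exp 1\<close> by 3 keeps the constants integral: 3 from here
      and 2 from differentiating \<open>exp_fn (2 * a)\<close> give 5, and the sup norm adds 1 to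
      reach 6.\<close>
    also have "\<dots> \<le> a * (m * exp (a * Re z) * 3)"
      using exp_le m0 a by (intro mult_left_mono) auto
    finally have d: "norm (deriv h z) \<le> 3 * a * m * exp (a * Re z)" by simp
    have hz: "norm (h z) \<le> m * exp (a * Re z)" using hb[of z] z by (simp add: rhp_def)
    have "(h has_field_derivative deriv h z) (at z)"
      using h by (simp add: holomorphic_derivI)
    from DERIV_mult[OF exp_fn_deriv[of "2 * a"] this]
    have "deriv g z = exp_fn (2 * a) z * (deriv h z - 2 * of_real a * h z)"
      unfolding g_def by (subst DERIV_imp_deriv) (auto simp: algebra_simps)
    hence "norm (deriv g z) \<le> exp (- (2 * a) * Re z) * (norm (deriv h z) + 2 * a * norm (h z))"
      using norm_triangle_ineq4[of "deriv h z" "2 * of_real a * h z"] a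
      by (simp add: norm_mult norm_exp_fn)
    also have "\<dots> \<le> exp (- (2 * a) * Re z) * (3 * a * m * exp (a * Re z) + 2 * a * (m * exp (a * Re z)))"
      using d hz a by (intro mult_left_mono add_mono) auto
    also have "\<dots> = a * (5 * m) * exp (- a * Re z)"
      unfolding cancel[symmetric] by (simp add: algebra_simps)
    finally show ?thesis .
  qed
  show "(\<lambda>z. exp_fn (2 * a) z * h z) \<in> B_alg" "B_norm (\<lambda>z. exp_fn (2 * a) z * h z) \<le> 6 * m"
    using B_algI_exp[of g m a "5 * m"] hol bd' dv a m0 unfolding g_def by auto
qed

section \<open>Uniform closure of the functions of exponential type\<close>

lemma iR_ne: "iR \<noteq> {}"
proof -
  have "0 \<in> iR" by (simp add: iR_def)
  thus ?thesis by blast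
qed

text \<open>Membership demands a positive rate, since its inverse serves as the radius in Cauchy's
  estimate. Enlarging the rate to \<open>|a| + 1\<close> lets its sign be ignored when functions are
  constructed.\<close>

lemma exp_typeI:
  assumes "h holomorphic_on UNIV" "\<And>z. norm (h z) \<le> K * exp (a * \<bar>Re z\<bar>)"
  shows "h \<in> exp_type"
proof -
  have "norm (h z) \<le> \<bar>K\<bar> * exp ((\<bar>a\<bar> + 1) * \<bar>Re z\<bar>)" for z
  proof -
    have "norm (h z) \<le> K * exp (a * \<bar>Re z\<bar>)" by (rule assms)
    also have "\<dots> \<le> \<bar>K\<bar> * exp ((\<bar>a\<bar> + 1) * \<bar>Re z\<bar>)"
      by (intro mult_mono) (auto intro!: mult_right_mono)
    finally show ?thesis .
  qed
  moreover have "\<bar>a\<bar> + 1 > 0" by simp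
  ultimately show ?thesis using assms(1) unfolding exp_type_def by blast
qed

lemma exp_typeE:
  assumes "h \<in> exp_type"
  obtains a K where "a > 0" "K \<ge> 0" "h holomorphic_on UNIV" "\<And>z. norm (h z) \<le> K * exp (a * \<bar>Re z\<bar>)"
proof -
  from assms obtain a K where *: "a > 0" "h holomorphic_on UNIV" "\<And>z. norm (h z) \<le> K * exp (a * \<bar>Re z\<bar>)"
    by (auto simp: exp_type_def)
  have "K \<ge> 0" using order_trans[OF norm_ge_zero *(3)[of 0]] by simp
  with * that show ?thesis by blast
qed

lemma exp_type_bounded_iR:
  assumes "h \<in> exp_type"
  obtains m where "\<And>z. z \<in> iR \<Longrightarrow> norm (h z) \<le> m"
proof -
  obtain a K where *: "a > 0" "K \<ge> 0" "h holomorphic_on UNIV" "\<And>z. norm (h z) \<le> K * exp (a * \<bar>Re z\<bar>)"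
    using exp_typeE[OF assms] by blast
  have "norm (h z) \<le> K" if "z \<in> iR" for z using *(4)[of z] that by (simp add: iR_def)
  thus ?thesis by (rule that)
qed

lemma exp_type_const: "(\<lambda>z. c) \<in> exp_type"
  by (rule exp_typeI[where K = "norm c" and a = 0]) auto

lemma exp_type_add:
  assumes "f \<in> exp_type" "g \<in> exp_type"
  shows "(\<lambda>z. f z + g z) \<in> exp_type"
proof -
  obtain a K where f: "a > 0" "K \<ge> 0" "f holomorphic_on UNIV" "\<And>z. norm (f z) \<le> K * exp (a * \<bar>Re z\<bar>)"
    using exp_typeE[OF assms(1)] by blast
  obtain b L where g: "b > 0" "L \<ge> 0" "g holomorphic_on UNIV" "\<And>z. norm (g z) \<le> L * exp (b * \<bar>Re z\<bar>)"
    using exp_typeE[OF assms(2)] by blast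
  show ?thesis
  proof (rule exp_typeI[where K = "K + L" and a = "a + b"])
    show "(\<lambda>z. f z + g z) holomorphic_on UNIV" by (intro holomorphic_intros f g)
    fix z
    have "norm (f z + g z) \<le> K * exp (a * \<bar>Re z\<bar>) + L * exp (b * \<bar>Re z\<bar>)"
      by (rule norm_triangle_mono[OF f(4) g(4)])
    also have "\<dots> \<le> K * exp ((a + b) * \<bar>Re z\<bar>) + L * exp ((a + b) * \<bar>Re z\<bar>)"
      using f(1,2) g(1,2) by (intro add_mono mult_left_mono) (auto intro!: mult_right_mono)
    finally show "norm (f z + g z) \<le> (K + L) * exp ((a + b) * \<bar>Re z\<bar>)" by (simp add: algebra_simps)
  qed
qed

lemma exp_type_mult:
  assumes "f \<in> exp_type" "g \<in> exp_type"
  shows "(\<lambda>z. f z * g z) \<in> exp_type"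
proof -
  obtain a K where f: "a > 0" "K \<ge> 0" "f holomorphic_on UNIV" "\<And>z. norm (f z) \<le> K * exp (a * \<bar>Re z\<bar>)"
    using exp_typeE[OF assms(1)] by blast
  obtain b L where g: "b > 0" "L \<ge> 0" "g holomorphic_on UNIV" "\<And>z. norm (g z) \<le> L * exp (b * \<bar>Re z\<bar>)"
    using exp_typeE[OF assms(2)] by blast
  show ?thesis
  proof (rule exp_typeI[where K = "K * L" and a = "a + b"])
    show "(\<lambda>z. f z * g z) holomorphic_on UNIV" by (intro holomorphic_intros f g)
    fix z
    have "norm (f z * g z) \<le> (K * exp (a * \<bar>Re z\<bar>)) * (L * exp (b * \<bar>Re z\<bar>))"
      unfolding norm_mult using f g by (intro mult_mono) auto
    thus "norm (f z * g z) \<le> (K * L) * exp ((a + b) * \<bar>Re z\<bar>)" by (simp add: algebra_simps exp_add)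
  qed
qed

lemma exp_type_scale: "f \<in> exp_type \<Longrightarrow> (\<lambda>z. c * f z) \<in> exp_type"
  by (rule exp_type_mult[OF exp_type_const])

text \<open>The function is \<open>\<integral>\<^sub>0\<^sup>s exp (- (w + z) t) dt\<close>, with its removable singularity at \<open>-w\<close> filled in.\<close>

lemma truncated_resolvent:
  fixes w :: complex and s :: real
  obtains h where "h \<in> exp_type" "\<And>z. (w + z) * h z = 1 - exp (- of_real s * w) * exp_fn s z"
proof -
  define f where "f = (\<lambda>z. - exp (- of_real s * (w + z)))"
  \<comment> \<open>A difference quotient of \<open>f\<close> at \<open>- w\<close>. Since
    \<open>f (- w) = -1\<close>, it equals \<open>(1 + f z) / (w + z)\<close> away from that point,
    which is the value of the integral.\<close>
  define h where "h = (\<lambda>z. if z = - w then deriv f (- w) else (f z - f (- w)) / (z - - w))"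
  have fh: "f holomorphic_on UNIV" unfolding f_def by (intro holomorphic_intros)
  have "(f has_field_derivative of_real s) (at (- w))"
    unfolding f_def by (auto intro!: derivative_eq_intros)
  hence d: "deriv f (- w) = of_real s" by (rule DERIV_imp_deriv)
  have fw: "f (- w) = -1" by (simp add: f_def)
  have prod: "(w + z) * h z = 1 - exp (- of_real s * w) * exp_fn s z" for z
  proof (cases "z = - w")
    case True
    thus ?thesis by (simp add: exp_fn_def exp_add[symmetric])
  next
    case False
    hence "w + z \<noteq> 0" by (metis add_eq_0_iff)
    hence "(w + z) * h z = f z + 1" using False by (simp add: h_def fw add.commute)
    moreover have "f z = - (exp (- of_real s * w) * exp_fn s z)"
      unfolding f_def exp_fn_def exp_add[symmetric] by (simp only: distrib_left)
    ultimately show ?thesis by simp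
  qed
  have "h \<in> exp_type"
  proof (rule exp_typeI[where K = "\<bar>s\<bar> * exp (\<bar>s\<bar> * \<bar>Re w\<bar>)" and a = "\<bar>s\<bar>"])
    show "h holomorphic_on UNIV" unfolding h_def by (rule pole_lemma_open[OF fh open_UNIV])
    fix z
    have "\<bar>s\<bar> * \<bar>Re (w + z)\<bar> \<le> \<bar>s\<bar> * (\<bar>Re w\<bar> + \<bar>Re z\<bar>)" by (intro mult_left_mono) auto
    hence e: "\<bar>s\<bar> * exp (\<bar>s\<bar> * \<bar>Re (w + z)\<bar>) \<le> \<bar>s\<bar> * exp (\<bar>s\<bar> * \<bar>Re w\<bar>) * exp (\<bar>s\<bar> * \<bar>Re z\<bar>)"
      by (simp add: mult.assoc exp_add[symmetric] distrib_left mult_left_mono)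
    show "norm (h z) \<le> \<bar>s\<bar> * exp (\<bar>s\<bar> * \<bar>Re w\<bar>) * exp (\<bar>s\<bar> * \<bar>Re z\<bar>)"
    proof (cases "z = - w")
      case True
      have "\<bar>s\<bar> * 1 \<le> \<bar>s\<bar> * (exp (\<bar>s\<bar> * \<bar>Re w\<bar>) * exp (\<bar>s\<bar> * \<bar>Re z\<bar>))"
        unfolding exp_add[symmetric] by (intro mult_left_mono) auto
      thus ?thesis using True by (simp add: h_def d mult.assoc)
    next
      case False
      hence nz: "w + z \<noteq> 0" by (metis add_eq_0_iff)
      have "norm (h z) = norm (1 - exp (- of_real s * (w + z))) / norm (w + z)"
        using False by (simp add: h_def fw f_def norm_divide add.commute)
      also have "\<dots> \<le> (norm (- of_real s * (w + z)) * exp \<bar>Re (- of_real s * (w + z))\<bar>) / norm (w + z)"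
        by (intro divide_right_mono norm_one_minus_exp_le) auto
      also have "\<dots> = \<bar>s\<bar> * exp (\<bar>s\<bar> * \<bar>Re (w + z)\<bar>)"
      proof -
        have "\<bar>Re (- of_real s * z)\<bar> = \<bar>s\<bar> * \<bar>Re z\<bar>"
          for z by (simp add: abs_mult)
        thus ?thesis using nz by (simp only: norm_mult norm_minus_cancel norm_of_real) simp
      qed
      finally show ?thesis using e by linarith
    qed
  qed
  with prod that show ?thesis by blast
qed

text \<open>Only values on \<open>iR\<close> enter. Constants belong to this set, so it is a unital
  algebra, more convenient for polynomial approximation than \<open>C0_iR\<close>.\<close>

definition exp_type_closure :: "(complex \<Rightarrow> complex) set" where
  "exp_type_closure = {f. \<forall>e>0. \<exists>h\<in>exp_type. \<forall>z\<in>iR. norm (f z - h z) \<le> e}"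

lemma exp_type_closureD:
  assumes "f \<in> exp_type_closure" "e > 0"
  obtains h where "h \<in> exp_type" "\<And>z. z \<in> iR \<Longrightarrow> norm (f z - h z) \<le> e"
  using assms unfolding exp_type_closure_def by blast

lemma exp_type_closure_closed:
  assumes "\<And>e. e > 0 \<Longrightarrow> \<exists>g\<in>exp_type_closure. \<forall>z\<in>iR. norm (f z - g z) \<le> e"
  shows "f \<in> exp_type_closure"
  unfolding exp_type_closure_def
proof safe
  fix e :: real assume "e > 0"
  then obtain g where g: "g \<in> exp_type_closure" "\<And>z. z \<in> iR \<Longrightarrow> norm (f z - g z) \<le> e / 2"
    using assms[of "e / 2"] by auto
  obtain h where h: "h \<in> exp_type" "\<And>z. z \<in> iR \<Longrightarrow> norm (g z - h z) \<le> e / 2"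
    using exp_type_closureD[OF g(1), of "e / 2"] \<open>e > 0\<close> by auto
  show "\<exists>h\<in>exp_type. \<forall>z\<in>iR. norm (f z - h z) \<le> e"
  proof (intro bexI[OF _ h(1)] ballI)
    fix z assume z: "z \<in> iR"
    show "norm (f z - h z) \<le> e"
      using norm_triangle_ineq[of "f z - g z" "g z - h z"] g(2)[OF z] h(2)[OF z] by simp
  qed
qed

lemma exp_type_closure_cong:
  "f \<in> exp_type_closure \<Longrightarrow> (\<And>z. z \<in> iR \<Longrightarrow> g z = f z) \<Longrightarrow> g \<in> exp_type_closure"
  unfolding exp_type_closure_def by simp

lemma exp_type_subset_closure: "f \<in> exp_type \<Longrightarrow> f \<in> exp_type_closure"
  unfolding exp_type_closure_def by (auto intro!: bexI[of _ f])

lemma exp_type_closure_bounded: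
  assumes "f \<in> exp_type_closure"
  obtains m where "m > 0" "\<And>z. z \<in> iR \<Longrightarrow> norm (f z) \<le> m"
proof -
  obtain h where h: "h \<in> exp_type" "\<And>z. z \<in> iR \<Longrightarrow> norm (f z - h z) \<le> 1"
    using exp_type_closureD[OF assms, of 1] by auto
  obtain m where m: "\<And>z. z \<in> iR \<Longrightarrow> norm (h z) \<le> m" using exp_type_bounded_iR[OF h(1)] by blast
  have "norm (f z) \<le> \<bar>m\<bar> + 1" if "z \<in> iR" for z
    using norm_triangle_ineq[of "f z - h z" "h z"] h(2)[OF that] m[OF that] by simp
  thus ?thesis using that[of "\<bar>m\<bar> + 1"] by simp
qed

lemma exp_type_closure_add:
  assumes f: "f \<in> exp_type_closure" and g: "g \<in> exp_type_closure"
  shows "(\<lambda>z. f z + g z) \<in> exp_type_closure"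
  unfolding exp_type_closure_def
proof safe
  fix e :: real assume e: "e > 0"
  obtain h where h: "h \<in> exp_type" "\<And>z. z \<in> iR \<Longrightarrow> norm (f z - h z) \<le> e / 2"
    using exp_type_closureD[OF f, of "e / 2"] e by auto
  obtain k where k: "k \<in> exp_type" "\<And>z. z \<in> iR \<Longrightarrow> norm (g z - k z) \<le> e / 2"
    using exp_type_closureD[OF g, of "e / 2"] e by auto
  show "\<exists>h\<in>exp_type. \<forall>z\<in>iR. norm (f z + g z - h z) \<le> e"
  proof (intro bexI[OF _ exp_type_add[OF h(1) k(1)]] ballI)
    fix z assume z: "z \<in> iR"
    show "norm (f z + g z - (h z + k z)) \<le> e"
      using norm_triangle_ineq[of "f z - h z" "g z - k z"] h(2)[OF z] k(2)[OF z]
      by (simp add: algebra_simps)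
  qed
qed

lemma exp_type_closure_mult:
  assumes f: "f \<in> exp_type_closure" and g: "g \<in> exp_type_closure"
  shows "(\<lambda>z. f z * g z) \<in> exp_type_closure"
  unfolding exp_type_closure_def
proof safe
  fix e :: real assume e: "e > 0"
  obtain m where m: "m > 0" "\<And>z. z \<in> iR \<Longrightarrow> norm (g z) \<le> m"
    using exp_type_closure_bounded[OF g] by blast
  obtain h where h: "h \<in> exp_type" "\<And>z. z \<in> iR \<Longrightarrow> norm (f z - h z) \<le> e / (2 * m)"
    using exp_type_closureD[OF f, of "e / (2 * m)"] e m by auto
  \<comment> \<open>\<open>b\<close> bounds the approximant \<open>h\<close>, not \<open>f\<close>,
    so \<open>k\<close> can only be chosen once \<open>h\<close> is fixed.\<close>
  obtain b where b: "b > 0" "\<And>z. z \<in> iR \<Longrightarrow> norm (h z) \<le> b"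
    using exp_type_closure_bounded[OF exp_type_subset_closure[OF h(1)]] by blast
  obtain k where k: "k \<in> exp_type" "\<And>z. z \<in> iR \<Longrightarrow> norm (g z - k z) \<le> e / (2 * b)"
    using exp_type_closureD[OF g, of "e / (2 * b)"] e b by auto
  show "\<exists>h\<in>exp_type. \<forall>z\<in>iR. norm (f z * g z - h z) \<le> e"
  proof (intro bexI[OF _ exp_type_mult[OF h(1) k(1)]] ballI)
    fix z assume z: "z \<in> iR"
    have "norm (f z * g z - h z * k z) = norm ((f z - h z) * g z + h z * (g z - k z))"
      by (simp add: algebra_simps)
    also have "\<dots> \<le> norm (f z - h z) * norm (g z) + norm (h z) * norm (g z - k z)"
      by (metis norm_triangle_ineq norm_mult)
    also have "\<dots> \<le> (e / (2 * m)) * m + b * (e / (2 * b))"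
      using h(2)[OF z] k(2)[OF z] m(1) m(2)[OF z] b(2)[OF z] b(1) e by (intro add_mono mult_mono) auto
    also have "\<dots> = e" using m b by simp
    finally show "norm (f z * g z - h z * k z) \<le> e" .
  qed
qed

lemma exp_type_closure_scale: "f \<in> exp_type_closure \<Longrightarrow> (\<lambda>z. c * f z) \<in> exp_type_closure"
  by (rule exp_type_closure_mult[OF exp_type_subset_closure[OF exp_type_const]])

text \<open>The sign of \<open>s n\<close> is that of \<open>Re w\<close>, so
  \<open>exp (- s n * w)\<close> decays in both cases. For negative \<open>Re w\<close> the
  resolvent function is a Laplace integral from 0 to minus infinity, and the truncation runs
  backwards in time.\<close>

lemma truncated_resolvent_approx:
  assumes w: "w \<notin> iR"
  defines "s \<equiv> \<lambda>n::nat. sgn (Re w) * real n"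
  assumes h: "\<And>n z. (w + z) * h n z = 1 - exp (- of_real (s n) * w) * exp_fn (s n) z"
  shows "z \<in> iR \<Longrightarrow> norm (rz w z - h n z) \<le> exp (- real n * \<bar>Re w\<bar>) / \<bar>Re w\<bar>"
    and "(\<lambda>n. exp (- real n * \<bar>Re w\<bar>) / \<bar>Re w\<bar>) \<longlonglongrightarrow> 0"
proof -
  have re: "\<bar>Re w\<bar> > 0" using w by (simp add: iR_def)
  have ex: "s n * Re w = real n * \<bar>Re w\<bar>" for n by (simp add: s_def abs_sgn mult_ac)
  show "norm (rz w z - h n z) \<le> exp (- real n * \<bar>Re w\<bar>) / \<bar>Re w\<bar>" if z: "z \<in> iR"
  proof -
    have rz: "Re z = 0" using z by (simp add: iR_def)
    have ge: "\<bar>Re w\<bar> \<le> norm (w + z)" using abs_Re_le_cmod[of "w + z"] rz by simp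
    hence nz: "w + z \<noteq> 0" using re by auto
    have "rz w z - h n z = (1 - (w + z) * h n z) / (w + z)"
      using nz by (simp add: rz_def field_simps)
    also have "\<dots> = exp (- of_real (s n) * w) * exp_fn (s n) z / (w + z)" by (simp add: h)
    also have "norm \<dots> = exp (- real n * \<bar>Re w\<bar>) / norm (w + z)"
      by (simp add: norm_divide norm_mult norm_exp_fn rz ex)
    also have "\<dots> \<le> exp (- real n * \<bar>Re w\<bar>) / \<bar>Re w\<bar>"
      using ge re nz by (intro divide_left_mono) (auto intro!: mult_pos_pos)
    finally show ?thesis .
  qed
  have "(\<lambda>n. exp (- real n * \<bar>Re w\<bar>)) \<longlonglongrightarrow> 0"
  proof -
    have "(\<lambda>n. exp (- \<bar>Re w\<bar>) ^ n) \<longlonglongrightarrow> 0" using re by (intro LIMSEQ_power_zero) auto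
    thus ?thesis by (simp add: exp_of_nat_mult[symmetric])
  qed
  thus "(\<lambda>n. exp (- real n * \<bar>Re w\<bar>) / \<bar>Re w\<bar>) \<longlonglongrightarrow> 0"
    using tendsto_divide[OF _ tendsto_const, of _ 0 sequentially "\<bar>Re w\<bar>"] re by simp
qed

lemma rz_in_exp_type_closure:
  assumes w: "w \<notin> iR"
  shows "rz w \<in> exp_type_closure"
  unfolding exp_type_closure_def
proof safe
  fix e :: real assume e: "e > 0"
  have "\<exists>h\<in>exp_type. \<forall>z. (w + z) * h z = 1 - exp (- of_real (sgn (Re w) * real n) * w) * exp_fn (sgn (Re w) * real n) z" for n
    using truncated_resolvent[of w "sgn (Re w) * real n"] by metis
  then obtain h where h: "\<And>n. h n \<in> exp_type" 
    "\<And>n z. (w + z) * h n z = 1 - exp (- of_real (sgn (Re w) * real n) * w) * exp_fn (sgn (Re w) * real n) z"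
    by metis
  note est = truncated_resolvent_approx[OF w h(2)]
  have "eventually (\<lambda>n::nat. exp (- real n * \<bar>Re w\<bar>) / \<bar>Re w\<bar> < e) sequentially"
    by (rule order_tendstoD(2)[OF est(2) e])
  then obtain n where n: "exp (- real n * \<bar>Re w\<bar>) / \<bar>Re w\<bar> < e"
    by (auto simp: eventually_sequentially)
  show "\<exists>h\<in>exp_type. \<forall>z\<in>iR. norm (rz w z - h z) \<le> e"
    using est(1)[of _ n] n h(1)[of n] by (intro bexI[of _ "h n"]) force+
qed

text \<open>The Cayley transform \<open>u = (1 - z) / (1 + z)\<close> maps \<open>i\<real>\<close> onto the circle without \<open>-1\<close>, and both
  coordinates of \<open>u\<close> are combinations of \<open>1\<close>, \<open>r\<^sub>1\<close> and the resolvent at \<open>-1\<close>.\<close>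

lemma cayley_polynomial_in_closure:
  fixes g :: "complex \<Rightarrow> real"
  assumes "real_polynomial_function g"
  shows "(\<lambda>z. of_real (g ((1 - z) / (1 + z)))) \<in> exp_type_closure"
  using assms
proof induction
  case (linear g)
  have r: "rz 1 \<in> exp_type_closure" "rz (-1) \<in> exp_type_closure"
    by (intro rz_in_exp_type_closure; simp add: iR_def)+
  have c: "(\<lambda>z. c) \<in> exp_type_closure" for c by (intro exp_type_subset_closure exp_type_const)
  \<comment> \<open>On \<open>iR\<close> these are the real and imaginary parts of \<open>u\<close>,
    because \<open>u = 2 * rz 1 z - 1\<close> and \<open>cnj u = - 2 * rz (-1) z - 1\<close>
    there.\<close>
  let ?X = "\<lambda>z. rz 1 z + (-1 * rz (-1) z + (-1))" and ?Y = "\<lambda>z. (- \<i>) * (rz 1 z + rz (-1) z)"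
  have mem: "(\<lambda>z. of_real (g 1) * ?X z + of_real (g \<i>) * ?Y z) \<in> exp_type_closure"
    by (intro exp_type_closure_add exp_type_closure_scale r c)
  show ?case
  proof (rule exp_type_closure_cong[OF mem])
    fix z assume "z \<in> iR"
    then obtain y where z: "z = \<i> * of_real y"
      by (metis iR_def mem_Collect_eq complex_eq add_0 of_real_0)
    define u where "u = (1 - z) / (1 + z)"
    have n1: "1 + z \<noteq> 0" and n2: "-1 + z \<noteq> 0" by (simp_all add: z complex_eq_iff)
    \<comment> \<open>Conjugation acts as \<open>z \<mapsto> - z\<close> on the imaginary axis, so
      \<open>cnj u\<close> is rational in \<open>z\<close>, with its pole at 1.\<close>
    have cu: "cnj u = (1 + z) / (1 - z)" by (simp add: u_def z)
    have u1: "u = 2 * rz 1 z - 1" using n1 by (simp add: u_def rz_def field_simps)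
    have "cnj u = - ((2 + (-1 + z)) / (-1 + z))"
      unfolding cu by (simp add: minus_divide_right)
    also have "\<dots> = - (2 / (-1 + z) + 1)" using n2 add_divide_distrib[of 2 "-1 + z" "-1 + z"] by simp
    finally have u2: "cnj u = - 2 * rz (-1) z - 1" by (simp add: rz_def)
    have X: "?X z = of_real (Re u)"
    proof -
      have "of_real (Re u) = (u + cnj u) / 2" by (simp add: complex_add_cnj)
      also have "\<dots> = ?X z"
        unfolding u2 unfolding u1 by (simp add: field_simps)
      finally show ?thesis by simp
    qed
    have Y: "?Y z = of_real (Im u)"
    proof -
      have "of_real (Im u) = - \<i> * (u - cnj u) / 2" by (simp add: complex_eq_iff)
      also have "\<dots> = ?Y z"
        unfolding u2 unfolding u1 by (simp add: field_simps)
      finally show ?thesis by simp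
    qed
    have "u = Re u *\<^sub>R 1 + Im u *\<^sub>R \<i>" by (simp add: complex_eq_iff)
    hence "g u = g (Re u *\<^sub>R 1 + Im u *\<^sub>R \<i>)" by simp
    also have "\<dots> = Re u * g 1 + Im u * g \<i>"
      using linear bounded_linear.linear[OF linear] by (simp add: linear_add linear_scale)
    finally show "of_real (g ((1 - z) / (1 + z))) = of_real (g 1) * ?X z + of_real (g \<i>) * ?Y z"
      unfolding X Y u_def[symmetric] by (simp add: mult.commute)
  qed
next
  case (const c)
  show ?case by (intro exp_type_subset_closure exp_type_const)
next
  case (add f g)
  thus ?case using exp_type_closure_add by fastforce
next
  case (mult f g)
  thus ?case using exp_type_closure_mult by fastforce
qed

text \<open>The map \<open>u \<mapsto> (1 - u) / (1 + u)\<close> leaves every bounded set as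
  \<open>u\<close> tends to \<open>-1\<close>, so decay of \<open>f\<close> at infinity becomes
  continuity at the added point, with value 0.\<close>

lemma C0_iR_transport_circle:
  assumes f: "f \<in> C0_iR"
  shows "continuous_on (sphere 0 1) (\<lambda>u. if u = -1 then 0 else f ((1 - u) / (1 + u)))"
    (is "continuous_on ?S ?F")
  unfolding continuous_on_def
proof
  have inR: "(1 - u) / (1 + u) \<in> iR" if "u \<in> ?S" for u :: complex
  proof -
    have "(Re u)\<^sup>2 + (Im u)\<^sup>2 = 1" using that by (simp add: cmod_def)
    thus ?thesis by (simp add: iR_def Re_divide algebra_simps power2_eq_square)
  qed
  fix u assume u: "u \<in> ?S"
  show "(?F \<longlongrightarrow> ?F u) (at u within ?S)"
  proof (cases "u = -1")
    case False
    have nz: "1 + v \<noteq> 0" if "v \<noteq> -1" for v :: complex using that by (metis add.inverse_unique)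
    have cf: "continuous_on iR f" using f by (simp add: C0_iR_def)
    have "continuous_on (?S - {-1}) (\<lambda>u. f ((1 - u) / (1 + u)))"
      by (rule continuous_on_compose2[OF cf]) (use inR nz in \<open>auto intro!: continuous_intros\<close>)
    hence "continuous_on (?S - {-1}) ?F" by (rule continuous_on_eq) auto
    hence "(?F \<longlongrightarrow> ?F u) (at u within (?S - {-1}))"
      using u False by (simp add: continuous_on_def)
    moreover have "at u within (?S - {-1}) = at u within ?S"
      by (rule at_within_nhd[of _ "- {-1}"]) (use False in auto)
    ultimately show ?thesis by simp
  next
    case True
    show ?thesis unfolding tendsto_iff
    proof safe
      fix e :: real assume e: "e > 0"
      have "\<exists>R. \<forall>z\<in>iR. norm z \<ge> R \<longrightarrow> norm (f z) < e" using f e by (simp add: C0_iR_def)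
      then obtain R where R: "\<And>z. z \<in> iR \<Longrightarrow> norm z \<ge> R \<Longrightarrow> norm (f z) < e" by blast
      \<comment> \<open>Chosen with \<open>1 / d = |R| + 1\<close>, which is at least
        \<open>R\<close>; moreover \<open>d\<close> is at most 1, which keeps the numerator
        \<open>1 - v\<close> at distance at least 1 from 0.\<close>
      define d where "d = 1 / (\<bar>R\<bar> + 1)"
      have d: "0 < d" "d \<le> 1" by (auto simp: d_def)
      show "eventually (\<lambda>v. dist (?F v) (?F u) < e) (at u within ?S)"
        unfolding eventually_at
      proof (intro exI[of _ d] conjI ballI impI d(1))
        fix v assume v: "v \<in> ?S" "v \<noteq> u \<and> dist v u < d"
        have nv: "norm (1 + v) < d" using v True by (simp add: dist_norm add.commute)
        have v0: "norm (1 + v) > 0" using v True by (metis add.inverse_unique zero_less_norm_iff)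
        have "norm ((1 - v) + (1 + v)) \<le> norm (1 - v) + norm (1 + v)" by (rule norm_triangle_ineq)
        hence "norm (1 - v) \<ge> 1" using nv d by simp
        hence "1 / d \<le> norm (1 - v) / norm (1 + v)" using nv v0 d by (intro frac_le) auto
        hence "R \<le> norm ((1 - v) / (1 + v))" by (simp add: norm_divide d_def)
        hence "norm (f ((1 - v) / (1 + v))) < e" using R inR v(1) by blast
        thus "dist (?F v) (?F u) < e" using True v by simp
      qed
    qed
  qed
qed

text \<open>The polynomial provided by Stone-Weierstrass need not vanish at \<open>-1\<close>, so
  its pull-back to the axis may fail to decay. This does not matter, since
  \<open>exp_type_closure\<close> contains the constants and is itself closed under uniform limits
  on \<open>iR\<close>.\<close>

lemma C0_iR_subset_exp_type_closure: "C0_iR \<subseteq> exp_type_closure"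
proof
  fix f assume f: "f \<in> C0_iR"
  let ?F = "\<lambda>u. if u = -1 then 0 else f ((1 - u) / (1 + u))"
  show "f \<in> exp_type_closure"
  proof (rule exp_type_closure_closed)
    fix e :: real assume "e > 0"
    have "\<exists>g. polynomial_function g \<and> (\<forall>u\<in>sphere 0 1. norm (?F u - g u) < e)"
      by (rule Stone_Weierstrass_polynomial_function[OF compact_sphere C0_iR_transport_circle[OF f] \<open>e > 0\<close>])
    then obtain g where g: "polynomial_function g" and gF: "\<forall>u\<in>sphere 0 1. norm (?F u - g u) < e"
      by (elim exE conjE)
    have P: "real_polynomial_function (\<lambda>u. L (g u))" if "bounded_linear L" for L
      using g that by (simp add: polynomial_function_def o_def)
    have "(\<lambda>z. of_real (Re (g ((1 - z) / (1 + z)))) + \<i> * of_real (Im (g ((1 - z) / (1 + z)))))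
        \<in> exp_type_closure"
      by (rule exp_type_closure_add[OF cayley_polynomial_in_closure[OF P[OF bounded_linear_Re]]
            exp_type_closure_scale[OF cayley_polynomial_in_closure[OF P[OF bounded_linear_Im]]]])
    hence "(\<lambda>z. g ((1 - z) / (1 + z))) \<in> exp_type_closure"
      by (simp only: complex_eq[symmetric])
    moreover have "norm (f z - g ((1 - z) / (1 + z))) \<le> e" if "z \<in> iR" for z
    proof -
      obtain y where z: "z = \<i> * of_real y"
        using \<open>z \<in> iR\<close> by (metis iR_def mem_Collect_eq complex_eq add_0 of_real_0)
      let ?u = "(1 - z) / (1 + z)"
      have nz: "1 + z \<noteq> 0" by (simp add: z complex_eq_iff)
      have "norm (1 - z) = norm (1 + z)" by (simp add: cmod_def z)
      hence s: "?u \<in> sphere 0 1" using nz by (simp add: norm_divide)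
      have u1: "?u \<noteq> -1" using nz by (simp add: divide_eq_eq)
      have "1 + ?u = 2 / (1 + z)" "1 - ?u = 2 * z / (1 + z)" using nz by (simp_all add: field_simps)
      hence "(1 - ?u) / (1 + ?u) = z" using nz by simp
      thus ?thesis using bspec[OF gF s] u1 by simp
    qed
    ultimately show "\<exists>g\<in>exp_type_closure. \<forall>z\<in>iR. norm (f z - g z) \<le> e"
      by (intro bexI[of _ "\<lambda>z. g ((1 - z) / (1 + z))"]) auto
  qed
qed

section \<open>Groups with a calculus on the half-plane\<close>

locale group_B_calculus =
  fixes T :: "real \<Rightarrow> 'a::complex_banach \<Rightarrow> 'a" and D :: "'a set" and A :: "'a \<Rightarrow> 'a"
    and \<Phi> :: "(complex \<Rightarrow> complex) \<Rightarrow> 'a \<Rightarrow> 'a"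
  assumes group: "bounded_C0_group T" and generator: "is_generator T D (\<lambda>x. - A x)"
    and dense: "densely_defined D"
    and hom: "bounded_alg_hom B_alg B_norm \<Phi>"
    and inverse: "\<And>z. z \<in> rhp \<Longrightarrow> is_inverse_shift D A z (\<Phi> (rz z))"
begin

section \<open>The group, its generator and the resolvent at 1\<close>

lemma T_op: "bounded_op (T t)" and T_0 [simp]: "T 0 x = x" and T_add: "T (s + t) x = T s (T t x)"
proof -
  note g = group[unfolded bounded_C0_group_def]
  show "bounded_op (T t)" by (rule g[THEN conjunct1, THEN spec])
  show "T 0 x = x" using g[THEN conjunct2, THEN conjunct1] by simp
  show "T (s + t) x = T s (T t x)"
    using fun_cong[OF g[THEN conjunct2, THEN conjunct2, THEN conjunct1, THEN spec, THEN spec, of s t], of x]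
    by (simp only: o_apply)
qed

lemma T_inverse [simp]: "T (- t) (T t x) = x" and T_inverse' [simp]: "T t (T (- t) x) = x"
  by (simp_all add: T_add[symmetric])

lemma T_commute: "T s (T t x) = T t (T s x)"
  by (simp add: T_add[symmetric] add.commute)

lemma T_bounded: obtains M where "M \<ge> 0" "\<And>t x. norm (T t x) \<le> M * norm x"
proof -
  have "\<exists>M. \<forall>t. onorm (T t) \<le> M" using group unfolding bounded_C0_group_def by (elim conjE)
  then obtain M where M: "\<And>t. onorm (T t) \<le> M" by blast
  have "norm (T t x) \<le> M * norm x" for t x
    using onorm[OF bounded_op_bounded_linear[OF T_op], of t x]
      mult_right_mono[OF M[of t] norm_ge_zero[of x]] by linarith
  moreover have "0 \<le> M"
    by (rule order_trans[OF onorm_pos_le[OF bounded_op_bounded_linear[OF T_op]] M[of 0]])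
  ultimately show ?thesis using that by blast
qed

lemma generator_lim: "x \<in> D \<Longrightarrow> ((\<lambda>t. (1 / t) *\<^sub>R (T t x - x)) \<longlongrightarrow> - A x) (at 0)"
  using generator unfolding is_generator_def by (elim conjE bspec)

lemma generatorI:
  assumes "((\<lambda>t. (1 / t) *\<^sub>R (T t x - x)) \<longlongrightarrow> - y) (at 0)"
  shows "x \<in> D" and "A x = y"
proof -
  have "D = {x. \<exists>y. ((\<lambda>t. (1 / t) *\<^sub>R (T t x - x)) \<longlongrightarrow> y) (at 0)}"
    using generator unfolding is_generator_def by (rule conjunct1)
  thus "x \<in> D" by (rule ssubst) (intro CollectI exI[of _ "- y"] assms)
  from tendsto_unique[OF _ generator_lim[OF this] assms] show "A x = y" by simp
qed

text \<open>\<open>T t\<close> is continuous and commutes with every \<open>T h\<close>, so applying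
  it to the difference quotients at \<open>x\<close> produces those at \<open>T t x\<close>.\<close>

lemma T_domain:
  assumes "x \<in> D"
  shows "T t x \<in> D" and "A (T t x) = T t (A x)"
proof -
  have "((\<lambda>h. T t ((1 / h) *\<^sub>R (T h x - x))) \<longlongrightarrow> T t (- A x)) (at 0)"
    by (rule bounded_linear.tendsto[OF bounded_op_bounded_linear[OF T_op] generator_lim[OF assms]])
  moreover have "T t ((1 / h) *\<^sub>R (T h x - x)) = (1 / h) *\<^sub>R (T h (T t x) - T t x)" for h
    unfolding bounded_op_scaleR[OF T_op] bounded_op_diff[OF T_op] by (subst T_commute) (rule refl)
  ultimately have "((\<lambda>h. (1 / h) *\<^sub>R (T h (T t x) - T t x)) \<longlongrightarrow> - T t (A x)) (at 0)"
    by (simp only: bounded_op_minus[OF T_op])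
  from generatorI[OF this] show "T t x \<in> D" "A (T t x) = T t (A x)" by auto
qed

text \<open>By the group law the increment at \<open>t\<close> is \<open>T t\<close> applied to the
  increment at 0, which leaves only the limit that defines the generator.\<close>

lemma T_vector_derivative:
  assumes "x \<in> D"
  shows "((\<lambda>t. T t x) has_vector_derivative - T t (A x)) (at t)"
  unfolding has_vector_derivative_def has_derivative_at
proof
  show "bounded_linear (\<lambda>r. r *\<^sub>R - T t (A x))" by (rule bounded_linear_scaleR_left)
  have "((\<lambda>h. T t ((1 / h) *\<^sub>R (T h x - x) - - A x)) \<longlongrightarrow> T t (- A x - - A x)) (at 0)"
    by (rule bounded_linear.tendsto[OF bounded_op_bounded_linear[OF T_op]
          tendsto_diff[OF generator_lim[OF assms] tendsto_const]])
  moreover have "norm (T t (- A x - - A x)) = 0"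
    by (simp only: diff_self bounded_op_zero[OF T_op] norm_zero)
  ultimately have "((\<lambda>h. norm (T t ((1 / h) *\<^sub>R (T h x - x) - - A x))) \<longlongrightarrow> 0) (at 0)"
    using tendsto_norm by fastforce
  thus "(\<lambda>h. norm (T (t + h) x - T t x - h *\<^sub>R - T t (A x)) / norm h) \<midarrow>0\<rightarrow> 0"
  proof (rule Lim_transform_eventually)
    show "eventually (\<lambda>h. norm (T t ((1 / h) *\<^sub>R (T h x - x) - - A x))
        = norm (T (t + h) x - T t x - h *\<^sub>R - T t (A x)) / norm h) (at 0)"
      unfolding eventually_at_filter
    proof (rule always_eventually, intro allI impI)
      fix h :: real assume h: "h \<noteq> 0"
      have "T (t + h) x - T t x - h *\<^sub>R - T t (A x) = T t (T h x - x + h *\<^sub>R A x)"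
        by (simp add: T_add bounded_op_add[OF T_op] bounded_op_diff[OF T_op] bounded_op_scaleR[OF T_op])
      moreover have "T h x - x + h *\<^sub>R A x = h *\<^sub>R ((1 / h) *\<^sub>R (T h x - x) - - A x)"
        using h by (simp add: scaleR_right_distrib)
      ultimately have "T (t + h) x - T t x - h *\<^sub>R - T t (A x)
          = h *\<^sub>R T t ((1 / h) *\<^sub>R (T h x - x) - - A x)"
        by (simp only: bounded_op_scaleR[OF T_op])
      thus "norm (T t ((1 / h) *\<^sub>R (T h x - x) - - A x))
          = norm (T (t + h) x - T t x - h *\<^sub>R - T t (A x)) / norm h"
        using h by (simp only: norm_scaleR) simp
    qed
  qed
qed

text \<open>Inherited from the difference quotients: their limits exist for the combined vectors,
  which places these in \<open>D\<close>, and are unique, which determines \<open>A\<close> on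
  them.\<close>

lemma linear_A: "lin_op D A"
  unfolding lin_op_def
proof (intro conjI ballI allI)
  have "((\<lambda>t. (1 / t) *\<^sub>R (T t 0 - 0)) \<longlongrightarrow> - 0) (at 0)"
    by (simp add: bounded_op_zero[OF T_op])
  thus "0 \<in> D" by (rule generatorI)
  fix x assume x: "x \<in> D"
  {
    fix y assume y: "y \<in> D"
    have "(1 / t) *\<^sub>R (T t x - x) + (1 / t) *\<^sub>R (T t y - y) = (1 / t) *\<^sub>R (T t (x + y) - (x + y))" for t
      unfolding bounded_op_add[OF T_op] scaleR_right_distrib[symmetric] by (simp only: add_diff_add)
    moreover have "- A x + - A y = - (A x + A y)" by simp
    ultimately have "((\<lambda>t. (1 / t) *\<^sub>R (T t (x + y) - (x + y))) \<longlongrightarrow> - (A x + A y)) (at 0)"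
      using tendsto_add[OF generator_lim[OF x] generator_lim[OF y]] by (simp only:)
    from generatorI[OF this] show "x + y \<in> D" "A (x + y) = A x + A y" by auto
  }
  fix c
  have "((\<lambda>t. cscale c ((1 / t) *\<^sub>R (T t x - x))) \<longlongrightarrow> cscale c (- A x)) (at 0)"
    by (rule bounded_linear.tendsto[OF bounded_linear_cscale generator_lim[OF x]])
  moreover have "cscale c ((1 / t) *\<^sub>R (T t x - x)) = (1 / t) *\<^sub>R (T t (cscale c x) - cscale c x)" for t
    by (simp only: bounded_op_cscale[OF T_op] cscale_diff_right
        linear_scale[OF bounded_linear.linear[OF bounded_linear_cscale]])
  ultimately have "((\<lambda>t. (1 / t) *\<^sub>R (T t (cscale c x) - cscale c x)) \<longlongrightarrow> - cscale c (A x)) (at 0)"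
    by (simp only: cscale_minus_right)
  from generatorI[OF this] show "cscale c x \<in> D" "A (cscale c x) = cscale c (A x)" by auto
qed

lemma A_diff: "x \<in> D \<Longrightarrow> y \<in> D \<Longrightarrow> x - y \<in> D \<and> A (x - y) = A x - A y"
proof -
  assume x: "x \<in> D" and y: "y \<in> D"
  have "cscale (-1) y \<in> D \<and> A (cscale (-1) y) = cscale (-1) (A y)"
    using linear_A y by (simp add: lin_op_def)
  hence m: "- y \<in> D" "A (- y) = - A y" by (simp_all add: cscale_minus_left)
  have "x + - y \<in> D \<and> A (x + - y) = A x + A (- y)"
    using linear_A x m(1) unfolding lin_op_def by blast
  thus ?thesis using m by simp
qed

text \<open>The inverse of \<open>1 + A\<close>. Its range is exactly \<open>D\<close>, so it
  regularises vectors while losing only a dense set's worth of information.\<close>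

definition R :: "'a \<Rightarrow> 'a" where "R = \<Phi> (rz 1)"

lemma R_op: "bounded_op R"
  unfolding R_def by (intro bounded_alg_hom_op[OF hom] rz_in_B_alg) (simp add: rhp_def)

lemma R_left: "x \<in> D \<Longrightarrow> R (x + A x) = x"
  and R_domain: "R y \<in> D" and R_right: "R y + A (R y) = y"
proof -
  have "is_inverse_shift D A 1 R" unfolding R_def by (rule inverse) (simp add: rhp_def)
  thus "x \<in> D \<Longrightarrow> R (x + A x) = x" "R y \<in> D" "R y + A (R y) = y"
    by (simp_all add: is_inverse_shift_def)
qed

lemma A_R: "A (R y) = y - R y"
  using R_right[of y] by (simp add: algebra_simps)

lemma range_R: "range R = D"
proof
  show "range R \<subseteq> D" using R_domain by auto
  show "D \<subseteq> range R"
  proof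
    fix x assume "x \<in> D"
    hence "x = R (x + A x)" by (simp add: R_left)
    thus "x \<in> range R" by (rule range_eqI)
  qed
qed

lemma dense_range_R: "closure (range R) = UNIV"
  using dense by (simp add: range_R densely_defined_def)

text \<open>The relation \<open>1 * rz 1 = rz 1\<close> shows that the image of 1 fixes the range of
  \<open>R\<close>, which is dense.\<close>

lemma \<Phi>_const: "\<Phi> (\<lambda>z. 1) x = x"
proof -
  have "\<Phi> (\<lambda>z. 1) = id"
  proof (rule bounded_op_eq_on_dense[OF _ _ dense_range_R])
    show "bounded_op (\<Phi> (\<lambda>z. 1))" by (intro bounded_alg_hom_op[OF hom] B_alg_const)
    show "bounded_op (id :: 'a \<Rightarrow> 'a)" by (rule bounded_opI[where K = 1]) auto
    fix x assume "x \<in> range R"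
    then obtain y where "x = R y" by auto
    thus "\<Phi> (\<lambda>z. 1) x = id x"
      using bounded_alg_hom_mult[OF hom B_alg_const[of 1] rz_in_B_alg[of 1], of y]
      by (simp add: R_def rhp_def)
  qed
  thus ?thesis by simp
qed

text \<open>Two mean value estimates replace the integral remainder: the orbit of \<open>A x\<close>
  is Lipschitz with constant governed by \<open>A (A x)\<close>, and up to sign it is the derivative
  of the orbit of \<open>x\<close>.\<close>

lemma T_taylor2:
  assumes x: "x \<in> D" "A x \<in> D" and t: "t \<ge> 0" and M: "M \<ge> 0" "\<And>t x. norm (T t x) \<le> M * norm x"
  shows "norm (T t x - x + t *\<^sub>R A x) \<le> M * t\<^sup>2 * norm (A (A x))"
proof -
  have lip: "norm (T s y - y) \<le> M * s * norm (A y)" if y: "y \<in> D" and s: "s \<ge> 0" for s y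
  proof -
    have "norm (T s y - T 0 y) \<le> (M * norm (A y)) * norm (s - 0)"
    proof (rule differentiable_bound[where S = UNIV and f = "\<lambda>s. T s y" and f' = "\<lambda>t h. h *\<^sub>R - T t (A y)"])
      fix t :: real
      show "((\<lambda>s. T s y) has_derivative (\<lambda>h. h *\<^sub>R - T t (A y))) (at t)"
        by (rule T_vector_derivative[OF y, unfolded has_vector_derivative_def])
      show "onorm (\<lambda>h. h *\<^sub>R - T t (A y)) \<le> M * norm (A y)"
      proof (rule onorm_bound)
        show "0 \<le> M * norm (A y)" using M(1) by simp
        show "norm (h *\<^sub>R - T t (A y)) \<le> M * norm (A y) * norm h" for h
          using mult_right_mono[OF M(2)[of t "A y"] norm_ge_zero[of h]]
          by (simp only: norm_scaleR norm_minus_cancel real_norm_def mult.commute[of "\<bar>h\<bar>"])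
      qed
    qed auto
    also have "\<dots> = M * s * norm (A y)" using s by simp
    finally show ?thesis by simp
  qed
  define v where "v = (\<lambda>s. - T s (A x))"
  have dv: "((\<lambda>t. T t x) has_vector_derivative v s) (at s within {0..t})" for s
    unfolding v_def by (rule has_vector_derivative_at_within[OF T_vector_derivative[OF x(1)]])
  have bv: "norm (v s - v 0) \<le> M * t * norm (A (A x))" if s: "s \<in> {0..t}" for s
  proof -
    have "norm (v s - v 0) = norm (T s (A x) - A x)"
      using norm_minus_commute[of "T s (A x)" "A x"] by (simp add: v_def)
    also have "\<dots> \<le> M * s * norm (A (A x))" using s by (intro lip[OF x(2)]) simp
    also have "\<dots> \<le> M * t * norm (A (A x))" using s M(1) by (intro mult_right_mono mult_left_mono) auto
    finally show ?thesis .
  qed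
  have "norm (T t x - T 0 x - (t - 0) *\<^sub>R v 0) \<le> norm (t - 0) * (M * t * norm (A (A x)))"
    by (rule vector_differentiable_bound_linearization[OF dv _ bv])
      (use t in \<open>simp_all add: closed_segment_eq_real_ivl\<close>)
  also have "\<dots> = M * t\<^sup>2 * norm (A (A x))" using t by (simp add: power2_eq_square)
  finally show ?thesis by (simp add: v_def)
qed

end

section \<open>Identification of the images of exponentials with the group\<close>

context group_B_calculus
begin

lemma \<Phi>_op: "f \<in> B_alg \<Longrightarrow> bounded_op (\<Phi> f)"
  by (rule bounded_alg_hom_op[OF hom])

lemma \<Phi>_mult: "f \<in> B_alg \<Longrightarrow> g \<in> B_alg \<Longrightarrow> \<Phi> (\<lambda>z. f z * g z) x = \<Phi> f (\<Phi> g x)"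
  by (rule bounded_alg_hom_mult[OF hom])

lemma \<Phi>_commute: "f \<in> B_alg \<Longrightarrow> g \<in> B_alg \<Longrightarrow> \<Phi> f (\<Phi> g x) = \<Phi> g (\<Phi> f x)"
proof -
  assume fg: "f \<in> B_alg" "g \<in> B_alg"
  have "(\<lambda>z. f z * g z) = (\<lambda>z. g z * f z)" by (simp add: mult.commute)
  thus ?thesis using \<Phi>_mult[OF fg, of x] \<Phi>_mult[OF fg(2,1), of x] by simp
qed

lemma \<Phi>_bounded: obtains C where "C \<ge> 0" "\<And>f x. f \<in> B_alg \<Longrightarrow> norm (\<Phi> f x) \<le> C * B_norm f * norm x"
  using bounded_alg_hom_bound[OF hom B_norm_nonneg] by blast

lemma rz1_B: "rz 1 \<in> B_alg"
  by (rule rz_in_B_alg) (simp add: rhp_def)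

text \<open>The factor \<open>z\<close> is outside the algebra, and
  \<open>z * rz 1 z = 1 - rz 1 z\<close> trades it for a resolvent, mirroring
  \<open>A (R y) = y - R y\<close>. Additivity of \<open>\<Phi>\<close> applies only to members of
  the algebra, hence the decomposition into pieces each of which is one.\<close>

lemma \<Phi>_exp_taylor2:
  assumes "t \<ge> 0"
  shows "\<Phi> (\<lambda>z. (exp_fn t z - 1 + of_real t * z) * rz 1 z ^ 3) x
    = \<Phi> (exp_fn t) (R (R (R x))) - R (R (R x)) + t *\<^sub>R A (R (R (R x)))"
proof -
  let ?r = "rz 1"
  define r2 where "r2 = (\<lambda>z. ?r z * ?r z)"
  define r3 where "r3 = (\<lambda>z. ?r z * r2 z)"
  define g1 where "g1 = (\<lambda>z. exp_fn t z * r3 z)"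
  define g2 where "g2 = (\<lambda>z. - 1 * r3 z)"
  define g3 where "g3 = (\<lambda>z. of_real t * r2 z)"
  define g4 where "g4 = (\<lambda>z. of_real (- t) * r3 z)"
  define g where "g = (\<lambda>z. (g1 z + g2 z) + (g3 z + g4 z))"
  define g12 where "g12 = (\<lambda>z. g1 z + g2 z)"
  define g34 where "g34 = (\<lambda>z. g3 z + g4 z)"
  have r2B: "r2 \<in> B_alg" unfolding r2_def by (intro B_alg_mult rz1_B)
  have r3B: "r3 \<in> B_alg" unfolding r3_def by (intro B_alg_mult rz1_B r2B)
  have g1B: "g1 \<in> B_alg" unfolding g1_def by (intro B_alg_mult exp_fn_in_B_alg assms r3B)
  have gB: "g2 \<in> B_alg" "g3 \<in> B_alg" "g4 \<in> B_alg"
    unfolding g2_def g3_def g4_def by (intro B_alg_scale r3B r2B)+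
  have g12B: "g12 \<in> B_alg" unfolding g12_def by (intro B_alg_add g1B gB)
  have g34B: "g34 \<in> B_alg" unfolding g34_def by (intro B_alg_add gB)
  have gadd: "g = (\<lambda>z. g12 z + g34 z)" by (simp add: g_def g12_def g34_def)
  have gB': "g \<in> B_alg" unfolding gadd by (intro B_alg_add g12B g34B)
  have r2x: "\<Phi> r2 x = R (R x)" unfolding r2_def R_def by (rule \<Phi>_mult[OF rz1_B rz1_B])
  have r3x: "\<Phi> r3 x = R (R (R x))"
    unfolding r3_def using \<Phi>_mult[OF rz1_B r2B, of x] by (simp add: r2x R_def[symmetric])
  have g1x: "\<Phi> g1 x = \<Phi> (exp_fn t) (R (R (R x)))"
    unfolding g1_def using \<Phi>_mult[OF exp_fn_in_B_alg(1)[OF assms] r3B, of x] by (simp add: r3x)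
  have g2x: "\<Phi> g2 x = - R (R (R x))"
    unfolding g2_def bounded_alg_hom_scale[OF hom r3B] r3x by (simp only: cscale_minus_left cscale_one)
  have g3x: "\<Phi> g3 x = t *\<^sub>R R (R x)"
    unfolding g3_def bounded_alg_hom_scale[OF hom r2B] r2x by (simp only: cscale_of_real)
  have g4x: "\<Phi> g4 x = - (t *\<^sub>R R (R (R x)))"
    unfolding g4_def bounded_alg_hom_scale[OF hom r3B] r3x cscale_of_real by simp
  have gx: "\<Phi> g x = (\<Phi> g1 x + \<Phi> g2 x) + (\<Phi> g3 x + \<Phi> g4 x)"
    unfolding gadd bounded_alg_hom_add[OF hom g12B g34B]
    unfolding g12_def g34_def bounded_alg_hom_add[OF hom g1B gB(1)] bounded_alg_hom_add[OF hom gB(2,3)]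
    by (rule refl)
  have "\<Phi> (\<lambda>z. (exp_fn t z - 1 + of_real t * z) * ?r z ^ 3) = \<Phi> g"
  proof (rule bounded_alg_hom_B_cong[OF hom B_norm_exp_taylor2(1)[OF assms] gB'])
    fix z assume "z \<in> rhp"
    hence "1 + z \<noteq> 0" by (auto simp: rhp_def complex_eq_iff)
    hence zr: "z * ?r z = 1 - ?r z" by (simp add: rz_def field_simps)
    have "(exp_fn t z - 1 + of_real t * z) * ?r z ^ 3
        = exp_fn t z * ?r z ^ 3 - ?r z ^ 3 + of_real t * (z * ?r z) * (?r z)\<^sup>2"
      by (simp add: algebra_simps power2_eq_square power3_eq_cube)
    also have "\<dots> = g z"
      unfolding zr g_def g1_def g2_def g3_def g4_def r3_def r2_def
      by (simp add: algebra_simps power2_eq_square power3_eq_cube)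
    finally show "(exp_fn t z - 1 + of_real t * z) * ?r z ^ 3 = g z" .
  qed
  thus ?thesis unfolding gx g1x g2x g3x g4x A_R by (simp add: scaleR_diff_right gx g1x g2x g3x g4x A_R)
qed

text \<open>Telescoping: \<open>T t\<close> and \<open>\<Phi> (exp_fn t)\<close> agree to second order on the range of \<open>R\<^sup>3\<close>, so over \<open>n\<close>
  steps of length \<open>t / n\<close> the total error is of order \<open>1 / n\<close>.\<close>

lemma \<Phi>_exp_fn_R3:
  assumes t: "t \<ge> 0"
  shows "\<Phi> (exp_fn t) (R (R (R x))) = T t (R (R (R x)))"
proof -
  obtain M where M: "M \<ge> 0" "\<And>t x. norm (T t x) \<le> M * norm x" using T_bounded by blast
  obtain C where C: "C \<ge> 0" "\<And>f x. f \<in> B_alg \<Longrightarrow> norm (\<Phi> f x) \<le> C * B_norm f * norm x"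
    using \<Phi>_bounded by blast
  define S where "S = (\<lambda>s. \<Phi> (exp_fn s))"
  let ?R3 = "\<lambda>x. R (R (R x))"
  have S_op: "bounded_op (S s)" if "s \<ge> 0" for s unfolding S_def by (intro \<Phi>_op exp_fn_in_B_alg that)
  have S_le: "norm (S s x) \<le> 2 * C * norm x" if "s \<ge> 0" for s x
  proof -
    have "norm (S s x) \<le> C * B_norm (exp_fn s) * norm x" unfolding S_def by (intro C exp_fn_in_B_alg that)
    also have "\<dots> \<le> C * 2 * norm x"
      using exp_fn_in_B_alg(2)[OF that] C(1) by (intro mult_right_mono mult_left_mono) auto
    finally show ?thesis by (simp add: mult_ac)
  qed
  have S_add: "S (r + s) x = S r (S s x)" if "r \<ge> 0" "s \<ge> 0" for r s x
  proof -
    have "exp_fn (r + s) = (\<lambda>z. exp_fn r z * exp_fn s z)" by (simp add: fun_eq_iff exp_fn_add)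
    thus ?thesis
      unfolding S_def using \<Phi>_mult[OF exp_fn_in_B_alg(1)[OF that(1)] exp_fn_in_B_alg(1)[OF that(2)]]
      by (simp only:)
  qed
  have S_R: "S s (R x) = R (S s x)" if "s \<ge> 0" for s x
    unfolding S_def R_def by (rule \<Phi>_commute[OF exp_fn_in_B_alg(1)[OF that] rz1_B])
  obtain N where N: "N \<ge> 0" "\<And>x. norm (R x) \<le> N * norm x"
  proof
    show "0 \<le> onorm R" by (rule onorm_pos_le[OF bounded_op_bounded_linear[OF R_op]])
    show "norm (R x) \<le> onorm R * norm x" for x by (rule onorm[OF bounded_op_bounded_linear[OF R_op]])
  qed
  define K where "K = C * 5 + M * ((1 + N) * ((1 + N) * N))"
  have step: "norm (S s (?R3 y) - T s (?R3 y)) \<le> K * s\<^sup>2 * norm y" if s: "s \<ge> 0" for s y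
  proof -
    let ?v = "?R3 y"
    have "norm (S s ?v - ?v + s *\<^sub>R A ?v) \<le> C * (5 * s\<^sup>2) * norm y"
    proof -
      have "norm (S s ?v - ?v + s *\<^sub>R A ?v)
          \<le> C * B_norm (\<lambda>z. (exp_fn s z - 1 + of_real s * z) * rz 1 z ^ 3) * norm y"
        unfolding S_def \<Phi>_exp_taylor2[OF s, symmetric] by (intro C B_norm_exp_taylor2 s)
      also have "\<dots> \<le> C * (5 * s\<^sup>2) * norm y"
        using B_norm_exp_taylor2(2)[OF s] C(1) by (intro mult_right_mono mult_left_mono) auto
      finally show ?thesis .
    qed
    moreover have "norm (T s ?v - ?v + s *\<^sub>R A ?v) \<le> M * s\<^sup>2 * ((1 + N) * ((1 + N) * N) * norm y)"
    proof -
      have Av: "A ?v = R (R y) - ?v" by (rule A_R)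
      have Av': "A ?v \<in> D" unfolding Av by (rule A_diff[OF R_domain R_domain, THEN conjunct1])
      have AAv: "A (A ?v) = (R y - R (R y)) - (R (R y) - ?v)"
        unfolding Av using A_diff[OF R_domain R_domain, of "R y" "R (R y)"] by (simp add: A_R)
      have d: "norm (u - R u) \<le> (1 + N) * norm u" for u
        using norm_triangle_ineq4[of u "R u"] N(2)[of u] by (simp add: distrib_right)
      \<comment> \<open>This is the square of \<open>1 - R\<close> applied to \<open>R y\<close>,
        whence the factor \<open>(1 + N) * ((1 + N) * N)\<close> in \<open>K\<close>.\<close>
      have "A (A ?v) = (R y - R (R y)) - R (R y - R (R y))"
        unfolding AAv by (simp add: bounded_op_diff[OF R_op])
      hence "norm (A (A ?v)) \<le> (1 + N) * norm (R y - R (R y))"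
        using d[of "R y - R (R y)"] by (simp only:)
      also have "\<dots> \<le> (1 + N) * ((1 + N) * norm (R y))" using N(1) by (intro mult_left_mono d) auto
      also have "\<dots> \<le> (1 + N) * ((1 + N) * (N * norm y))" using N(1) by (intro mult_left_mono N(2)) auto
      finally have "norm (A (A ?v)) \<le> (1 + N) * ((1 + N) * N) * norm y" by (simp add: mult_ac)
      hence "M * s\<^sup>2 * norm (A (A ?v)) \<le> M * s\<^sup>2 * ((1 + N) * ((1 + N) * N) * norm y)"
        using M(1) by (intro mult_left_mono) auto
      thus ?thesis using T_taylor2[OF R_domain Av' s M] by (rule order_trans[rotated])
    qed
    moreover have "norm (S s ?v - T s ?v)
        \<le> norm (S s ?v - ?v + s *\<^sub>R A ?v) + norm (T s ?v - ?v + s *\<^sub>R A ?v)"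
      using norm_triangle_ineq4[of "S s ?v - ?v + s *\<^sub>R A ?v" "T s ?v - ?v + s *\<^sub>R A ?v"] by simp
    moreover have "C * (5 * s\<^sup>2) * norm y + M * s\<^sup>2 * ((1 + N) * ((1 + N) * N) * norm y) = K * s\<^sup>2 * norm y"
      by (simp add: K_def algebra_simps)
    ultimately show ?thesis by linarith
  qed
  have K0: "K \<ge> 0" using C(1) M(1) N(1) by (simp add: K_def)
  define c where "c = M * (K * (2 * C * norm x)) * t\<^sup>2"
  have bound: "norm (S t (?R3 x) - T t (?R3 x)) \<le> c / real n" if n: "n > 0" for n :: nat
  proof -
    define s where "s = t / real n"
    have s: "s \<ge> 0" using t by (simp add: s_def)
    \<comment> \<open>Interpolates between the two sides: \<open>k\<close> of the \<open>n\<close>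
      steps are made by \<open>S\<close> and the others by \<open>T\<close>.\<close>
    define a where "a = (\<lambda>k. T (real (n - k) * s) (S (real k * s) (?R3 x)))"
    have stepk: "norm (a (Suc k) - a k) \<le> c / (real n)\<^sup>2" if k: "k < n" for k
    proof -
      define y where "y = S (real k * s) x"
      have ks: "real k * s \<ge> 0" using s by simp
      \<comment> \<open>Commutation of \<open>S\<close> with \<open>R\<close> keeps the intermediate
        vectors in the range of the third power of \<open>R\<close>, where the one-step estimate
        applies.\<close>
      have y3: "S (real k * s) (?R3 x) = ?R3 y" by (simp add: y_def S_R[OF ks])
      have "real (Suc k) * s = s + real k * s" by (simp add: distrib_right)
      hence 1: "S (real (Suc k) * s) (?R3 x) = S s (?R3 y)" by (simp only: S_add[OF s ks] y3)
      have "real (n - k) * s = real (n - Suc k) * s + s" using k by (simp add: of_nat_diff algebra_simps)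
      hence 2: "a k = T (real (n - Suc k) * s) (T s (?R3 y))" by (simp only: a_def T_add y3)
      have "a (Suc k) - a k = T (real (n - Suc k) * s) (S s (?R3 y) - T s (?R3 y))"
        unfolding 2 by (simp only: a_def 1 bounded_op_diff[OF T_op])
      hence "norm (a (Suc k) - a k) \<le> M * norm (S s (?R3 y) - T s (?R3 y))" by (rule ssubst) (rule M(2))
      also have "\<dots> \<le> M * (K * s\<^sup>2 * norm y)" by (intro mult_left_mono step s M(1))
      also have "\<dots> \<le> M * (K * s\<^sup>2 * (2 * C * norm x))"
        unfolding y_def using K0 by (intro mult_left_mono S_le ks M(1)) auto
      also have "\<dots> = c / (real n)\<^sup>2" by (simp add: c_def s_def power_divide)
      finally show ?thesis .
    qed
    have "norm (a n - a 0) = norm (\<Sum>k<n. a (Suc k) - a k)" by (simp only: sum_lessThan_telescope)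
    also have "\<dots> \<le> (\<Sum>k<n. c / (real n)\<^sup>2)" by (intro sum_norm_le stepk) simp
    also have "\<dots> = c / real n" using n by (simp add: power2_eq_square)
    finally have "norm (a n - a 0) \<le> c / real n" .
    moreover have "a n = S t (?R3 x)" using n by (simp add: a_def s_def)
    moreover have "a 0 = T t (?R3 x)" using n \<Phi>_const by (simp add: a_def s_def S_def)
    ultimately show ?thesis by simp
  qed
  have "(\<lambda>n. c / real n) \<longlonglongrightarrow> 0" by (rule lim_const_over_n)
  hence "norm (S t (?R3 x) - T t (?R3 x)) \<le> 0"
    by (rule LIMSEQ_le_const) (intro exI[of _ 1] allI impI bound, simp)
  thus ?thesis by (simp add: S_def)
qed

lemma \<Phi>_exp_fn:
  assumes t: "t \<ge> 0"
  shows "\<Phi> (exp_fn t) = T t"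
proof (rule bounded_op_eq_on_dense[OF \<Phi>_op[OF exp_fn_in_B_alg(1)[OF t]] T_op])
  show "closure (R ` R ` range R) = UNIV"
    by (rule dense_image[OF R_op dense_image[OF R_op dense_range_R dense_range_R] dense_range_R])
  show "\<Phi> (exp_fn t) x = T t x" if "x \<in> R ` R ` range R" for x
  proof -
    from that obtain y where "x = R (R (R y))" by auto
    thus ?thesis by (simp only: \<Phi>_exp_fn_R3[OF t])
  qed
qed

text \<open>Multiplication by \<open>exp_fn N\<close> may move a function that is unbounded on the half-plane into the
  algebra; the group element \<open>T (- N)\<close> undoes the shift.\<close>

definition shiftable :: "real \<Rightarrow> (complex \<Rightarrow> complex) \<Rightarrow> bool" where
  "shiftable N f \<longleftrightarrow> 0 \<le> N \<and> (\<lambda>z. exp_fn N z * f z) \<in> B_alg"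

definition cal :: "(complex \<Rightarrow> complex) \<Rightarrow> 'a \<Rightarrow> 'a" where
  "cal f x = (let N = SOME N. shiftable N f in T (- N) (\<Phi> (\<lambda>z. exp_fn N z * f z) x))"

text \<open>A surplus \<open>M - N\<close> in the shift comes out of \<open>\<Phi>\<close> as
  \<open>T (M - N)\<close> and is absorbed by \<open>T (- M)\<close>. Thus \<open>cal\<close> is
  independent of the shift chosen, and several functions may share one.\<close>

lemma shift_more:
  assumes f: "shiftable N f" and M: "M \<ge> N"
  shows "shiftable M f" and "T (- M) (\<Phi> (\<lambda>z. exp_fn M z * f z) x) = T (- N) (\<Phi> (\<lambda>z. exp_fn N z * f z) x)"
proof -
  have N: "0 \<le> N" and fB: "(\<lambda>z. exp_fn N z * f z) \<in> B_alg" using f by (auto simp: shiftable_def)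
  have eB: "exp_fn (M - N) \<in> B_alg" using M by (intro exp_fn_in_B_alg) simp
  have eq: "(\<lambda>z. exp_fn M z * f z) = (\<lambda>z. exp_fn (M - N) z * (exp_fn N z * f z))"
    by (simp add: fun_eq_iff mult.assoc[symmetric] exp_fn_add[symmetric])
  show "shiftable M f" using N M B_alg_mult[OF eB fB] by (simp add: shiftable_def eq)
  have "\<Phi> (\<lambda>z. exp_fn M z * f z) x = T (M - N) (\<Phi> (\<lambda>z. exp_fn N z * f z) x)"
    unfolding eq \<Phi>_mult[OF eB fB] using \<Phi>_exp_fn[of "M - N"] M by simp
  thus "T (- M) (\<Phi> (\<lambda>z. exp_fn M z * f z) x) = T (- N) (\<Phi> (\<lambda>z. exp_fn N z * f z) x)"
    by (simp add: T_add[symmetric])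
qed

lemma cal_eq:
  assumes "shiftable N f"
  shows "cal f x = T (- N) (\<Phi> (\<lambda>z. exp_fn N z * f z) x)"
proof -
  define K where "K = (SOME N. shiftable N f)"
  have K: "shiftable K f" unfolding K_def by (rule someI[of "\<lambda>N. shiftable N f", OF assms])
  have "cal f x = T (- K) (\<Phi> (\<lambda>z. exp_fn K z * f z) x)" by (simp add: cal_def K_def Let_def)
  also have "\<dots> = T (- max K N) (\<Phi> (\<lambda>z. exp_fn (max K N) z * f z) x)"
    by (rule shift_more(2)[OF K, symmetric]) simp
  also have "\<dots> = T (- N) (\<Phi> (\<lambda>z. exp_fn N z * f z) x)" by (rule shift_more(2)[OF assms]) simp
  finally show ?thesis .
qed

lemma cal_op: "shiftable N f \<Longrightarrow> bounded_op (cal f)"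
proof -
  assume f: "shiftable N f"
  have "cal f = T (- N) \<circ> \<Phi> (\<lambda>z. exp_fn N z * f z)" by (simp add: fun_eq_iff cal_eq[OF f])
  thus ?thesis using f by (simp add: bounded_op_comp T_op \<Phi>_op shiftable_def)
qed

lemma cal_add:
  assumes f: "shiftable N f" and g: "shiftable M g"
  shows "shiftable (max N M) (\<lambda>z. f z + g z)" and "cal (\<lambda>z. f z + g z) x = cal f x + cal g x"
proof -
  define K where "K = max N M"
  have fK: "shiftable K f" and gK: "shiftable K g"
    using shift_more(1)[OF f, of K] shift_more(1)[OF g, of K] by (simp_all add: K_def)
  have B: "(\<lambda>z. exp_fn K z * f z) \<in> B_alg" "(\<lambda>z. exp_fn K z * g z) \<in> B_alg" "K \<ge> 0"
    using fK gK by (auto simp: shiftable_def)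
  have eq: "(\<lambda>z. exp_fn K z * (f z + g z)) = (\<lambda>z. exp_fn K z * f z + exp_fn K z * g z)"
    by (simp add: distrib_left)
  have s: "shiftable K (\<lambda>z. f z + g z)" unfolding shiftable_def eq using B by (simp add: B_alg_add)
  thus "shiftable (max N M) (\<lambda>z. f z + g z)" by (simp add: K_def)
  show "cal (\<lambda>z. f z + g z) x = cal f x + cal g x"
    unfolding cal_eq[OF s] cal_eq[OF fK] cal_eq[OF gK] eq bounded_alg_hom_add[OF hom B(1,2)]
    by (rule bounded_op_add[OF T_op])
qed

lemma cal_mult:
  assumes f: "shiftable N f" and g: "shiftable M g"
  shows "shiftable (N + M) (\<lambda>z. f z * g z)" and "cal (\<lambda>z. f z * g z) x = cal f (cal g x)"
proof -
  have B: "(\<lambda>z. exp_fn N z * f z) \<in> B_alg" "(\<lambda>z. exp_fn M z * g z) \<in> B_alg" "N \<ge> 0" "M \<ge> 0"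
    using f g by (auto simp: shiftable_def)
  have eq: "(\<lambda>z. exp_fn (N + M) z * (f z * g z)) = (\<lambda>z. (exp_fn N z * f z) * (exp_fn M z * g z))"
    by (simp add: fun_eq_iff exp_fn_add mult_ac)
  show s: "shiftable (N + M) (\<lambda>z. f z * g z)" unfolding shiftable_def eq using B by (simp add: B_alg_mult)
  \<comment> \<open>\<open>T M\<close> is itself the image of \<open>exp_fn M\<close> under
    \<open>\<Phi>\<close>, so it commutes with \<open>\<Phi> h\<close>; inverting it gives the claim
    for \<open>T (- M)\<close>.\<close>
  have comm: "T (- M) (\<Phi> h y) = \<Phi> h (T (- M) y)" if h: "h \<in> B_alg" for h y
  proof -
    have "T M (\<Phi> h (T (- M) y)) = \<Phi> h (T M (T (- M) y))"
      using \<Phi>_commute[OF exp_fn_in_B_alg(1)[OF B(4)] h] \<Phi>_exp_fn[OF B(4)] by simp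
    hence "T (- M) (T M (\<Phi> h (T (- M) y))) = T (- M) (\<Phi> h y)" by simp
    thus ?thesis by simp
  qed
  have "cal (\<lambda>z. f z * g z) x = T (- N + - M) (\<Phi> (\<lambda>z. exp_fn N z * f z) (\<Phi> (\<lambda>z. exp_fn M z * g z) x))"
    unfolding cal_eq[OF s] eq \<Phi>_mult[OF B(1,2)] by simp
  also have "\<dots> = cal f (cal g x)"
    unfolding T_add comm[OF B(1)] cal_eq[OF f] cal_eq[OF g] by (rule refl)
  finally show "cal (\<lambda>z. f z * g z) x = cal f (cal g x)" .
qed

lemma cal_B:
  assumes "f \<in> B_alg" shows "shiftable 0 f" and "cal f x = \<Phi> f x"
proof -
  show s: "shiftable 0 f" using assms by (simp add: shiftable_def)
  show "cal f x = \<Phi> f x" unfolding cal_eq[OF s] by simp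
qed

lemma cal_scale: "shiftable N f \<Longrightarrow> cal (\<lambda>z. c * f z) x = cscale c (cal f x)"
proof -
  assume f: "shiftable N f"
  hence B: "(\<lambda>z. exp_fn N z * f z) \<in> B_alg" by (simp add: shiftable_def)
  have eq: "(\<lambda>z. exp_fn N z * (c * f z)) = (\<lambda>z. c * (exp_fn N z * f z))" by (simp add: mult_ac)
  have s: "shiftable N (\<lambda>z. c * f z)"
    using f B_alg_scale[OF B, of c] unfolding shiftable_def eq by simp
  show ?thesis
    unfolding cal_eq[OF s] cal_eq[OF f] eq bounded_alg_hom_scale[OF hom B]
    by (rule bounded_op_cscale[OF T_op])
qed

lemma cal_cong:
  assumes f: "shiftable N f" and g: "shiftable M g" and eq: "\<And>z. z \<in> rhp \<Longrightarrow> f z = g z"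
  shows "cal f x = cal g x"
proof -
  define K where "K = max N M"
  have fK: "shiftable K f" and gK: "shiftable K g"
    using shift_more(1)[OF f, of K] shift_more(1)[OF g, of K] by (simp_all add: K_def)
  have "\<Phi> (\<lambda>z. exp_fn K z * f z) = \<Phi> (\<lambda>z. exp_fn K z * g z)"
    using fK gK by (intro bounded_alg_hom_B_cong[OF hom]) (auto simp: shiftable_def eq)
  thus ?thesis by (simp add: cal_eq[OF fK] cal_eq[OF gK])
qed

lemma shiftable_exp_fn: "shiftable \<bar>t\<bar> (exp_fn t)"
  unfolding shiftable_def exp_fn_add[symmetric] by (simp add: exp_fn_in_B_alg)

text \<open>For negative \<open>t\<close> the exponential is unbounded on \<open>rhp\<close>; the
  shift turns it into \<open>exp_fn (|t| + t)\<close>, to which the identification for nonnegative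
  times applies.\<close>

lemma cal_exp_fn: "cal (exp_fn t) x = T t x"
  unfolding cal_eq[OF shiftable_exp_fn] exp_fn_add[symmetric]
  using \<Phi>_exp_fn[of "\<bar>t\<bar> + t"] by (simp add: T_add[symmetric])

lemma exp_type_shiftable:
  assumes "h \<in> exp_type" obtains N where "shiftable N h"
proof -
  obtain a K where *: "a > 0" "K \<ge> 0" "h holomorphic_on UNIV" "\<And>z. norm (h z) \<le> K * exp (a * \<bar>Re z\<bar>)"
    using exp_typeE[OF assms] by blast
  obtain m where m: "\<And>z. z \<in> iR \<Longrightarrow> norm (h z) \<le> m" using exp_type_bounded_iR[OF assms] by blast
  have "shiftable (2 * a) h"
    using exp_type_shift_in_B_alg(1)[OF *(3,1,4) m] *(1) by (simp add: shiftable_def)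
  thus ?thesis by (rule that)
qed

lemma cal_bounded:
  obtains K where "K \<ge> 0"
    "\<And>h m x. h \<in> exp_type \<Longrightarrow> (\<And>z. z \<in> iR \<Longrightarrow> norm (h z) \<le> m) \<Longrightarrow> norm (cal h x) \<le> K * m * norm x"
proof -
  obtain M where M: "M \<ge> 0" "\<And>t x. norm (T t x) \<le> M * norm x" using T_bounded by blast
  obtain C where C: "C \<ge> 0" "\<And>f x. f \<in> B_alg \<Longrightarrow> norm (\<Phi> f x) \<le> C * B_norm f * norm x"
    using \<Phi>_bounded by blast
  show ?thesis
  \<comment> \<open>\<open>M\<close> bounds the group element that undoes the shift,
    \<open>C\<close> bounds \<open>\<Phi>\<close>, and 6 compares the two function norms for every
    exponential type.\<close>
  proof (rule that[of "M * C * 6"])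
    show "0 \<le> M * C * 6" using M(1) C(1) by simp
    fix h m x assume h: "h \<in> exp_type" and m: "\<And>z. z \<in> iR \<Longrightarrow> norm (h z) \<le> m"
    obtain a K where *: "a > 0" "K \<ge> 0" "h holomorphic_on UNIV" "\<And>z. norm (h z) \<le> K * exp (a * \<bar>Re z\<bar>)"
      using exp_typeE[OF h] by blast
    let ?g = "\<lambda>z. exp_fn (2 * a) z * h z"
    have g: "?g \<in> B_alg" "B_norm ?g \<le> 6 * m"
      using exp_type_shift_in_B_alg[OF *(3,1,4) m] by auto
    have s: "shiftable (2 * a) h" using g(1) *(1) by (simp add: shiftable_def)
    have "norm (cal h x) \<le> M * norm (\<Phi> ?g x)" unfolding cal_eq[OF s] by (rule M(2))
    also have "\<dots> \<le> M * (C * B_norm ?g * norm x)" by (intro mult_left_mono C(2) g(1) M(1))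
    also have "\<dots> \<le> M * (C * (6 * m) * norm x)"
      using g(2) by (intro mult_left_mono mult_right_mono C(1) M(1)) auto
    finally show "norm (cal h x) \<le> M * C * 6 * m * norm x" by (simp add: mult_ac)
  qed
qed

end

section \<open>The induced calculus on the imaginary axis\<close>

lemma Cauchy_null_sequence:
  fixes y :: "nat \<Rightarrow> 'a::real_normed_vector"
  assumes a: "a \<longlonglongrightarrow> 0" and le: "\<And>m n. norm (y m - y n) \<le> a m + a n"
  shows "Cauchy y"
proof (rule metric_CauchyI)
  fix e :: real assume "e > 0"
  hence "eventually (\<lambda>n. a n < e / 2) sequentially" by (intro order_tendstoD(2)[OF a]) simp
  then obtain N where N: "\<And>n. n \<ge> N \<Longrightarrow> a n < e / 2" by (auto simp: eventually_sequentially)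
  have "dist (y m) (y n) < e" if "m \<ge> N" "n \<ge> N" for m n
    using le[of m n] N[OF that(1)] N[OF that(2)] by (simp add: dist_norm)
  thus "\<exists>M. \<forall>m\<ge>M. \<forall>n\<ge>M. dist (y m) (y n) < e" by blast
qed

text \<open>The bounds may vary with \<open>n\<close> so that the limit inherits their limit:
  approximants of a function bounded by \<open>m\<close> on \<open>iR\<close> are only bounded by
  \<open>m\<close> plus the approximation error.\<close>

lemma bounded_op_limit:
  fixes U :: "nat \<Rightarrow> 'a::complex_banach \<Rightarrow> 'a"
  assumes U: "\<And>n. bounded_op (U n)" and le: "\<And>n x. norm (U n x) \<le> K n * norm x"
    and K: "K \<longlonglongrightarrow> k" and lim: "\<And>x. (\<lambda>n. U n x) \<longlonglongrightarrow> W x"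
  shows "bounded_op W" and "norm (W x) \<le> k * norm x"
proof -
  have b: "norm (W x) \<le> k * norm x" for x
    by (rule LIMSEQ_le[OF tendsto_norm[OF lim] tendsto_mult[OF K tendsto_const]]) (use le in blast)
  show "norm (W x) \<le> k * norm x" by (rule b)
  show "bounded_op W"
  proof (rule bounded_opI[OF _ _ b])
    fix x y c
    have "(\<lambda>n. U n (x + y)) \<longlonglongrightarrow> W x + W y"
      unfolding bounded_op_add[OF U] by (rule tendsto_add[OF lim lim])
    thus "W (x + y) = W x + W y" by (rule LIMSEQ_unique[OF lim])
    have "(\<lambda>n. U n (cscale c x)) \<longlonglongrightarrow> cscale c (W x)"
      unfolding bounded_op_cscale[OF U] by (rule bounded_linear.tendsto[OF bounded_linear_cscale lim])
    thus "W (cscale c x) = cscale c (W x)" by (rule LIMSEQ_unique[OF lim])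
  qed
qed

text \<open>Read off from the density result: a function uniformly close to one that is bounded on
  \<open>iR\<close> is bounded there.\<close>

lemma C0_iR_bounded:
  assumes "f \<in> C0_iR"
  shows "bdd_above ((\<lambda>z. norm (f z)) ` iR)"
proof -
  have "f \<in> exp_type_closure" using C0_iR_subset_exp_type_closure assms by (rule subsetD)
  then obtain m where "\<And>z. z \<in> iR \<Longrightarrow> norm (f z) \<le> m" using exp_type_closure_bounded by blast
  thus ?thesis by (rule bdd_aboveI2)
qed

lemma C0_norm_le: "f \<in> C0_iR \<Longrightarrow> z \<in> iR \<Longrightarrow> norm (f z) \<le> sup_norm_iR f"
  unfolding sup_norm_iR_def by (rule cSUP_upper[OF _ C0_iR_bounded])

lemma exp_type_closure_seq:
  assumes "f \<in> exp_type_closure"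
  obtains h where "\<And>n. h n \<in> exp_type" "\<And>n z. z \<in> iR \<Longrightarrow> norm (f z - h n z) \<le> inverse (real (Suc n))"
proof -
  have "\<exists>h. h \<in> exp_type \<and> (\<forall>z\<in>iR. norm (f z - h z) \<le> inverse (real (Suc n)))" for n
    using exp_type_closureD[OF assms, of "inverse (real (Suc n))"] by (metis inverse_positive_iff_positive of_nat_0_less_iff zero_less_Suc)
  then obtain h where "\<forall>n. h n \<in> exp_type \<and> (\<forall>z\<in>iR. norm (f z - h n z) \<le> inverse (real (Suc n)))"
    using choice[of "\<lambda>n h. h \<in> exp_type \<and> (\<forall>z\<in>iR. norm (f z - h z) \<le> inverse (real (Suc n)))"] by blast
  thus ?thesis using that[of h] by blast
qed

section \<open>Extension of the calculus to uniform limits on the imaginary axis\<close>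

context group_B_calculus
begin

lemma cal_op_exp_type: "h \<in> exp_type \<Longrightarrow> bounded_op (cal h)"
  using exp_type_shiftable cal_op by metis

lemma cal_add_exp_type: "h \<in> exp_type \<Longrightarrow> k \<in> exp_type \<Longrightarrow> cal (\<lambda>z. h z + k z) x = cal h x + cal k x"
  using exp_type_shiftable cal_add(2) by metis

lemma cal_mult_exp_type: "h \<in> exp_type \<Longrightarrow> k \<in> exp_type \<Longrightarrow> cal (\<lambda>z. h z * k z) x = cal h (cal k x)"
  using exp_type_shiftable cal_mult(2) by metis

lemma cal_scale_exp_type: "h \<in> exp_type \<Longrightarrow> cal (\<lambda>z. c * h z) x = cscale c (cal h x)"
  using exp_type_shiftable cal_scale by metis

text \<open>Fixing one approximating sequence for each \<open>f\<close> makes \<open>Hop\<close> a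
  function of \<open>f\<close>; \<open>Hop_lim\<close> shows that any other sequence would give the
  same operator.\<close>

definition approx_seq :: "(complex \<Rightarrow> complex) \<Rightarrow> nat \<Rightarrow> complex \<Rightarrow> complex" where
  "approx_seq f = (SOME h. \<forall>n. h n \<in> exp_type \<and> (\<forall>z\<in>iR. norm (f z - h n z) \<le> inverse (real (Suc n))))"

definition Hop :: "(complex \<Rightarrow> complex) \<Rightarrow> 'a \<Rightarrow> 'a" where
  "Hop f x = lim (\<lambda>n. cal (approx_seq f n) x)"

lemma approx_seq:
  assumes "f \<in> exp_type_closure"
  shows "approx_seq f n \<in> exp_type" and "z \<in> iR \<Longrightarrow> norm (f z - approx_seq f n z) \<le> inverse (real (Suc n))"
proof -
  obtain h where h: "\<And>n. h n \<in> exp_type" "\<And>n z. z \<in> iR \<Longrightarrow> norm (f z - h n z) \<le> inverse (real (Suc n))"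
    using exp_type_closure_seq[OF assms] by blast
  hence "\<forall>n. h n \<in> exp_type \<and> (\<forall>z\<in>iR. norm (f z - h n z) \<le> inverse (real (Suc n)))" by blast
  from someI[of "\<lambda>h. \<forall>n. h n \<in> exp_type \<and> (\<forall>z\<in>iR. norm (f z - h n z) \<le> inverse (real (Suc n)))", OF this]
  show "approx_seq f n \<in> exp_type" "z \<in> iR \<Longrightarrow> norm (f z - approx_seq f n z) \<le> inverse (real (Suc n))"
    unfolding approx_seq_def[symmetric] by blast+
qed

text \<open>Two functions within \<open>a\<close> and \<open>b\<close> of \<open>f\<close> on
  \<open>iR\<close> differ there by at most \<open>a + b\<close>, and \<open>cal\<close> turns this
  into a bound for the images. The same estimate yields convergence of the chosen sequence and
  independence of the choice.\<close>

lemma Hop_lim: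
  assumes f: "f \<in> exp_type_closure" and h: "\<And>n. h n \<in> exp_type"
    and e: "e \<longlonglongrightarrow> 0" "\<And>n z. z \<in> iR \<Longrightarrow> norm (f z - h n z) \<le> e n"
  shows "(\<lambda>n. cal (h n) x) \<longlonglongrightarrow> Hop f x"
proof -
  obtain K where K: "K \<ge> 0"
    "\<And>h m x. h \<in> exp_type \<Longrightarrow> (\<And>z. z \<in> iR \<Longrightarrow> norm (h z) \<le> m) \<Longrightarrow> norm (cal h x) \<le> K * m * norm x"
    using cal_bounded by blast
  let ?g = "approx_seq f" and ?a = "\<lambda>n. inverse (real (Suc n))"
  have diff: "norm (cal h x - cal k x) \<le> K * (a + b) * norm x"
    if "h \<in> exp_type" "k \<in> exp_type" "\<And>z. z \<in> iR \<Longrightarrow> norm (f z - h z) \<le> a"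
      "\<And>z. z \<in> iR \<Longrightarrow> norm (f z - k z) \<le> b" for h k a b
  proof -
    have k': "(\<lambda>z. -1 * k z) \<in> exp_type" by (rule exp_type_scale[OF that(2)])
    have "cal h x - cal k x = cal (\<lambda>z. h z + -1 * k z) x"
      unfolding cal_add_exp_type[OF that(1) k'] cal_scale_exp_type[OF that(2)]
      by (simp add: cscale_minus_left)
    moreover have "norm (h z + -1 * k z) \<le> a + b" if z: "z \<in> iR" for z
      using norm_triangle_ineq4[of "f z - k z" "f z - h z"] \<open>\<And>z. z \<in> iR \<Longrightarrow> norm (f z - h z) \<le> a\<close>[OF z]
        \<open>\<And>z. z \<in> iR \<Longrightarrow> norm (f z - k z) \<le> b\<close>[OF z] by simp
    ultimately show ?thesis using K(2)[OF exp_type_add[OF that(1) k'], of "a + b" x] by simp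
  qed
  have a0: "?a \<longlonglongrightarrow> 0" by (rule LIMSEQ_inverse_real_of_nat)
  have "Cauchy (\<lambda>n. cal (?g n) x)"
  proof (rule Cauchy_null_sequence)
    show "(\<lambda>n. K * ?a n * norm x) \<longlonglongrightarrow> 0"
      using tendsto_mult_right[OF tendsto_mult_left[OF a0, of K], of "norm x"] by simp
    show "norm (cal (?g m) x - cal (?g n) x) \<le> K * ?a m * norm x + K * ?a n * norm x" for m n
      using diff[OF approx_seq(1)[OF f, of m] approx_seq(1)[OF f, of n] approx_seq(2)[OF f] approx_seq(2)[OF f]]
      by (simp add: algebra_simps)
  qed
  hence g: "(\<lambda>n. cal (?g n) x) \<longlonglongrightarrow> Hop f x"
    unfolding Hop_def by (simp only: Cauchy_convergent_iff convergent_LIMSEQ_iff)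
  have "(\<lambda>n. K * (e n + ?a n) * norm x) \<longlonglongrightarrow> 0"
    using tendsto_mult_right[OF tendsto_mult_left[OF tendsto_add[OF e(1) a0], of K], of "norm x"] by simp
  hence "(\<lambda>n. cal (h n) x - cal (?g n) x) \<longlonglongrightarrow> 0"
    by (rule Lim_null_comparison[rotated])
      (rule always_eventually, rule allI, rule diff[OF h approx_seq(1)[OF f] e(2) approx_seq(2)[OF f]])
  from tendsto_add[OF this g] show ?thesis by simp
qed

lemma Hop_bound:
  obtains K where "K \<ge> 0"
    "\<And>f m x. f \<in> exp_type_closure \<Longrightarrow> (\<And>z. z \<in> iR \<Longrightarrow> norm (f z) \<le> m) \<Longrightarrow>
      bounded_op (Hop f) \<and> norm (Hop f x) \<le> K * m * norm x"
proof -
  obtain K where K: "K \<ge> 0"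
    "\<And>h m x. h \<in> exp_type \<Longrightarrow> (\<And>z. z \<in> iR \<Longrightarrow> norm (h z) \<le> m) \<Longrightarrow> norm (cal h x) \<le> K * m * norm x"
    using cal_bounded by blast
  let ?a = "\<lambda>n. inverse (real (Suc n))"
  have a0: "?a \<longlonglongrightarrow> 0" by (rule LIMSEQ_inverse_real_of_nat)
  show ?thesis
  proof (rule that[OF K(1)])
    fix f m x assume f: "f \<in> exp_type_closure" and m: "\<And>z. z \<in> iR \<Longrightarrow> norm (f z) \<le> m"
    have le: "norm (cal (approx_seq f n) x) \<le> K * (m + ?a n) * norm x" for n x
    proof (rule K(2)[OF approx_seq(1)[OF f]])
      fix z assume z: "z \<in> iR"
      show "norm (approx_seq f n z) \<le> m + ?a n"
        using norm_triangle_ineq4[of "f z" "f z - approx_seq f n z"] m[OF z] approx_seq(2)[OF f z, of n] by simp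
    qed
    have lim: "(\<lambda>n. K * (m + ?a n)) \<longlonglongrightarrow> K * m"
      using tendsto_mult_left[OF tendsto_add[OF tendsto_const a0, of m], of K] by simp
    note * = bounded_op_limit[OF cal_op_exp_type[OF approx_seq(1)[OF f]] le lim
        Hop_lim[OF f approx_seq(1)[OF f] a0 approx_seq(2)[OF f]]]
    show "bounded_op (Hop f) \<and> norm (Hop f x) \<le> K * m * norm x" using * by blast
  qed
qed

lemma Hop_op: "f \<in> exp_type_closure \<Longrightarrow> bounded_op (Hop f)"
proof -
  assume f: "f \<in> exp_type_closure"
  obtain m where "m > 0" "\<And>z. z \<in> iR \<Longrightarrow> norm (f z) \<le> m" using exp_type_closure_bounded[OF f] by blast
  thus ?thesis using Hop_bound f by metis
qed

lemma Hop_add: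
  assumes f: "f \<in> exp_type_closure" and g: "g \<in> exp_type_closure"
  shows "Hop (\<lambda>z. f z + g z) x = Hop f x + Hop g x"
proof -
  let ?a = "\<lambda>n. inverse (real (Suc n))" and ?h = "approx_seq f" and ?k = "approx_seq g"
  have a0: "?a \<longlonglongrightarrow> 0" by (rule LIMSEQ_inverse_real_of_nat)
  have "(\<lambda>n. cal (\<lambda>z. ?h n z + ?k n z) x) \<longlonglongrightarrow> Hop (\<lambda>z. f z + g z) x"
  proof (rule Hop_lim[OF exp_type_closure_add[OF f g] exp_type_add[OF approx_seq(1)[OF f] approx_seq(1)[OF g]]])
    show "(\<lambda>n. ?a n + ?a n) \<longlonglongrightarrow> 0" using tendsto_add[OF a0 a0] by simp
    fix n z assume z: "z \<in> iR"
    show "norm (f z + g z - (?h n z + ?k n z)) \<le> ?a n + ?a n"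
      unfolding add_diff_add by (rule norm_triangle_mono[OF approx_seq(2)[OF f z] approx_seq(2)[OF g z]])
  qed
  moreover have "(\<lambda>n. cal (\<lambda>z. ?h n z + ?k n z) x) \<longlonglongrightarrow> Hop f x + Hop g x"
    unfolding cal_add_exp_type[OF approx_seq(1)[OF f] approx_seq(1)[OF g]]
    by (intro tendsto_add Hop_lim[OF f approx_seq(1)[OF f] a0 approx_seq(2)[OF f]]
        Hop_lim[OF g approx_seq(1)[OF g] a0 approx_seq(2)[OF g]])
  ultimately show ?thesis by (rule LIMSEQ_unique)
qed

lemma Hop_mult:
  assumes f: "f \<in> exp_type_closure" and g: "g \<in> exp_type_closure"
  shows "Hop (\<lambda>z. f z * g z) x = Hop f (Hop g x)"
proof -
  let ?a = "\<lambda>n. inverse (real (Suc n))" and ?h = "approx_seq f" and ?k = "approx_seq g"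
  have a0: "?a \<longlonglongrightarrow> 0" by (rule LIMSEQ_inverse_real_of_nat)
  have a1: "?a n \<le> 1" for n by (simp add: inverse_le_1_iff)
  obtain K where K: "K \<ge> 0"
    "\<And>h m x. h \<in> exp_type \<Longrightarrow> (\<And>z. z \<in> iR \<Longrightarrow> norm (h z) \<le> m) \<Longrightarrow> norm (cal h x) \<le> K * m * norm x"
    using cal_bounded by blast
  obtain p where p: "p > 0" "\<And>z. z \<in> iR \<Longrightarrow> norm (f z) \<le> p" using exp_type_closure_bounded[OF f] by blast
  obtain q where q: "q > 0" "\<And>z. z \<in> iR \<Longrightarrow> norm (g z) \<le> q" using exp_type_closure_bounded[OF g] by blast
  have hb: "norm (?h n z) \<le> p + 1" if "z \<in> iR" for n z
    using norm_triangle_ineq4[of "f z" "f z - ?h n z"] p(2)[OF that] approx_seq(2)[OF f that, of n] a1[of n] by simp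
  have "(\<lambda>n. cal (\<lambda>z. ?h n z * ?k n z) x) \<longlonglongrightarrow> Hop (\<lambda>z. f z * g z) x"
  proof (rule Hop_lim[OF exp_type_closure_mult[OF f g] exp_type_mult[OF approx_seq(1)[OF f] approx_seq(1)[OF g]]])
    show "(\<lambda>n. ?a n * q + (p + 1) * ?a n) \<longlonglongrightarrow> 0"
      using tendsto_add[OF tendsto_mult_right[OF a0, of q] tendsto_mult_left[OF a0, of "p + 1"]] by simp
    fix n z assume z: "z \<in> iR"
    have "norm (f z * g z - ?h n z * ?k n z) = norm ((f z - ?h n z) * g z + ?h n z * (g z - ?k n z))"
      by (simp add: algebra_simps)
    also have "\<dots> \<le> norm ((f z - ?h n z) * g z) + norm (?h n z * (g z - ?k n z))" by (rule norm_triangle_ineq)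
    also have "\<dots> \<le> ?a n * q + (p + 1) * ?a n"
      unfolding norm_mult
      by (rule add_mono[OF mult_mono[OF approx_seq(2)[OF f z] q(2)[OF z]] mult_mono[OF hb[OF z] approx_seq(2)[OF g z]]])
        (use p(1) in auto)
    finally show "norm (f z * g z - ?h n z * ?k n z) \<le> ?a n * q + (p + 1) * ?a n" .
  qed
  moreover have "(\<lambda>n. cal (\<lambda>z. ?h n z * ?k n z) x) \<longlonglongrightarrow> Hop f (Hop g x)"
  proof -
    let ?y = "Hop g x"
    have y: "(\<lambda>n. cal (?k n) x) \<longlonglongrightarrow> ?y" by (rule Hop_lim[OF g approx_seq(1)[OF g] a0 approx_seq(2)[OF g]])
    have "(\<lambda>n. norm (cal (?k n) x - ?y)) \<longlonglongrightarrow> 0"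
      using tendsto_norm[OF tendsto_diff[OF y tendsto_const[of ?y]]] by simp
    \<comment> \<open>Both factors move with \<open>n\<close>. The operators
      \<open>cal (?h n)\<close> share the bound \<open>K * (p + 1)\<close>, so replacing the inner
      vector by its limit costs an error that vanishes.\<close>
    from tendsto_mult_left[OF this, of "K * (p + 1)"]
    have "(\<lambda>n. K * (p + 1) * norm (cal (?k n) x - ?y)) \<longlonglongrightarrow> 0" by simp
    hence "(\<lambda>n. cal (?h n) (cal (?k n) x - ?y)) \<longlonglongrightarrow> 0"
      by (rule Lim_null_comparison[rotated])
        (rule always_eventually, rule allI, rule K(2)[OF approx_seq(1)[OF f] hb])
    from tendsto_add[OF this Hop_lim[OF f approx_seq(1)[OF f] a0 approx_seq(2)[OF f], of ?y]]
    show ?thesis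
      unfolding cal_mult_exp_type[OF approx_seq(1)[OF f] approx_seq(1)[OF g]]
        bounded_op_add[OF cal_op_exp_type[OF approx_seq(1)[OF f]], symmetric] by simp
  qed
  ultimately show ?thesis by (rule LIMSEQ_unique)
qed

text \<open>Nonzero constants do not belong to \<open>C0_iR\<close>; having \<open>Hop\<close> on
  the larger unital algebra makes compatibility with scalars a case of multiplicativity.\<close>

lemma Hop_const: "Hop (\<lambda>z. c) x = cscale c x"
proof -
  have "(\<lambda>n. cal (\<lambda>z. c) x) \<longlonglongrightarrow> Hop (\<lambda>z. c) x"
    by (rule Hop_lim[where e = "\<lambda>_. 0", OF exp_type_subset_closure[OF exp_type_const] exp_type_const tendsto_const]) simp
  moreover have "cal (\<lambda>z. c) x = cscale c x"
    using cal_scale[OF cal_B(1)[OF B_alg_const[of 1]], of c x] by (simp add: cal_B(2)[OF B_alg_const] \<Phi>_const)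
  ultimately show ?thesis using LIMSEQ_unique[OF _ tendsto_const] by metis
qed

lemma Hop_scale: "f \<in> exp_type_closure \<Longrightarrow> Hop (\<lambda>z. c * f z) x = cscale c (Hop f x)"
  using Hop_mult[OF exp_type_subset_closure[OF exp_type_const[of c]]] by (simp only: Hop_const)

lemma Hop_bounded_alg_hom: "bounded_alg_hom C0_iR sup_norm_iR Hop"
  unfolding bounded_alg_hom_def
proof (intro conjI ballI allI)
  note cl = subsetD[OF C0_iR_subset_exp_type_closure]
  show "bounded_op (Hop f)" if "f \<in> C0_iR" for f by (rule Hop_op[OF cl[OF that]])
  show "Hop (\<lambda>z. f z + g z) = (\<lambda>x. Hop f x + Hop g x)" if "f \<in> C0_iR" "g \<in> C0_iR" for f g
    by (rule ext) (rule Hop_add[OF cl[OF that(1)] cl[OF that(2)]])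
  show "Hop (\<lambda>z. c * f z) = (\<lambda>x. cscale c (Hop f x))" if "f \<in> C0_iR" for c f
    by (rule ext) (rule Hop_scale[OF cl[OF that]])
  show "Hop (\<lambda>z. f z * g z) = Hop f \<circ> Hop g" if "f \<in> C0_iR" "g \<in> C0_iR" for f g
    by (rule ext) (simp only: o_apply Hop_mult[OF cl[OF that(1)] cl[OF that(2)]])
  obtain K where K: "K \<ge> 0"
    "\<And>f m x. f \<in> exp_type_closure \<Longrightarrow> (\<And>z. z \<in> iR \<Longrightarrow> norm (f z) \<le> m) \<Longrightarrow>
      bounded_op (Hop f) \<and> norm (Hop f x) \<le> K * m * norm x"
    using Hop_bound by blast
  show "\<exists>C. \<forall>f\<in>C0_iR. onorm (Hop f) \<le> C * sup_norm_iR f"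
  proof (intro exI[of _ K] ballI)
    fix f assume f: "f \<in> C0_iR"
    have "0 \<in> iR" by (simp add: iR_def)
    hence "0 \<le> sup_norm_iR f" using C0_norm_le[OF f] norm_ge_zero order_trans by blast
    show "onorm (Hop f) \<le> K * sup_norm_iR f"
    proof (rule onorm_bound)
      show "0 \<le> K * sup_norm_iR f" using K(1) \<open>0 \<le> sup_norm_iR f\<close> by simp
      show "norm (Hop f x) \<le> K * sup_norm_iR f * norm x" for x
        by (rule K(2)[OF cl[OF f] C0_norm_le[OF f], THEN conjunct2])
    qed
  qed
qed

text \<open>Since \<open>w + A\<close> is unbounded, invertibility is expressed after composing with
  \<open>R\<close>: \<open>(w + A) R = 1 + (w - 1) R\<close>, the image of
  \<open>(w + z) * rz 1 z\<close>. Multiplying this function by the truncated resolvent leaves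
  \<open>rz 1\<close> and an exponentially small translate of it.\<close>

lemma Hop_resolvent_identity:
  assumes w: "w \<notin> iR"
  shows "Hop (rz w) (x + cscale (w - 1) (R x)) = R x" and "Hop (rz w) (R x) = R (Hop (rz w) x)"
proof -
  define s where "s = (\<lambda>n::nat. sgn (Re w) * real n)"
  have "\<exists>h. h \<in> exp_type \<and> (\<forall>z. (w + z) * h z = 1 - exp (- of_real (s n) * w) * exp_fn (s n) z)" for n
    using truncated_resolvent[of w "s n"] by metis
  then obtain h where h: "\<And>n. h n \<in> exp_type"
    "\<And>n z. (w + z) * h n z = 1 - exp (- of_real (s n) * w) * exp_fn (s n) z"
    by metis
  let ?e = "\<lambda>n. exp (- real n * \<bar>Re w\<bar>)"
  note est = truncated_resolvent_approx[OF w h(2)[unfolded s_def]]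
  have lim: "(\<lambda>n. cal (h n) x) \<longlonglongrightarrow> Hop (rz w) x" for x
    by (rule Hop_lim[OF rz_in_exp_type_closure[OF w] h(1) est(2) est(1)])
  have "\<forall>n. \<exists>N. shiftable N (h n)" using exp_type_shiftable[OF h(1)] by blast
  then obtain N where N: "\<And>n. shiftable (N n) (h n)" using choice[of "\<lambda>n N. shiftable N (h n)"] by blast
  have R_cal: "cal (rz 1) y = R y" for y by (simp only: cal_B(2)[OF rz1_B] R_def)
  note r = cal_B(1)[OF rz1_B]
  have comm: "cal (h n) (R x) = R (cal (h n) x)" for n x
  proof -
    have "cal (\<lambda>z. h n z * rz 1 z) x = cal (\<lambda>z. rz 1 z * h n z) x"
      by (simp only: mult.commute)
    thus ?thesis unfolding cal_mult(2)[OF N r] cal_mult(2)[OF r N] R_cal .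
  qed
  have "(\<lambda>n. R (cal (h n) x)) \<longlonglongrightarrow> R (Hop (rz w) x)"
    by (rule bounded_linear.tendsto[OF bounded_op_bounded_linear[OF R_op] lim])
  from LIMSEQ_unique[OF lim[of "R x", unfolded comm] this]
  show "Hop (rz w) (R x) = R (Hop (rz w) x)" .
  define g where "g = (\<lambda>z. 1 + (w - 1) * rz 1 z)"
  have gB: "g \<in> B_alg" unfolding g_def by (rule B_alg_add[OF B_alg_const B_alg_scale[OF rz1_B]])
  have gx: "cal g x = x + cscale (w - 1) (R x)"
    unfolding cal_B(2)[OF gB] unfolding g_def bounded_alg_hom_add[OF hom B_alg_const B_alg_scale[OF rz1_B]]
      bounded_alg_hom_scale[OF hom rz1_B] \<Phi>_const R_def by (rule refl)
  have key: "cal (h n) (x + cscale (w - 1) (R x))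
      = R x + cscale (- exp (- of_real (s n) * w)) (T (s n) (R x))" for n
  proof -
    let ?c = "- exp (- of_real (s n) * w)"
    define p where "p = (\<lambda>z. exp_fn (s n) z * rz 1 z)"
    have p: "shiftable (\<bar>s n\<bar> + 0) p" unfolding p_def by (rule cal_mult(1)[OF shiftable_exp_fn r])
    have pc: "shiftable (0 + (\<bar>s n\<bar> + 0)) (\<lambda>z. ?c * p z)"
      by (rule cal_mult(1)[OF cal_B(1)[OF B_alg_const] p])
    have "cal (h n) (x + cscale (w - 1) (R x)) = cal (\<lambda>z. h n z * g z) x"
      unfolding cal_mult(2)[OF N cal_B(1)[OF gB]] gx by (rule refl)
    also have "\<dots> = cal (\<lambda>z. rz 1 z + ?c * p z) x"
    proof (rule cal_cong[OF cal_mult(1)[OF N cal_B(1)[OF gB]] cal_add(1)[OF r pc]])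
      fix z assume "z \<in> rhp"
      hence "1 + z \<noteq> 0" by (auto simp: rhp_def complex_eq_iff)
      hence "g z = (w + z) * rz 1 z" by (simp add: g_def rz_def field_simps)
      hence "h n z * g z = ((w + z) * h n z) * rz 1 z" by simp
      also have "\<dots> = rz 1 z + ?c * p z" unfolding h(2) p_def by (simp add: algebra_simps)
      finally show "h n z * g z = rz 1 z + ?c * p z" .
    qed
    also have "\<dots> = R x + cscale ?c (T (s n) (R x))"
      unfolding cal_add(2)[OF r pc] cal_scale[OF p] unfolding p_def cal_mult(2)[OF shiftable_exp_fn r]
        R_cal cal_exp_fn by (rule refl)
    finally show ?thesis .
  qed
  \<comment> \<open>When \<open>Re w\<close> is negative the times \<open>s n\<close> are
    nonpositive, so a bound for the whole group is required to make the remainder vanish.\<close>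
  obtain M where M: "M \<ge> 0" "\<And>t x. norm (T t x) \<le> M * norm x" using T_bounded by blast
  have re: "\<bar>Re w\<bar> > 0" using w by (simp add: iR_def)
  have "(\<lambda>n. ?e n / \<bar>Re w\<bar> * (\<bar>Re w\<bar> * (M * norm (R x)))) \<longlonglongrightarrow> 0"
    using tendsto_mult_right[OF est(2), of "\<bar>Re w\<bar> * (M * norm (R x))"] by simp
  hence z: "(\<lambda>n. cscale (- exp (- of_real (s n) * w)) (T (s n) (R x))) \<longlonglongrightarrow> 0"
  proof (rule Lim_null_comparison[rotated], intro always_eventually allI)
    fix n
    have "norm (exp (- of_real (s n) * w)) = ?e n"
      by (simp add: s_def abs_sgn mult_ac)
    hence "norm (cscale (- exp (- of_real (s n) * w)) (T (s n) (R x))) = ?e n * norm (T (s n) (R x))"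
      by (simp only: norm_cscale norm_minus_cancel)
    also have "\<dots> \<le> ?e n * (M * norm (R x))" by (rule mult_left_mono[OF M(2)]) simp
    also have "\<dots> = ?e n / \<bar>Re w\<bar> * (\<bar>Re w\<bar> * (M * norm (R x)))" using re by simp
    finally show "norm (cscale (- exp (- of_real (s n) * w)) (T (s n) (R x)))
        \<le> ?e n / \<bar>Re w\<bar> * (\<bar>Re w\<bar> * (M * norm (R x)))" .
  qed
  have "(\<lambda>n. R x + cscale (- exp (- of_real (s n) * w)) (T (s n) (R x))) \<longlonglongrightarrow> R x"
    using tendsto_add[OF tendsto_const[of "R x"] z] by simp
  from LIMSEQ_unique[OF lim[of "x + cscale (w - 1) (R x)", unfolded key] this]
  show "Hop (rz w) (x + cscale (w - 1) (R x)) = R x" .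
qed

text \<open>Both identities pass through \<open>R\<close>. A vector \<open>x\<close> of
  \<open>D\<close> is \<open>R (x + A x)\<close>; and for arbitrary \<open>y\<close>, commutation
  with \<open>R\<close> exhibits \<open>Hop (rz w) y\<close> as an element of its range, hence of
  \<open>D\<close>.\<close>

lemma Hop_inverse:
  assumes w: "w \<notin> iR"
  shows "is_inverse_shift D A w (Hop (rz w))"
  unfolding is_inverse_shift_def
proof (intro conjI ballI allI)
  let ?L = "Hop (rz w)"
  fix x assume x: "x \<in> D"
  have e: "cscale w x + A x = (x + A x) + cscale (w - 1) (R (x + A x))"
    unfolding R_left[OF x] cscale_diff_left by simp
  show "?L (cscale w x + A x) = x"
    unfolding e Hop_resolvent_identity(1)[OF w] by (rule R_left[OF x])
next
  let ?L = "Hop (rz w)"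
  have L: "bounded_op ?L" by (rule Hop_op[OF rz_in_exp_type_closure[OF w]])
  fix y
  have "R y = ?L y + cscale (w - 1) (R (?L y))"
    using Hop_resolvent_identity[OF w, of y]
    by (simp add: bounded_op_add[OF L] bounded_op_cscale[OF L])
  hence e: "?L y = R (y - cscale (w - 1) (?L y))"
    by (simp add: bounded_op_diff[OF R_op] bounded_op_cscale[OF R_op])
  show "?L y \<in> D" by (subst e) (rule R_domain)
  have "A (?L y) = (y - cscale (w - 1) (?L y)) - R (y - cscale (w - 1) (?L y))"
    by (subst e) (rule A_R)
  also have "\<dots> = (y - cscale (w - 1) (?L y)) - ?L y" by (simp only: e[symmetric])
  finally show "cscale w (?L y) + A (?L y) = y" by (simp add: cscale_diff_left)
qed

text \<open>The pairs in the graph are those with \<open>R (x + y) = x\<close>, an equaliser of two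
  continuous maps.\<close>

lemma closed_A: "closed_op D A"
  unfolding closed_op_def
proof
  show "lin_op D A" by (rule linear_A)
  have "{(x, A x) | x. x \<in> D} = {p. R (fst p + snd p) = fst p}"
  proof (intro set_eqI iffI)
    fix p assume "p \<in> {(x, A x) | x. x \<in> D}"
    thus "p \<in> {p. R (fst p + snd p) = fst p}" using R_left by auto
  next
    fix p assume "p \<in> {p. R (fst p + snd p) = fst p}"
    hence p: "R (fst p + snd p) = fst p" by simp
    have "fst p \<in> D" using R_domain[of "fst p + snd p"] p by simp
    moreover have "A (fst p) = snd p" using A_R[of "fst p + snd p"] p by simp
    ultimately show "p \<in> {(x, A x) | x. x \<in> D}" by (cases p) auto
  qed
  also have "closed \<dots>"
  proof (rule closed_Collect_eq)
    show "continuous_on UNIV (\<lambda>p. R (fst p + snd p))"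
      by (rule bounded_linear.continuous_on[OF bounded_op_bounded_linear[OF R_op]])
        (intro continuous_on_add continuous_on_fst continuous_on_snd continuous_on_id)
    show "continuous_on UNIV (fst :: 'a \<times> 'a \<Rightarrow> 'a)" by (intro continuous_on_fst continuous_on_id)
  qed
  finally show "closed {(x, A x) | x. x \<in> D}" .
qed

text \<open>\<open>w - A\<close> is the negative of \<open>- w + A\<close>, and \<open>iR\<close> is
  symmetric, so the resolvent at \<open>w\<close> is minus the inverse already constructed for
  \<open>- w\<close>.\<close>

lemma spectrum_subset_iR: "spectrum_op D A \<subseteq> iR"
proof
  fix w assume ws: "w \<in> spectrum_op D A"
  show "w \<in> iR"
  proof (rule ccontr)
    assume "w \<notin> iR"
    hence w: "- w \<notin> iR" by (simp add: iR_def)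
    let ?L = "Hop (rz (- w))"
    have L: "bounded_op ?L" by (rule Hop_op[OF rz_in_exp_type_closure[OF w]])
    have i1: "?L (cscale (- w) x + A x) = x" if "x \<in> D" for x
      using Hop_inverse[OF w] that unfolding is_inverse_shift_def by blast
    have i2: "?L y \<in> D" "cscale (- w) (?L y) + A (?L y) = y" for y
      using Hop_inverse[OF w] unfolding is_inverse_shift_def by blast+
    have "bounded_op (\<lambda>y. - ?L y)"
      using L by (simp add: bounded_op_def bounded_linear_minus cscale_minus_right)
    moreover have "- ?L (cscale w x - A x) = x" if "x \<in> D" for x
      using i1[OF that] bounded_op_minus[OF L, of "cscale w x - A x"] by (simp add: cscale_minus_left)
    moreover have "- ?L y \<in> D \<and> cscale w (- ?L y) - A (- ?L y) = y" for y
    proof -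
      have "0 \<in> D" using linear_A by (simp add: lin_op_def)
      moreover have "A 0 = 0" using A_diff[OF \<open>0 \<in> D\<close> \<open>0 \<in> D\<close>] by simp
      ultimately have "- ?L y \<in> D \<and> A (- ?L y) = - A (?L y)" using A_diff[OF \<open>0 \<in> D\<close> i2(1)[of y]] by simp
      thus ?thesis using i2(2)[of y] by (simp add: cscale_minus_left cscale_minus_right)
    qed
    ultimately have "w \<in> resolvent_set D A" unfolding resolvent_set_def by blast
    thus False using ws by (simp add: spectrum_op_def)
  qed
qed

lemma admits_C0: "admits_C0_calculus D A"
  unfolding admits_C0_calculus_def
  using closed_A dense spectrum_subset_iR Hop_bounded_alg_hom Hop_inverse by blast

end

section \<open>From the imaginary axis to the half-plane\<close>

lemma rz_in_C0_iR:
  assumes "w \<notin> iR" shows "rz w \<in> C0_iR"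
  unfolding C0_iR_def
proof (intro CollectI conjI allI impI)
  have nz: "w + z \<noteq> 0" if "z \<in> iR" for z
    using that assms by (auto simp: iR_def complex_eq_iff)
  show "continuous_on iR (rz w)" unfolding rz_def using nz by (intro continuous_intros) auto
  fix e :: real assume e: "e > 0"
  show "\<exists>R. \<forall>z\<in>iR. norm z \<ge> R \<longrightarrow> norm (rz w z) < e"
  proof (intro exI[of _ "norm w + 1 / e + 1"] ballI impI)
    fix z assume z: "z \<in> iR" "norm z \<ge> norm w + 1 / e + 1"
    have "norm z \<le> norm (w + z) + norm w" using norm_triangle_ineq4[of "w + z" w] by simp
    hence "1 / e < norm (w + z)" using z(2) by linarith
    moreover have "0 < 1 / e" using e by simp
    ultimately have "0 < norm (w + z)" and "1 < e * norm (w + z)" using e by (auto simp: field_simps)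
    thus "norm (rz w z) < e" unfolding rz_def norm_divide norm_one by (simp only: pos_divide_less_eq)
  qed
qed

lemma C0_iR_vanishing:
  assumes "f \<in> C0_iR" "e > 0"
  obtains R where "\<And>z. z \<in> iR \<Longrightarrow> norm z \<ge> R \<Longrightarrow> norm (f z) < e"
proof -
  have "\<forall>e>0. \<exists>R. \<forall>z\<in>iR. norm z \<ge> R \<longrightarrow> norm (f z) < e" using assms(1) by (simp add: C0_iR_def)
  with assms(2) have "\<exists>R. \<forall>z\<in>iR. norm z \<ge> R \<longrightarrow> norm (f z) < e" by (elim allE impE)
  then obtain R where "\<forall>z\<in>iR. norm z \<ge> R \<longrightarrow> norm (f z) < e" ..
  thus ?thesis using that[of R] by blast
qed

text \<open>The ideal property of \<open>C0_iR\<close>. It gives closure under products and later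
  makes \<open>b * f\<close> admissible for merely bounded continuous \<open>b\<close>.\<close>

lemma C0_iR_mult_bounded:
  assumes b: "continuous_on iR b" "\<And>z. z \<in> iR \<Longrightarrow> norm (b z) \<le> m" and f: "f \<in> C0_iR"
  shows "(\<lambda>z. b z * f z) \<in> C0_iR"
  unfolding C0_iR_def
proof (intro CollectI conjI allI impI)
  have cf: "continuous_on iR f" using f by (simp add: C0_iR_def)
  show "continuous_on iR (\<lambda>z. b z * f z)" by (intro continuous_on_mult b cf)
  fix e :: real assume e: "e > 0"
  have "e / (\<bar>m\<bar> + 1) > 0" using e by (intro divide_pos_pos) auto
  then obtain R where R: "\<And>z. z \<in> iR \<Longrightarrow> norm z \<ge> R \<Longrightarrow> norm (f z) < e / (\<bar>m\<bar> + 1)"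
    using C0_iR_vanishing[OF f] by blast
  show "\<exists>R. \<forall>z\<in>iR. norm z \<ge> R \<longrightarrow> norm (b z * f z) < e"
  proof (intro exI[of _ R] ballI impI)
    fix z assume z: "z \<in> iR" "norm z \<ge> R"
    have "norm (b z * f z) \<le> (\<bar>m\<bar> + 1) * norm (f z)"
      unfolding norm_mult using b(2)[OF z(1)] by (intro mult_right_mono) auto
    also have "\<dots> < (\<bar>m\<bar> + 1) * (e / (\<bar>m\<bar> + 1))" by (rule mult_strict_left_mono[OF R[OF z]]) simp
    also have "\<dots> = e" by (simp add: field_simps)
    finally show "norm (b z * f z) < e" .
  qed
qed

lemma C0_iR_add:
  assumes f: "f \<in> C0_iR" and g: "g \<in> C0_iR"
  shows "(\<lambda>z. f z + g z) \<in> C0_iR"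
  unfolding C0_iR_def
proof (intro CollectI conjI allI impI)
  have c: "continuous_on iR f" "continuous_on iR g" using f g by (simp_all add: C0_iR_def)
  show "continuous_on iR (\<lambda>z. f z + g z)" by (intro continuous_on_add c)
  fix e :: real assume "e > 0"
  hence e: "e / 2 > 0" by simp
  obtain R where R: "\<And>z. z \<in> iR \<Longrightarrow> norm z \<ge> R \<Longrightarrow> norm (f z) < e / 2"
    using C0_iR_vanishing[OF f e] by blast
  obtain S where S: "\<And>z. z \<in> iR \<Longrightarrow> norm z \<ge> S \<Longrightarrow> norm (g z) < e / 2"
    using C0_iR_vanishing[OF g e] by blast
  show "\<exists>R. \<forall>z\<in>iR. norm z \<ge> R \<longrightarrow> norm (f z + g z) < e"
  proof (intro exI[of _ "max R S"] ballI impI)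
    fix z assume z: "z \<in> iR" "norm z \<ge> max R S"
    show "norm (f z + g z) < e"
      using R[OF z(1)] S[OF z(1)] z(2) norm_triangle_ineq[of "f z" "g z"] by simp
  qed
qed

lemma C0_iR_scale: "f \<in> C0_iR \<Longrightarrow> (\<lambda>z. c * f z) \<in> C0_iR"
  by (rule C0_iR_mult_bounded[OF continuous_on_const]) auto

lemma C0_iR_mult: "f \<in> C0_iR \<Longrightarrow> g \<in> C0_iR \<Longrightarrow> (\<lambda>z. f z * g z) \<in> C0_iR"
  by (rule C0_iR_mult_bounded[OF _ C0_norm_le]) (auto simp: C0_iR_def)

lemma sup_norm_nonneg: "f \<in> C0_iR \<Longrightarrow> 0 \<le> sup_norm_iR f"
  by (rule order_trans[OF norm_ge_zero C0_norm_le[of f 0]]) (auto simp: iR_def)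

lemma sup_norm_le: "(\<And>z. z \<in> iR \<Longrightarrow> norm (f z) \<le> m) \<Longrightarrow> sup_norm_iR f \<le> m"
  unfolding sup_norm_iR_def by (rule cSUP_least[OF iR_ne])

lemma bounded_alg_hom_C0_cong:
  assumes hom: "bounded_alg_hom C0_iR sup_norm_iR H" and f: "f \<in> C0_iR" and g: "g \<in> C0_iR"
    and eq: "\<And>z. z \<in> iR \<Longrightarrow> f z = g z"
  shows "H f = H g"
  by (rule bounded_alg_hom_cong[OF hom sup_norm_nonneg f g C0_iR_scale[OF g]
        C0_iR_add[OF f C0_iR_scale[OF g]] sup_norm_le]) (simp_all add: eq)

lemma bounded_ops_convergent:
  fixes U :: "nat \<Rightarrow> 'a::complex_banach \<Rightarrow> 'a"
  assumes U: "\<And>n. bounded_op (U n)" and le: "\<And>n x. norm (U n x) \<le> K * norm x" and K: "K \<ge> 0"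
    and S: "closure S = UNIV" and conv: "\<And>s. s \<in> S \<Longrightarrow> convergent (\<lambda>n. U n s)"
  shows "convergent (\<lambda>n. U n x)"
  unfolding Cauchy_convergent_iff[symmetric]
proof (rule metric_CauchyI)
  fix e :: real assume e: "e > 0"
  \<comment> \<open>Adding 1 avoids division by zero if \<open>K = 0\<close>; two quarters of
    \<open>e\<close> pay for moving to the dense set and half is left for the Cauchy term.\<close>
  have "e / (4 * (K + 1)) > 0" using e K by (intro divide_pos_pos) auto
  moreover have "x \<in> closure S" using S by simp
  ultimately obtain s where s: "s \<in> S" "dist s x < e / (4 * (K + 1))"
    unfolding closure_approachable by blast
  have "Cauchy (\<lambda>n. U n s)" using conv[OF s(1)] by (simp add: Cauchy_convergent_iff)
  moreover have "e / 2 > 0" using e by simp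
  ultimately obtain N where N: "\<And>m n. m \<ge> N \<Longrightarrow> n \<ge> N \<Longrightarrow> dist (U m s) (U n s) < e / 2"
    unfolding Cauchy_def by blast
  have d: "norm (U n x - U n s) \<le> e / 4" for n
  proof -
    have "norm (U n x - U n s) \<le> K * norm (x - s)" unfolding bounded_op_diff[OF U, symmetric] by (rule le)
    also have "\<dots> \<le> (K + 1) * (e / (4 * (K + 1)))"
      using s(2) K e by (intro mult_mono) (auto simp: dist_norm norm_minus_commute)
    also have "\<dots> = e / 4"
    proof -
      have "c * (e / (4 * c)) = e / 4" if "c > 0" for c :: real using that by simp
      moreover have "K + 1 > 0" using K by simp
      ultimately show ?thesis by blast
    qed
    finally show ?thesis .
  qed
  have "dist (U m x) (U n x) < e" if "m \<ge> N" "n \<ge> N" for m n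
  proof -
    have "U m x - U n x = (U m x - U m s) + (U m s - U n s) - (U n x - U n s)" by simp
    hence "norm (U m x - U n x) \<le> norm (U m x - U m s) + norm (U m s - U n s) + norm (U n x - U n s)"
      using norm_triangle_ineq4[of "(U m x - U m s) + (U m s - U n s)" "U n x - U n s"]
        norm_triangle_ineq[of "U m x - U m s" "U m s - U n s"] by simp
    thus ?thesis using d[of m] d[of n] N[OF that] by (simp add: dist_norm)
  qed
  thus "\<exists>M. \<forall>m\<ge>M. \<forall>n\<ge>M. dist (U m x) (U n x) < e" by blast
qed

text \<open>The tail \<open>\<integral>\<^sub>0\<^sup>\<delta> sup |f'|\<close> tends to zero, so \<open>f\<close> converges uniformly at the imaginary axis.\<close>

lemma B_alg_horizontal_bound:
  assumes f: "f \<in> B_alg" and a: "0 < a" "a \<le> b"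
  shows "ennreal (norm (f (Complex b y) - f (Complex a y)))
    \<le> (\<integral>\<^sup>+ x. indicator {a..b} x * B0_sup f x \<partial>lborel)"
proof -
  let ?g = "\<lambda>t. deriv f (Complex t y)"
  have in_rhp: "Complex t y \<in> rhp" if "t \<in> {a..b}" for t using that a by (simp add: rhp_def)
  have d: "((\<lambda>t. f (Complex t y)) has_vector_derivative ?g t) (at t within {a..b})" if t: "t \<in> {a..b}" for t
  proof -
    have "((\<lambda>t. of_real t :: complex) has_vector_derivative 1) (at t)"
      unfolding has_vector_derivative_def
      using bounded_linear_imp_has_derivative[OF bounded_linear_of_real] by (simp add: scaleR_conv_of_real)
    from has_vector_derivative_add[OF this has_vector_derivative_const]
    have 1: "((\<lambda>t. Complex t y) has_vector_derivative 1 + 0) (at t)" unfolding Complex_eq .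
    have 2: "(f has_field_derivative ?g t) (at (Complex t y))"
      by (rule holomorphic_derivI[OF B_alg_holomorphic[OF f] open_rhp in_rhp[OF t]])
    from field_vector_diff_chain_at[OF 1 2]
    have "((\<lambda>t. f (Complex t y)) has_vector_derivative ?g t) (at t)"
      by (simp only: o_def add_0_right mult_1_left)
    thus ?thesis by (rule has_vector_derivative_at_within)
  qed
  have cg: "continuous_on {a..b} ?g"
  proof (rule continuous_on_compose2[where f = "\<lambda>t. Complex t y" and g = "deriv f" and t = rhp])
    show "continuous_on rhp (deriv f)"
      by (intro holomorphic_on_imp_continuous_on holomorphic_deriv B_alg_holomorphic f open_rhp)
    show "continuous_on {a..b} (\<lambda>t. Complex t y)"
      unfolding Complex_eq by (intro continuous_intros)
    show "(\<lambda>t. Complex t y) ` {a..b} \<subseteq> rhp" using in_rhp by blast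
  qed
  have I: "(?g has_integral f (Complex b y) - f (Complex a y)) {a..b}"
    by (rule fundamental_theorem_of_calculus[OF a(2) d])
  have gi: "?g integrable_on {a..b}" by (rule integrable_continuous_interval[OF cg])
  have ni: "(\<lambda>t. norm (?g t)) integrable_on {a..b}"
    by (rule integrable_continuous_interval[OF continuous_on_norm[OF cg]])
  have "norm (f (Complex b y) - f (Complex a y)) \<le> integral {a..b} (\<lambda>t. norm (?g t))"
    unfolding integral_unique[OF I, symmetric] by (rule integral_norm_bound_integral[OF gi ni order_refl])
  hence "ennreal (norm (f (Complex b y) - f (Complex a y))) \<le> ennreal (integral {a..b} (\<lambda>t. norm (?g t)))"
    by (rule ennreal_leI)
  also have "\<dots> = (\<integral>\<^sup>+ x. ennreal (indicator {a..b} x * norm (?g x)) \<partial>lborel)"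
    by (rule nn_integral_has_integral_lebesgue[OF _ integrable_integral[OF ni], symmetric]) simp
  also have "\<dots> \<le> (\<integral>\<^sup>+ x. indicator {a..b} x * B0_sup f x \<partial>lborel)"
  proof (rule nn_integral_mono)
    fix x :: real
    show "ennreal (indicator {a..b} x * norm (?g x)) \<le> indicator {a..b} x * B0_sup f x"
    proof (cases "x \<in> {a..b}")
      case True
      hence "0 < Re (Complex x y)" using a by simp
      from B0_sup_ge[OF this, of f] True show ?thesis by simp
    qed simp
  qed
  finally show ?thesis .
qed

text \<open>Dominated convergence with the integrable majorant \<open>B0_sup f\<close>: its cut-offs
  to \<open>{..<d n}\<close> tend to 0 pointwise, because it vanishes at nonpositive reals. The
  supremum over the imaginary part inside the integral makes \<open>d\<close> independent of
  \<open>y\<close>.\<close>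

lemma B_alg_uniform_at_boundary:
  assumes f: "f \<in> B_alg" and e: "e > 0"
  obtains d where "d > 0"
    "\<And>a b y. 0 < a \<Longrightarrow> a < d \<Longrightarrow> 0 < b \<Longrightarrow> b < d \<Longrightarrow> norm (f (Complex a y) - f (Complex b y)) \<le> e"
proof -
  define d where "d = (\<lambda>n::nat. inverse (real (Suc n)))"
  have d0: "d n > 0" for n by (simp add: d_def)
  define u where "u = (\<lambda>n x. indicator {..<d n} x * B0_sup f x)"
  note [measurable] = borel_measurable_B0_sup[OF B_alg_holomorphic[OF f]]
  have "(\<lambda>n. \<integral>\<^sup>+ x. u n x \<partial>lborel) \<longlonglongrightarrow> (\<integral>\<^sup>+ (x::real). 0 \<partial>lborel)"
  proof (rule nn_integral_dominated_convergence[where w = "B0_sup f"])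
    show "u n \<in> borel_measurable lborel" for n unfolding u_def by measurable
    show "AE x in lborel. u n x \<le> B0_sup f x" for n
      by (rule AE_I2) (simp add: u_def indicator_def)
    show "(\<integral>\<^sup>+ x. B0_sup f x \<partial>lborel) < \<infinity>" using B_alg_B0[OF f] by (simp add: B0_integral_eq)
    show "AE x in lborel. (\<lambda>n. u n x) \<longlonglongrightarrow> 0"
    proof (rule AE_I2)
      fix x :: real
      show "(\<lambda>n. u n x) \<longlonglongrightarrow> 0"
      proof (cases "x > 0")
        case True
        have "d \<longlonglongrightarrow> 0" unfolding d_def by (rule LIMSEQ_inverse_real_of_nat)
        hence "eventually (\<lambda>n. d n < x) sequentially" using True by (rule order_tendstoD(2))
        hence "eventually (\<lambda>n. u n x = 0) sequentially"
          by (rule eventually_mono) (simp add: u_def)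
        thus ?thesis by (rule tendsto_eventually)
      next
        case False
        hence "u n x = 0" for n by (simp add: u_def B0_sup_def)
        thus ?thesis by simp
      qed
    qed
    show "(\<lambda>x. 0::ennreal) \<in> borel_measurable lborel" by simp
    show "B0_sup f \<in> borel_measurable lborel" by measurable
  qed
  hence "(\<lambda>n. \<integral>\<^sup>+ x. u n x \<partial>lborel) \<longlonglongrightarrow> 0" by simp
  moreover have "ennreal e > 0" using e by simp
  ultimately have "eventually (\<lambda>n. (\<integral>\<^sup>+ x. u n x \<partial>lborel) < ennreal e) sequentially"
    by (rule order_tendstoD(2))
  then obtain n where n: "(\<integral>\<^sup>+ x. u n x \<partial>lborel) < ennreal e"
    unfolding eventually_sequentially by blast
  have le: "norm (f (Complex b y) - f (Complex a y)) \<le> e" if "0 < a" "a \<le> b" "b < d n" for a b y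
  proof -
    have "ennreal (norm (f (Complex b y) - f (Complex a y)))
        \<le> (\<integral>\<^sup>+ x. indicator {a..b} x * B0_sup f x \<partial>lborel)"
      by (rule B_alg_horizontal_bound[OF f that(1,2)])
    also have "\<dots> \<le> (\<integral>\<^sup>+ x. u n x \<partial>lborel)"
      unfolding u_def using that(3) by (intro nn_integral_mono mult_right_mono) (auto simp: indicator_def)
    also have "\<dots> \<le> ennreal e" using n by simp
    finally show ?thesis using e by simp
  qed
  show ?thesis
  proof (rule that[OF d0[of n]])
    fix a b y assume "0 < a" "a < d n" "0 < b" "b < d n"
    thus "norm (f (Complex a y) - f (Complex b y)) \<le> e"
      using le[of a b y] le[of b a y] by (cases "a \<le> b") (auto simp: norm_minus_commute)
  qed
qed

text \<open>Approaches the axis horizontally and ignores \<open>Re z\<close>. Boundary values are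
  therefore defined at every complex number, and their bounds and algebraic rules hold without
  restriction to \<open>iR\<close>.\<close>

definition near :: "nat \<Rightarrow> complex \<Rightarrow> complex" where
  "near n z = Complex (inverse (real (Suc n))) (Im z)"

definition boundary_value :: "(complex \<Rightarrow> complex) \<Rightarrow> complex \<Rightarrow> complex" where
  "boundary_value f z = lim (\<lambda>n. f (near n z))"

lemma near_in_rhp: "near n z \<in> rhp"
  by (simp add: near_def rhp_def)

lemma near_tendsto:
  assumes z: "z \<in> iR"
  shows "(\<lambda>n. near n z) \<longlonglongrightarrow> z"
proof -
  have "Complex r (Im z) = of_real r + z" for r using z by (simp add: iR_def complex_eq_iff)
  hence "near n z = of_real (inverse (real (Suc n))) + z" for n unfolding near_def by blast
  moreover have "(\<lambda>n. of_real (inverse (real (Suc n))) + z) \<longlonglongrightarrow> of_real 0 + z"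
    by (intro tendsto_add tendsto_of_real LIMSEQ_inverse_real_of_nat tendsto_const)
  ultimately show ?thesis by (simp only: of_real_0 add_0)
qed

text \<open>A single index \<open>N\<close> serves all \<open>z\<close>; continuity of the boundary
  function rests on this uniformity.\<close>

lemma B_alg_near_Cauchy:
  assumes f: "f \<in> B_alg" and e: "e > 0"
  obtains N where "\<And>m n z. m \<ge> N \<Longrightarrow> n \<ge> N \<Longrightarrow> norm (f (near m z) - f (near n z)) \<le> e"
proof -
  obtain d where d: "d > 0"
    "\<And>a b y. 0 < a \<Longrightarrow> a < d \<Longrightarrow> 0 < b \<Longrightarrow> b < d \<Longrightarrow> norm (f (Complex a y) - f (Complex b y)) \<le> e"
    using B_alg_uniform_at_boundary[OF f e] by blast
  have "eventually (\<lambda>n. inverse (real (Suc n)) < d) sequentially"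
    by (rule order_tendstoD(2)[OF LIMSEQ_inverse_real_of_nat d(1)])
  then obtain N where N: "\<And>n. n \<ge> N \<Longrightarrow> inverse (real (Suc n)) < d"
    unfolding eventually_sequentially by blast
  show ?thesis by (rule that[of N], unfold near_def) (rule d(2)[OF _ N _ N]; simp)
qed

lemma boundary_value_lim:
  assumes f: "f \<in> B_alg"
  shows "(\<lambda>n. f (near n z)) \<longlonglongrightarrow> boundary_value f z"
proof -
  have "Cauchy (\<lambda>n. f (near n z))"
  proof (rule metric_CauchyI)
    fix e :: real assume "e > 0"
    hence "e / 2 > 0" by simp
    then obtain N where N: "\<And>m n z. m \<ge> N \<Longrightarrow> n \<ge> N \<Longrightarrow> norm (f (near m z) - f (near n z)) \<le> e / 2"
      using B_alg_near_Cauchy[OF f] by blast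
    have "dist (f (near m z)) (f (near n z)) < e" if "m \<ge> N" "n \<ge> N" for m n
      using N[OF that, of z] \<open>e > 0\<close> by (simp add: dist_norm)
    thus "\<exists>M. \<forall>m\<ge>M. \<forall>n\<ge>M. dist (f (near m z)) (f (near n z)) < e" by blast
  qed
  thus ?thesis unfolding boundary_value_def by (simp only: Cauchy_convergent_iff convergent_LIMSEQ_iff)
qed

lemma boundary_value_continuous:
  assumes f: "f \<in> B_alg"
  shows "continuous_on iR (boundary_value f)"
proof (rule uniform_limit_theorem)
  have "continuous_on iR (\<lambda>z. f (near n z))" for n
  proof (rule continuous_on_compose2[OF holomorphic_on_imp_continuous_on[OF B_alg_holomorphic[OF f]]])
    show "continuous_on iR (near n)" unfolding near_def Complex_eq by (intro continuous_intros)
    show "near n ` iR \<subseteq> rhp" using near_in_rhp by blast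
  qed
  thus "eventually (\<lambda>n. continuous_on iR (\<lambda>z. f (near n z))) sequentially" by simp
  show "uniform_limit iR (\<lambda>n z. f (near n z)) (boundary_value f) sequentially"
    unfolding uniform_limit_iff
  proof (intro allI impI)
    fix e :: real assume "e > 0"
    hence "e / 2 > 0" by simp
    then obtain N where N: "\<And>m n z. m \<ge> N \<Longrightarrow> n \<ge> N \<Longrightarrow> norm (f (near m z) - f (near n z)) \<le> e / 2"
      using B_alg_near_Cauchy[OF f] by blast
    have "dist (f (near n z)) (boundary_value f z) < e" if n: "n \<ge> N" for n z
    proof -
      have "norm (f (near n z) - boundary_value f z) \<le> e / 2"
        by (rule LIMSEQ_le_const2[OF tendsto_norm[OF tendsto_diff[OF tendsto_const boundary_value_lim[OF f]]]])
          (use N[OF n] in blast)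
      thus ?thesis using \<open>e > 0\<close> by (simp add: dist_norm)
    qed
    thus "eventually (\<lambda>n. \<forall>z\<in>iR. dist (f (near n z)) (boundary_value f z) < e) sequentially"
      unfolding eventually_sequentially by blast
  qed
qed simp

lemma boundary_value_bound:
  assumes f: "f \<in> B_alg"
  shows "norm (boundary_value f z) \<le> B_norm f"
proof (rule LIMSEQ_le_const2[OF tendsto_norm[OF boundary_value_lim[OF f]]])
  show "\<exists>N. \<forall>n\<ge>N. norm (f (near n z)) \<le> B_norm f"
    using order_trans[OF B_alg_norm_le[OF f near_in_rhp] B_sup_le_B_norm] by blast
qed

text \<open>This and the next two rules are equations between total functions, so they can be
  rewritten inside the argument of the extended calculus.\<close>

lemma boundary_value_add: "f \<in> B_alg \<Longrightarrow> g \<in> B_alg \<Longrightarrow> boundary_value (\<lambda>z. f z + g z) = (\<lambda>z. boundary_value f z + boundary_value g z)"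
  by (rule ext) (rule LIMSEQ_unique[OF boundary_value_lim[OF B_alg_add] tendsto_add[OF boundary_value_lim boundary_value_lim]])

lemma boundary_value_mult: "f \<in> B_alg \<Longrightarrow> g \<in> B_alg \<Longrightarrow> boundary_value (\<lambda>z. f z * g z) = (\<lambda>z. boundary_value f z * boundary_value g z)"
  by (rule ext) (rule LIMSEQ_unique[OF boundary_value_lim[OF B_alg_mult] tendsto_mult[OF boundary_value_lim boundary_value_lim]])

lemma boundary_value_scale: "f \<in> B_alg \<Longrightarrow> boundary_value (\<lambda>z. c * f z) = (\<lambda>z. c * boundary_value f z)"
  by (rule ext) (rule LIMSEQ_unique[OF boundary_value_lim[OF B_alg_scale] tendsto_mult[OF tendsto_const boundary_value_lim]])

lemma boundary_value_rz:
  assumes w: "w \<in> rhp" and z: "z \<in> iR"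
  shows "boundary_value (rz w) z = rz w z"
proof (rule LIMSEQ_unique[OF boundary_value_lim[OF rz_in_B_alg[OF w]]])
  have "w + z \<noteq> 0" using w z by (auto simp: rhp_def iR_def complex_eq_iff)
  thus "(\<lambda>n. rz w (near n z)) \<longlonglongrightarrow> rz w z"
    unfolding rz_def by (intro tendsto_divide tendsto_add tendsto_const near_tendsto[OF z])
qed

section \<open>Extension of a calculus to bounded continuous functions\<close>

locale C0_calculus =
  fixes D :: "'a::complex_banach set" and A :: "'a \<Rightarrow> 'a" and H :: "(complex \<Rightarrow> complex) \<Rightarrow> 'a \<Rightarrow> 'a"
  assumes dense: "densely_defined D"
    and hom: "bounded_alg_hom C0_iR sup_norm_iR H"
    and inverse: "\<And>z. z \<notin> iR \<Longrightarrow> is_inverse_shift D A z (H (rz z))"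
begin

text \<open>The homomorphism extends to bounded continuous functions by means of the approximate unit
  \<open>n r\<^sub>n\<close>, whose images converge strongly to the identity.\<close>

definition BC :: "(complex \<Rightarrow> complex) set" where
  "BC = {b. continuous_on iR b \<and> (\<exists>m. \<forall>z\<in>iR. norm (b z) \<le> m)}"

definition unit_seq :: "nat \<Rightarrow> complex \<Rightarrow> complex" where
  "unit_seq n = (\<lambda>z. of_nat (Suc n) * rz (of_nat (Suc n)) z)"

definition ext_cal :: "(complex \<Rightarrow> complex) \<Rightarrow> 'a \<Rightarrow> 'a" where
  "ext_cal b x = lim (\<lambda>n. H (\<lambda>z. b z * unit_seq n z) x)"

lemma BC_C0: "b \<in> BC \<Longrightarrow> f \<in> C0_iR \<Longrightarrow> (\<lambda>z. b z * f z) \<in> C0_iR"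
  unfolding BC_def using C0_iR_mult_bounded by blast

lemma BC_add: "b \<in> BC \<Longrightarrow> c \<in> BC \<Longrightarrow> (\<lambda>z. b z + c z) \<in> BC"
proof -
  assume "b \<in> BC" "c \<in> BC"
  then obtain m k where "continuous_on iR b" "continuous_on iR c"
    and m: "\<And>z. z \<in> iR \<Longrightarrow> norm (b z) \<le> m" "\<And>z. z \<in> iR \<Longrightarrow> norm (c z) \<le> k"
    unfolding BC_def by blast
  moreover have "norm (b z + c z) \<le> m + k" if "z \<in> iR" for z
    by (rule norm_triangle_mono[OF m(1)[OF that] m(2)[OF that]])
  ultimately show ?thesis unfolding BC_def by (auto intro: continuous_on_add)
qed

lemma BC_mult: "b \<in> BC \<Longrightarrow> c \<in> BC \<Longrightarrow> (\<lambda>z. b z * c z) \<in> BC"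
proof -
  assume "b \<in> BC" "c \<in> BC"
  then obtain m k where "continuous_on iR b" "continuous_on iR c"
    and m: "\<And>z. z \<in> iR \<Longrightarrow> norm (b z) \<le> m" "\<And>z. z \<in> iR \<Longrightarrow> norm (c z) \<le> k"
    unfolding BC_def by blast
  moreover have "norm (b z * c z) \<le> m * k" if "z \<in> iR" for z
    unfolding norm_mult
    by (rule mult_mono[OF m(1)[OF that] m(2)[OF that] order_trans[OF norm_ge_zero m(1)[OF that]] norm_ge_zero])
  ultimately show ?thesis unfolding BC_def by (auto intro: continuous_on_mult)
qed

lemma BC_const: "(\<lambda>z. c) \<in> BC"
  unfolding BC_def by auto

lemma BC_boundary_value: "f \<in> B_alg \<Longrightarrow> boundary_value f \<in> BC"
  unfolding BC_def using boundary_value_continuous boundary_value_bound by blast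

lemma H_op: "f \<in> C0_iR \<Longrightarrow> bounded_op (H f)"
  by (rule bounded_alg_hom_op[OF hom])

lemma H_mult: "f \<in> C0_iR \<Longrightarrow> g \<in> C0_iR \<Longrightarrow> H (\<lambda>z. f z * g z) x = H f (H g x)"
  by (rule bounded_alg_hom_mult[OF hom])

lemma H_bounded:
  obtains K where "K \<ge> 0" "\<And>f m x. f \<in> C0_iR \<Longrightarrow> (\<And>z. z \<in> iR \<Longrightarrow> norm (f z) \<le> m) \<Longrightarrow> norm (H f x) \<le> K * m * norm x"
proof -
  obtain K where K: "K \<ge> 0" "\<And>f x. f \<in> C0_iR \<Longrightarrow> norm (H f x) \<le> K * sup_norm_iR f * norm x"
    using bounded_alg_hom_bound[OF hom sup_norm_nonneg] by blast
  show ?thesis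
  proof (rule that[OF K(1)])
    fix f m x assume f: "f \<in> C0_iR" and m: "\<And>z. z \<in> iR \<Longrightarrow> norm (f z) \<le> m"
    have "norm (H f x) \<le> K * sup_norm_iR f * norm x" by (rule K(2)[OF f])
    also have "\<dots> \<le> K * m * norm x" by (intro mult_right_mono mult_left_mono sup_norm_le m K(1)) auto
    finally show "norm (H f x) \<le> K * m * norm x" .
  qed
qed

lemma pos_not_iR: "complex_of_nat (Suc n) \<notin> iR"
  by (simp add: iR_def)

lemma norm_rz_pos: "z \<in> iR \<Longrightarrow> norm (rz (of_nat (Suc n)) z) \<le> inverse (real (Suc n))"
proof -
  assume z: "z \<in> iR"
  have "real (Suc n) \<le> norm (of_nat (Suc n) + z)"
    using complex_Re_le_cmod[of "of_nat (Suc n) + z"] z by (simp add: iR_def)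
  thus ?thesis unfolding rz_def inverse_eq_divide[symmetric] norm_inverse
    by (rule le_imp_inverse_le) simp
qed

lemma unit_seq_C0: "unit_seq n \<in> C0_iR"
  unfolding unit_seq_def by (rule C0_iR_scale[OF rz_in_C0_iR[OF pos_not_iR]])

lemma norm_unit_seq: "z \<in> iR \<Longrightarrow> norm (unit_seq n z) \<le> 1"
proof -
  assume z: "z \<in> iR"
  have "norm (unit_seq n z) = real (Suc n) * norm (rz (of_nat (Suc n)) z)"
    unfolding unit_seq_def norm_mult norm_of_nat by (rule refl)
  also have "\<dots> \<le> real (Suc n) * inverse (real (Suc n))" by (rule mult_left_mono[OF norm_rz_pos[OF z]]) simp
  also have "\<dots> = 1" by simp
  finally show ?thesis .
qed

definition R :: "'a \<Rightarrow> 'a" where "R = H (rz 1)"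

lemma one_not_iR: "1 \<notin> iR" by (simp add: iR_def)

lemma r1_C0: "rz 1 \<in> C0_iR" by (rule rz_in_C0_iR[OF one_not_iR])

lemma R_op: "bounded_op R" unfolding R_def by (rule H_op[OF r1_C0])

lemma dense_range_R: "closure (range R) = UNIV"
proof -
  have i: "R (cscale 1 x + A x) = x" if "x \<in> D" for x
    using inverse[OF one_not_iR] that unfolding is_inverse_shift_def R_def by blast
  have "D \<subseteq> range R"
  proof
    fix x assume "x \<in> D"
    from i[OF this, symmetric] show "x \<in> range R" by (rule range_eqI)
  qed
  from closure_mono[OF this] show ?thesis using dense by (auto simp: densely_defined_def)
qed

text \<open>On \<open>D\<close> the error is minus the resolvent at \<open>Suc n\<close> applied to
  \<open>A x\<close>, of size \<open>K / (n + 1)\<close> times \<open>norm (A x)\<close>. The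
  uniform bound extends convergence to the whole space, and the limit operator is the identity
  because it is so on a dense set.\<close>

lemma H_unit_seq: "(\<lambda>n. H (unit_seq n) x) \<longlonglongrightarrow> x"
proof -
  obtain K where K: "K \<ge> 0" "\<And>f m x. f \<in> C0_iR \<Longrightarrow> (\<And>z. z \<in> iR \<Longrightarrow> norm (f z) \<le> m) \<Longrightarrow> norm (H f x) \<le> K * m * norm x"
    using H_bounded by blast
  have le: "norm (H (unit_seq n) x) \<le> K * norm x" for n x
    using K(2)[OF unit_seq_C0 norm_unit_seq, of n x] by simp
  have onD: "(\<lambda>n. H (unit_seq n) x) \<longlonglongrightarrow> x" if x: "x \<in> D" for x
  proof -
    have eq: "H (unit_seq n) x - x = - H (rz (of_nat (Suc n))) (A x)" for n
    proof -
      let ?N = "complex_of_nat (Suc n)"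
      have r: "rz ?N \<in> C0_iR" by (rule rz_in_C0_iR[OF pos_not_iR])
      have "H (rz ?N) (cscale ?N x + A x) = x"
        using inverse[OF pos_not_iR] x unfolding is_inverse_shift_def by blast
      hence "cscale ?N (H (rz ?N) x) + H (rz ?N) (A x) = x"
        by (simp only: bounded_op_add[OF H_op[OF r]] bounded_op_cscale[OF H_op[OF r]])
      moreover have "H (unit_seq n) x = cscale ?N (H (rz ?N) x)"
        unfolding unit_seq_def by (rule bounded_alg_hom_scale[OF hom r])
      ultimately show ?thesis by (simp add: algebra_simps)
    qed
    have "(\<lambda>n. K * inverse (real (Suc n)) * norm (A x)) \<longlonglongrightarrow> 0"
      using tendsto_mult_right[OF tendsto_mult_left[OF LIMSEQ_inverse_real_of_nat, of K], of "norm (A x)"] by simp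
    hence "(\<lambda>n. H (unit_seq n) x - x) \<longlonglongrightarrow> 0"
    proof (rule Lim_null_comparison[rotated], intro always_eventually allI)
      fix n
      show "norm (H (unit_seq n) x - x) \<le> K * inverse (real (Suc n)) * norm (A x)"
        unfolding eq norm_minus_cancel by (rule K(2)[OF rz_in_C0_iR[OF pos_not_iR] norm_rz_pos])
    qed
    thus ?thesis by (simp add: LIM_zero_iff)
  qed
  have op: "bounded_op (H (unit_seq n))" for n by (rule H_op[OF unit_seq_C0])
  have conv: "convergent (\<lambda>n. H (unit_seq n) x)" for x
    by (rule bounded_ops_convergent[OF op le K(1) dense[unfolded densely_defined_def] convergentI[OF onD]])
  have lim: "(\<lambda>n. H (unit_seq n) x) \<longlonglongrightarrow> lim (\<lambda>n. H (unit_seq n) x)" for x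
    using conv by (simp only: convergent_LIMSEQ_iff)
  have W: "bounded_op (\<lambda>x. lim (\<lambda>n. H (unit_seq n) x))"
    by (rule bounded_op_limit(1)[OF op le tendsto_const lim])
  have "(\<lambda>x. lim (\<lambda>n. H (unit_seq n) x)) = (\<lambda>x. x)"
  proof (rule bounded_op_eq_on_dense[OF W _ dense[unfolded densely_defined_def]])
    show "bounded_op (\<lambda>x::'a. x)" by (rule bounded_opI[where K = 1]) auto
    show "lim (\<lambda>n. H (unit_seq n) x) = x" if "x \<in> D" for x by (rule limI[OF onD[OF that]])
  qed
  from fun_cong[OF this, of x] lim[of x] show ?thesis by simp
qed

text \<open>The factor \<open>rz 1\<close> behind \<open>R\<close> can be moved next to
  \<open>b\<close>. As \<open>b * rz 1\<close> lies in \<open>C0_iR\<close>, only the approximate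
  unit still depends on \<open>n\<close>, and it tends strongly to the identity.\<close>

lemma ext_cal_on_range:
  assumes b: "b \<in> BC"
  shows "(\<lambda>n. H (\<lambda>z. b z * unit_seq n z) (R y)) \<longlonglongrightarrow> H (\<lambda>z. b z * rz 1 z) y"
proof -
  have "H (\<lambda>z. b z * unit_seq n z) (R y) = H (unit_seq n) (H (\<lambda>z. b z * rz 1 z) y)" for n
  proof -
    have "(\<lambda>z. (b z * unit_seq n z) * rz 1 z) = (\<lambda>z. unit_seq n z * (b z * rz 1 z))"
      by (simp only: mult_ac)
    thus ?thesis
      unfolding R_def H_mult[OF BC_C0[OF b unit_seq_C0] r1_C0, symmetric]
        H_mult[OF unit_seq_C0 BC_C0[OF b r1_C0], symmetric] by (rule arg_cong)
  qed
  thus ?thesis by (simp only: H_unit_seq)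
qed

text \<open>Convergence on the dense range of \<open>R\<close> and the uniform bound give a strong
  limit everywhere. \<open>K\<close> is obtained before \<open>b\<close>, so one constant serves the
  whole algebra.\<close>

lemma ext_cal_bounded:
  obtains K where "K \<ge> 0"
    "\<And>b m x. b \<in> BC \<Longrightarrow> (\<And>z. z \<in> iR \<Longrightarrow> norm (b z) \<le> m) \<Longrightarrow>
      (\<lambda>n. H (\<lambda>z. b z * unit_seq n z) x) \<longlonglongrightarrow> ext_cal b x \<and>
      bounded_op (ext_cal b) \<and> norm (ext_cal b x) \<le> K * m * norm x"
proof -
  obtain K where K: "K \<ge> 0" "\<And>f m x. f \<in> C0_iR \<Longrightarrow> (\<And>z. z \<in> iR \<Longrightarrow> norm (f z) \<le> m) \<Longrightarrow> norm (H f x) \<le> K * m * norm x"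
    using H_bounded by blast
  show ?thesis
  proof (rule that[OF K(1)])
    fix b m x assume b: "b \<in> BC" and m: "\<And>z. z \<in> iR \<Longrightarrow> norm (b z) \<le> m"
    have "0 \<in> iR" by (simp add: iR_def)
    hence m0: "m \<ge> 0" by (rule order_trans[OF norm_ge_zero m])
    let ?U = "\<lambda>n. H (\<lambda>z. b z * unit_seq n z)"
    have C0: "(\<lambda>z. b z * unit_seq n z) \<in> C0_iR" for n by (rule BC_C0[OF b unit_seq_C0])
    have le: "norm (?U n x) \<le> K * m * norm x" for n x
    proof (rule K(2)[OF C0])
      fix z assume z: "z \<in> iR"
      have "norm (b z * unit_seq n z) \<le> m * 1"
        unfolding norm_mult by (rule mult_mono[OF m[OF z] norm_unit_seq[OF z] m0 norm_ge_zero])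
      thus "norm (b z * unit_seq n z) \<le> m" by simp
    qed
    have op: "bounded_op (?U n)" for n by (rule H_op[OF C0])
    have "convergent (\<lambda>n. ?U n x)" for x
    proof (rule bounded_ops_convergent[OF op le _ dense_range_R])
      show "0 \<le> K * m" using K(1) m0 by simp
      fix s assume "s \<in> range R"
      then obtain y where "s = R y" by blast
      thus "convergent (\<lambda>n. ?U n s)" using convergentI[OF ext_cal_on_range[OF b]] by simp
    qed
    hence lim: "(\<lambda>n. ?U n x) \<longlonglongrightarrow> ext_cal b x" for x
      unfolding ext_cal_def by (simp only: convergent_LIMSEQ_iff)
    show "(\<lambda>n. ?U n x) \<longlonglongrightarrow> ext_cal b x \<and> bounded_op (ext_cal b) \<and> norm (ext_cal b x) \<le> K * m * norm x"
      using lim bounded_op_limit[OF op le tendsto_const lim] by blast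
  qed
qed

lemma
  assumes b: "b \<in> BC"
  shows ext_cal_lim: "(\<lambda>n. H (\<lambda>z. b z * unit_seq n z) x) \<longlonglongrightarrow> ext_cal b x"
    and ext_cal_op: "bounded_op (ext_cal b)"
proof -
  obtain m where m: "\<And>z. z \<in> iR \<Longrightarrow> norm (b z) \<le> m" using b unfolding BC_def by blast
  show "(\<lambda>n. H (\<lambda>z. b z * unit_seq n z) x) \<longlonglongrightarrow> ext_cal b x" "bounded_op (ext_cal b)"
    using ext_cal_bounded b m by metis+
qed

lemma ext_cal_R: "b \<in> BC \<Longrightarrow> ext_cal b (R y) = H (\<lambda>z. b z * rz 1 z) y"
  by (rule LIMSEQ_unique[OF ext_cal_lim ext_cal_on_range])

lemma ext_cal_add:
  assumes b: "b \<in> BC" and c: "c \<in> BC"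
  shows "ext_cal (\<lambda>z. b z + c z) x = ext_cal b x + ext_cal c x"
proof (rule LIMSEQ_unique[OF ext_cal_lim[OF BC_add[OF b c]]])
  have "H (\<lambda>z. (b z + c z) * unit_seq n z) x
      = H (\<lambda>z. b z * unit_seq n z) x + H (\<lambda>z. c z * unit_seq n z) x" for n
    unfolding distrib_right by (rule bounded_alg_hom_add[OF hom BC_C0[OF b unit_seq_C0] BC_C0[OF c unit_seq_C0]])
  thus "(\<lambda>n. H (\<lambda>z. (b z + c z) * unit_seq n z) x) \<longlonglongrightarrow> ext_cal b x + ext_cal c x"
    by (simp only: tendsto_add[OF ext_cal_lim[OF b] ext_cal_lim[OF c]])
qed

lemma ext_cal_scale:
  assumes b: "b \<in> BC"
  shows "ext_cal (\<lambda>z. k * b z) x = cscale k (ext_cal b x)"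
proof (rule LIMSEQ_unique[OF ext_cal_lim[OF BC_mult[OF BC_const b]]])
  have "H (\<lambda>z. k * b z * unit_seq n z) x = cscale k (H (\<lambda>z. b z * unit_seq n z) x)" for n
    unfolding mult.assoc by (rule bounded_alg_hom_scale[OF hom BC_C0[OF b unit_seq_C0]])
  thus "(\<lambda>n. H (\<lambda>z. k * b z * unit_seq n z) x) \<longlonglongrightarrow> cscale k (ext_cal b x)"
    by (simp only: bounded_linear.tendsto[OF bounded_linear_cscale ext_cal_lim[OF b]])
qed

text \<open>Tested on the range of \<open>R\<close> squared: each of \<open>b\<close> and
  \<open>c\<close> absorbs one factor \<open>rz 1\<close>, after which multiplicativity of
  \<open>H\<close> on \<open>C0_iR\<close> applies.\<close>

lemma ext_cal_mult:
  assumes b: "b \<in> BC" and c: "c \<in> BC"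
  shows "ext_cal (\<lambda>z. b z * c z) = ext_cal b \<circ> ext_cal c"
proof (rule bounded_op_eq_on_dense)
  show "bounded_op (ext_cal (\<lambda>z. b z * c z))" by (rule ext_cal_op[OF BC_mult[OF b c]])
  show "bounded_op (ext_cal b \<circ> ext_cal c)" by (rule bounded_op_comp[OF ext_cal_op[OF b] ext_cal_op[OF c]])
  show "closure (R ` range R) = UNIV" by (rule dense_image[OF R_op dense_range_R dense_range_R])
  fix x assume "x \<in> R ` range R"
  then obtain y where x: "x = R (R y)" by blast
  let ?b = "\<lambda>z. b z * rz 1 z" and ?c = "\<lambda>z. c z * rz 1 z"
  note C0 = BC_C0[OF b r1_C0] BC_C0[OF c r1_C0] BC_C0[OF BC_mult[OF b c] r1_C0]
  have "H ?c (R y) = R (H ?c y)"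
    unfolding R_def H_mult[OF C0(2) r1_C0, symmetric] H_mult[OF r1_C0 C0(2), symmetric]
    by (simp only: mult.commute)
  hence "ext_cal b (ext_cal c x) = H ?b (H ?c y)" by (simp only: x ext_cal_R[OF c] ext_cal_R[OF b])
  also have "\<dots> = H (\<lambda>z. ?b z * ?c z) y" by (rule H_mult[OF C0(1,2), symmetric])
  also have "(\<lambda>z. ?b z * ?c z) = (\<lambda>z. (b z * c z * rz 1 z) * rz 1 z)" by (simp only: mult_ac)
  also have "H (\<lambda>z. (b z * c z * rz 1 z) * rz 1 z) y = ext_cal (\<lambda>z. b z * c z) x"
    unfolding x ext_cal_R[OF BC_mult[OF b c]] unfolding R_def H_mult[OF C0(3) r1_C0] by (rule refl)
  finally show "ext_cal (\<lambda>z. b z * c z) x = (ext_cal b \<circ> ext_cal c) x" by simp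
qed

text \<open>The boundary value coincides with \<open>rz w\<close> on \<open>iR\<close> only.
  Multiplied by \<open>rz 1\<close>, both functions lie in \<open>C0_iR\<close>, where
  \<open>H\<close> depends on the values on \<open>iR\<close> alone.\<close>

lemma ext_cal_boundary_value_rz:
  assumes w: "w \<in> rhp"
  shows "ext_cal (boundary_value (rz w)) = H (rz w)"
proof (rule bounded_op_eq_on_dense[OF _ _ dense_range_R])
  have w': "w \<notin> iR" using w by (simp add: rhp_def iR_def)
  note b = BC_boundary_value[OF rz_in_B_alg[OF w]]
  show "bounded_op (ext_cal (boundary_value (rz w)))" by (rule ext_cal_op[OF b])
  show "bounded_op (H (rz w))" by (rule H_op[OF rz_in_C0_iR[OF w']])
  fix x assume "x \<in> range R"
  then obtain y where x: "x = R y" by blast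
  have "H (\<lambda>z. boundary_value (rz w) z * rz 1 z) = H (\<lambda>z. rz w z * rz 1 z)"
    by (rule bounded_alg_hom_C0_cong[OF hom BC_C0[OF b r1_C0] C0_iR_mult[OF rz_in_C0_iR[OF w'] r1_C0]])
      (simp only: boundary_value_rz[OF w])
  thus "ext_cal (boundary_value (rz w)) x = H (rz w) x"
    unfolding x ext_cal_R[OF b] by (simp only: H_mult[OF rz_in_C0_iR[OF w'] r1_C0] R_def)
qed

lemma ext_cal_bounded_alg_hom: "bounded_alg_hom B_alg B_norm (\<lambda>f. ext_cal (boundary_value f))"
  unfolding bounded_alg_hom_def
proof (intro conjI ballI allI)
  show "bounded_op (ext_cal (boundary_value f))" if "f \<in> B_alg" for f by (rule ext_cal_op[OF BC_boundary_value[OF that]])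
  show "ext_cal (boundary_value (\<lambda>z. f z + g z)) = (\<lambda>x. ext_cal (boundary_value f) x + ext_cal (boundary_value g) x)"
    if "f \<in> B_alg" "g \<in> B_alg" for f g
    unfolding boundary_value_add[OF that] by (rule ext) (rule ext_cal_add[OF BC_boundary_value[OF that(1)] BC_boundary_value[OF that(2)]])
  show "ext_cal (boundary_value (\<lambda>z. c * f z)) = (\<lambda>x. cscale c (ext_cal (boundary_value f) x))" if "f \<in> B_alg" for c f
    unfolding boundary_value_scale[OF that] by (rule ext) (rule ext_cal_scale[OF BC_boundary_value[OF that]])
  show "ext_cal (boundary_value (\<lambda>z. f z * g z)) = ext_cal (boundary_value f) \<circ> ext_cal (boundary_value g)"
    if "f \<in> B_alg" "g \<in> B_alg" for f g
    unfolding boundary_value_mult[OF that] by (rule ext_cal_mult[OF BC_boundary_value[OF that(1)] BC_boundary_value[OF that(2)]])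
  obtain K where K: "K \<ge> 0"
    "\<And>b m x. b \<in> BC \<Longrightarrow> (\<And>z. z \<in> iR \<Longrightarrow> norm (b z) \<le> m) \<Longrightarrow>
      (\<lambda>n. H (\<lambda>z. b z * unit_seq n z) x) \<longlonglongrightarrow> ext_cal b x \<and>
      bounded_op (ext_cal b) \<and> norm (ext_cal b x) \<le> K * m * norm x"
    using ext_cal_bounded by blast
  show "\<exists>C. \<forall>f\<in>B_alg. onorm (ext_cal (boundary_value f)) \<le> C * B_norm f"
  proof (intro exI[of _ K] ballI onorm_bound)
    fix f assume f: "f \<in> B_alg"
    show "0 \<le> K * B_norm f" using K(1) B_norm_nonneg[OF f] by simp
    show "norm (ext_cal (boundary_value f) x) \<le> K * B_norm f * norm x" for x
      by (rule K(2)[OF BC_boundary_value[OF f] boundary_value_bound[OF f], THEN conjunct2, THEN conjunct2])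
  qed
qed

lemma B_calculus_hom:
  "\<exists>\<Phi>. bounded_alg_hom B_alg B_norm \<Phi> \<and> (\<forall>z\<in>rhp. is_inverse_shift D A z (\<Phi> (rz z)))"
proof (intro exI[of _ "\<lambda>f. ext_cal (boundary_value f)"] conjI ballI ext_cal_bounded_alg_hom)
  fix z assume z: "z \<in> rhp"
  hence "z \<notin> iR" by (simp add: rhp_def iR_def)
  from inverse[OF this] show "is_inverse_shift D A z (ext_cal (boundary_value (rz z)))"
    unfolding ext_cal_boundary_value_rz[OF z] .
qed

end

lemma iR_subset_closure_rhp: "iR \<subseteq> closure rhp"
proof
  fix z assume z: "z \<in> iR"
  show "z \<in> closure rhp"
    unfolding closure_sequential
    by (intro exI[of _ "\<lambda>n. near n z"] conjI allI near_in_rhp near_tendsto[OF z])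
qed

theorem mainTheorem14:
  fixes T :: "real \<Rightarrow> 'a::complex_banach \<Rightarrow> 'a"
    and D :: "'a set" and A :: "'a \<Rightarrow> 'a"
  assumes "bounded_C0_group T"
    and "is_generator T D (\<lambda>x. - A x)"
  shows "admits_B_calculus D A \<longleftrightarrow> admits_C0_calculus D A"
proof
  assume B: "admits_B_calculus D A"
  then obtain \<Phi> where "bounded_alg_hom B_alg B_norm \<Phi>" "\<And>z. z \<in> rhp \<Longrightarrow> is_inverse_shift D A z (\<Phi> (rz z))"
    unfolding admits_B_calculus_def by blast
  moreover have "densely_defined D" using B by (simp add: admits_B_calculus_def)
  ultimately have "group_B_calculus T D A \<Phi>" by (intro group_B_calculus.intro assms)
  thus "admits_C0_calculus D A" by (rule group_B_calculus.admits_C0)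
next
  assume C: "admits_C0_calculus D A"
  then obtain H where "bounded_alg_hom C0_iR sup_norm_iR H" "\<And>z. z \<notin> iR \<Longrightarrow> is_inverse_shift D A z (H (rz z))"
    unfolding admits_C0_calculus_def by blast
  moreover have D: "densely_defined D" using C by (simp add: admits_C0_calculus_def)
  ultimately have "C0_calculus D A H" by (intro C0_calculus.intro)
  from C0_calculus.B_calculus_hom[OF this]
  obtain \<Phi> where "bounded_alg_hom B_alg B_norm \<Phi>" "\<forall>z\<in>rhp. is_inverse_shift D A z (\<Phi> (rz z))" by blast
  moreover have "spectrum_op D A \<subseteq> closure rhp"
    using C iR_subset_closure_rhp by (auto simp: admits_C0_calculus_def)
  ultimately show "admits_B_calculus D A" unfolding admits_B_calculus_def using D by blast
qed

end
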